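(* Let $q\ge 2$ be an integer, and put $n=q^2+q+1$. If $G$ is a connected $C_4$-free graph on $n$ vertices satisfying $$e(G)\le \tfrac12 q(q+1)^2,$$ then $\tau(G)\le n^{(n-3)/2}$. Equality holds if and only if $G$ is an orthogonal polarity graph (arising from a projective plane of order $q$).
   Context: All graphs are finite and simple. $e(G)$ is the number of edges of $G$ and $\tau(G)$ is the number of spanning trees of $G$. A graph is $C_4$-free if it contains no subgraph (not necessarily induced) isomorphic to the 4-cycle $C_4$. Being an orthogonal polarity graph is understood up to graph isomorphism. A projective plane is an incidence structure of points and lines in which any two distinct points lie on a unique line, any two distinct lines meet in a unique point, and there exist four points no three of which are collinear. It has order $q$ if every line contains exactly $q+1$ points; it then has $q^2+q+1$ points and $q^2+q+1$ lines. Let $\Pi$ be a finite projective plane of order $q$ with point set $\mathcal P$ and line set $\mathcal L$. A polarity $\varphi$ of $\Pi$ is a bijection $\varphi:\mathcal P\cup\mathcal L\to\mathcal P\cup\mathcal L$ with $\varphi(\mathcal P)=\mathcal L$, $\varphi(\mathcal L)=\mathcal P$, $\varphi^2$ the identity, and, for every point $x$ and line $\ell$, $x\in\ell$ if and only if $\varphi(\ell)\in\varphi(x)$. A point $x$ is absolute if $x\in\varphi(x)$. The polarity graph $G(\varphi)$ is the simple graph with vertex set $\mathcal P$ in which two distinct points $x,y$ are adjacent if and only if $x\in\varphi(y)$. The polarity $\varphi$ is orthogonal if it has exactly $q+1$ absolute points, and then $G(\varphi)$ is called an orthogonal polarity graph. *)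

theory Defs
  imports Complex_Main "Graph_Theory.Graph_Theory"
begin

text \<open>
  A finite simple graph is a \<^locale>\<open>pair_graph\<close>: a symmetric irreflexive relation on a finite
  vertex set, so that an undirected edge is represented by two opposite arcs.
\<close>

definition edges :: "'a pair_pre_digraph \<Rightarrow> 'a set set" where
  "edges G = {{u, v} | u v. (u, v) \<in> parcs G}"

text \<open>
  The library predicates \<^const>\<open>forest\<close> and \<^const>\<open>spanning_tree\<close> speak about directed cycles: on a
  symmetric digraph every edge already gives a directed cycle of length 2. The cycles of the
  underlying undirected graph are exactly the directed cycles of length at least 3.
\<close>

definition acyclic_graph :: "'a pair_pre_digraph \<Rightarrow> bool" where
  "acyclic_graph T \<longleftrightarrow> \<not> (\<exists>p. pre_digraph.cycle T p \<and> 3 \<le> length p)"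

definition undirected_spanning_tree :: "'a pair_pre_digraph \<Rightarrow> 'a pair_pre_digraph \<Rightarrow> bool" where
  "undirected_spanning_tree T G \<longleftrightarrow>
     pair_graph T \<and> spanning T G \<and> Digraph_Component.connected T \<and> acyclic_graph T"

definition num_spanning_trees :: "'a pair_pre_digraph \<Rightarrow> nat" where
  "num_spanning_trees G = card {T. undirected_spanning_tree T G}"

definition four_cycle :: "nat pair_pre_digraph" where
  "four_cycle = \<lparr> pverts = {0, 1, 2, 3},
     parcs = {(0, 1), (1, 0), (1, 2), (2, 1), (2, 3), (3, 2), (3, 0), (0, 3)} \<rparr>"

definition C4_free :: "'a pair_pre_digraph \<Rightarrow> bool" where
  "C4_free G \<longleftrightarrow> \<not> (\<exists>H :: 'a pair_pre_digraph. subgraph H G \<and> digraph_iso H four_cycle)"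

locale projective_plane =
  fixes P :: "'p set" and L :: "'l set" and inc :: "'p \<Rightarrow> 'l \<Rightarrow> bool"
  assumes unique_line:
      "\<lbrakk>x \<in> P; y \<in> P; x \<noteq> y\<rbrakk> \<Longrightarrow> \<exists>!l. l \<in> L \<and> inc x l \<and> inc y l"
    and unique_point:
      "\<lbrakk>l \<in> L; m \<in> L; l \<noteq> m\<rbrakk> \<Longrightarrow> \<exists>!x. x \<in> P \<and> inc x l \<and> inc x m"
    and quadrangle:
      "\<exists>Q \<subseteq> P. card Q = 4 \<and> \<not> (\<exists>T \<subseteq> Q. card T = 3 \<and> (\<exists>l \<in> L. \<forall>x \<in> T. inc x l))"

locale finite_projective_plane = projective_plane P L inc
  for P :: "'p set" and L :: "'l set" and inc :: "'p \<Rightarrow> 'l \<Rightarrow> bool" +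
  fixes q :: nat
  assumes finite_points: "finite P"
    and finite_lines: "finite L"
    and order: "l \<in> L \<Longrightarrow> card {x \<in> P. inc x l} = q + 1"

text \<open>
  Points and lines may have different types, so a polarity acts on their disjoint sum:
  \<open>Inl\<close> marks points, \<open>Inr\<close> marks lines.
\<close>

definition polarity ::
  "'p set \<Rightarrow> 'l set \<Rightarrow> ('p \<Rightarrow> 'l \<Rightarrow> bool) \<Rightarrow> ('p + 'l \<Rightarrow> 'p + 'l) \<Rightarrow> bool" where
  "polarity P L inc \<phi> \<longleftrightarrow>
     bij_betw \<phi> (P <+> L) (P <+> L) \<and>
     \<phi> ` Inl ` P = Inr ` L \<and> \<phi> ` Inr ` L = Inl ` P \<and>
     (\<forall>z \<in> P <+> L. \<phi> (\<phi> z) = z) \<and>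
     (\<forall>x \<in> P. \<forall>l \<in> L. inc x l \<longleftrightarrow> inc (projl (\<phi> (Inr l))) (projr (\<phi> (Inl x))))"

definition absolute_points ::
  "'p set \<Rightarrow> ('p \<Rightarrow> 'l \<Rightarrow> bool) \<Rightarrow> ('p + 'l \<Rightarrow> 'p + 'l) \<Rightarrow> 'p set" where
  "absolute_points P inc \<phi> = {x \<in> P. inc x (projr (\<phi> (Inl x)))}"

definition polarity_graph ::
  "'p set \<Rightarrow> ('p \<Rightarrow> 'l \<Rightarrow> bool) \<Rightarrow> ('p + 'l \<Rightarrow> 'p + 'l) \<Rightarrow> 'p pair_pre_digraph" where
  "polarity_graph P inc \<phi> = \<lparr> pverts = P,
     parcs = {(x, y). x \<in> P \<and> y \<in> P \<and> x \<noteq> y \<and> inc x (projr (\<phi> (Inl y)))} \<rparr>"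

definition orthogonal_polarity ::
  "'p set \<Rightarrow> 'l set \<Rightarrow> ('p \<Rightarrow> 'l \<Rightarrow> bool) \<Rightarrow> nat \<Rightarrow> ('p + 'l \<Rightarrow> 'p + 'l) \<Rightarrow> bool" where
  "orthogonal_polarity P L inc q \<phi> \<longleftrightarrow>
     polarity P L inc \<phi> \<and> card (absolute_points P inc \<phi>) = q + 1"

text \<open>
  The plane is quantified existentially, so its carrier types have to be chosen. Every finite
  plane is isomorphic to one whose points and lines are natural numbers, so this choice loses
  nothing; see \<open>orthogonal_polarity_graphI\<close> below.
\<close>

definition orthogonal_polarity_graph :: "nat \<Rightarrow> 'a pair_pre_digraph \<Rightarrow> bool" where
  "orthogonal_polarity_graph q G \<longleftrightarrow>
     (\<exists>(P :: nat set) (L :: nat set) inc \<phi>.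
        finite_projective_plane P L inc q \<and> orthogonal_polarity P L inc q \<phi> \<and>
        digraph_iso G (polarity_graph P inc \<phi>))"

lemma orthogonal_polarity_graphI:
  fixes P :: "'p set" and L :: "'l set" and G :: "'a pair_pre_digraph"
  assumes plane: "finite_projective_plane P L inc q"
    and pol: "orthogonal_polarity P L inc q \<phi>"
    and iso: "digraph_iso G (polarity_graph P inc \<phi>)"
  shows "orthogonal_polarity_graph q G"
proof -
  interpret finite_projective_plane P L inc q by (rule plane)
  obtain f :: "'p \<Rightarrow> nat" where f: "inj_on f P"
    using finite_imp_inj_to_nat_seg[OF finite_points] by blast
  obtain g :: "'l \<Rightarrow> nat" where g: "inj_on g L"
    using finite_imp_inj_to_nat_seg[OF finite_lines] by blast
  define f' where "f' = the_inv_into P f"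
  define g' where "g' = the_inv_into L g"
  have f'f: "f' (f x) = x" if "x \<in> P" for x using f that by (simp add: f'_def the_inv_into_f_f)
  have g'g: "g' (g x) = x" if "x \<in> L" for x using g that by (simp add: g'_def the_inv_into_f_f)
  define I where "I a b = inc (f' a) (g' b)" for a b
  define \<psi> where "\<psi> z = map_sum f g (\<phi> (map_sum f' g' z))" for z
  have I: "I (f x) (g l) = inc x l" if "x \<in> P" "l \<in> L" for x l
    using that by (simp add: I_def f'f g'g)
  have inv: "\<forall>z \<in> P <+> L. \<phi> (\<phi> z) = z"
    and im: "\<phi> ` Inl ` P = Inr ` L" "\<phi> ` Inr ` L = Inl ` P"
    and pi: "\<forall>x \<in> P. \<forall>l \<in> L. inc x l \<longleftrightarrow> inc (projl (\<phi> (Inr l))) (projr (\<phi> (Inl x)))"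
    and abs: "card (absolute_points P inc \<phi>) = q + 1"
    using pol by (auto simp: orthogonal_polarity_def polarity_def)
  define p where "p x = projr (\<phi> (Inl x))" for x
  define r where "r l = projl (\<phi> (Inr l))" for l
  have p: "\<phi> (Inl x) = Inr (p x)" "p x \<in> L" if "x \<in> P" for x
  proof -
    have "\<phi> (Inl x) \<in> Inr ` L" using that im by blast
    then show "\<phi> (Inl x) = Inr (p x)" "p x \<in> L" by (auto simp: p_def)
  qed
  have r: "\<phi> (Inr l) = Inl (r l)" "r l \<in> P" if "l \<in> L" for l
  proof -
    have "\<phi> (Inr l) \<in> Inl ` P" using that im by blast
    then show "\<phi> (Inr l) = Inl (r l)" "r l \<in> P" by (auto simp: r_def)
  qed
  have rp: "r (p x) = x" if "x \<in> P" for x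
    using inv[rule_format, of "Inl x"] p[OF that] r[of "p x"] that by (simp add: InlI)
  have pr: "p (r l) = l" if "l \<in> L" for l
    using inv[rule_format, of "Inr l"] r[OF that] p[of "r l"] that by (simp add: InrI)
  have \<psi>: "\<psi> (Inl (f x)) = Inr (g (p x))" if "x \<in> P" for x
    using that by (simp add: \<psi>_def f'f p)
  have \<psi>': "\<psi> (Inr (g l)) = Inl (f (r l))" if "l \<in> L" for l
    using that by (simp add: \<psi>_def g'g r)
  have fe: "f x = f y \<longleftrightarrow> x = y" if "x \<in> P" "y \<in> P" for x y using f that by (auto dest: inj_onD)
  have ge: "g x = g y \<longleftrightarrow> x = y" if "x \<in> L" "y \<in> L" for x y using g that by (auto dest: inj_onD)
  have "finite_projective_plane (f ` P) (g ` L) I q"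
  proof
    fix x y assume "x \<in> f ` P" "y \<in> f ` P" "x \<noteq> y"
    then obtain a b where ab: "a \<in> P" "b \<in> P" "a \<noteq> b" "x = f a" "y = f b" by auto
    then obtain l where l: "l \<in> L" "inc a l" "inc b l"
      and u: "\<And>m. m \<in> L \<Longrightarrow> inc a m \<Longrightarrow> inc b m \<Longrightarrow> m = l"
      using unique_line[of a b] by blast
    show "\<exists>!l. l \<in> g ` L \<and> I x l \<and> I y l"
    proof (rule ex1I[of _ "g l"])
      show "g l \<in> g ` L \<and> I x (g l) \<and> I y (g l)" using l ab I by simp
      fix m assume m: "m \<in> g ` L \<and> I x m \<and> I y m"
      then obtain k where "k \<in> L" "m = g k" by blast
      then show "m = g l" using u[of k] m ab I by simp
    qed
  next
    fix x y assume "x \<in> g ` L" "y \<in> g ` L" "x \<noteq> y"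
    then obtain a b where ab: "a \<in> L" "b \<in> L" "a \<noteq> b" "x = g a" "y = g b" by auto
    then obtain l where l: "l \<in> P" "inc l a" "inc l b"
      and u: "\<And>m. m \<in> P \<Longrightarrow> inc m a \<Longrightarrow> inc m b \<Longrightarrow> m = l"
      using unique_point[of a b] by blast
    show "\<exists>!z. z \<in> f ` P \<and> I z x \<and> I z y"
    proof (rule ex1I[of _ "f l"])
      show "f l \<in> f ` P \<and> I (f l) x \<and> I (f l) y" using l ab I by simp
      fix m assume m: "m \<in> f ` P \<and> I m x \<and> I m y"
      then obtain k where "k \<in> P" "m = f k" by blast
      then show "m = f l" using u[of k] m ab I by simp
    qed
  next
    obtain Q where Q: "Q \<subseteq> P" "card Q = 4"
      and Q': "\<not> (\<exists>T \<subseteq> Q. card T = 3 \<and> (\<exists>l \<in> L. \<forall>x \<in> T. inc x l))"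
      using quadrangle by (elim exE conjE)
    have "\<not> (\<exists>T \<subseteq> f ` Q. card T = 3 \<and> (\<exists>l \<in> g ` L. \<forall>x \<in> T. I x l))"
    proof
      assume "\<exists>T \<subseteq> f ` Q. card T = 3 \<and> (\<exists>l \<in> g ` L. \<forall>x \<in> T. I x l)"
      then obtain T l where T: "T \<subseteq> Q" "card (f ` T) = 3" "l \<in> L" "\<forall>x \<in> T. I (f x) (g l)"
        unfolding subset_image_iff bex_simps by blast
      have "card T = 3" using T Q f by (metis card_image inj_on_subset subset_trans)
      moreover have "\<forall>x\<in>T. inc x l" using T Q I by blast
      ultimately show False using Q' T(1,3) by blast
    qed
    moreover have "card (f ` Q) = 4" using Q f by (metis card_image inj_on_subset)
    moreover have "f ` Q \<subseteq> f ` P" using Q by (simp add: image_mono)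
    ultimately show "\<exists>Q \<subseteq> f ` P. card Q = 4 \<and>
        \<not> (\<exists>T \<subseteq> Q. card T = 3 \<and> (\<exists>l \<in> g ` L. \<forall>x \<in> T. I x l))"
      by (intro exI[of _ "f ` Q"] conjI)
  next
    fix l assume "l \<in> g ` L"
    then obtain m where m: "m \<in> L" "l = g m" by auto
    have "{x \<in> f ` P. I x l} = f ` {x \<in> P. inc x m}" using m I by auto
    moreover have "inj_on f {x \<in> P. inc x m}" using f by (auto intro: inj_on_subset)
    ultimately show "card {x \<in> f ` P. I x l} = q + 1"
      using order[OF m(1)] by (simp add: card_image)
  qed (use finite_points finite_lines in auto)
  moreover have "orthogonal_polarity (f ` P) (g ` L) I q \<psi>"
  proof -
    have inv': "\<psi> (\<psi> z) = z" "\<psi> z \<in> f ` P <+> g ` L" if "z \<in> f ` P <+> g ` L" for z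
      using that by (auto simp: \<psi> \<psi>' p r pr rp)
    have "bij_betw \<psi> (f ` P <+> g ` L) (f ` P <+> g ` L)"
      by (rule bij_betw_byWitness[where f' = \<psi>]) (use inv' in auto)
    moreover have "\<psi> ` Inl ` f ` P = Inr ` g ` L"
    proof -
      have "p ` P = L" using p(2) r(2) pr by (metis image_eqI image_subsetI subsetI subset_antisym)
      moreover have "\<psi> ` Inl ` f ` P = Inr ` g ` p ` P"
        unfolding image_image by (rule image_cong) (simp_all add: \<psi>)
      ultimately show ?thesis by simp
    qed
    moreover have "\<psi> ` Inr ` g ` L = Inl ` f ` P"
    proof -
      have "r ` L = P" using p(2) r(2) rp by (metis image_eqI image_subsetI subsetI subset_antisym)
      moreover have "\<psi> ` Inr ` g ` L = Inl ` f ` r ` L"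
        unfolding image_image by (rule image_cong) (simp_all add: \<psi>')
      ultimately show ?thesis by simp
    qed
    moreover have "\<forall>x \<in> f ` P. \<forall>l \<in> g ` L.
        I x l \<longleftrightarrow> I (projl (\<psi> (Inr l))) (projr (\<psi> (Inl x)))"
      using pi by (auto simp: \<psi> \<psi>' I p r)
    moreover have "absolute_points (f ` P) I \<psi> = f ` absolute_points P inc \<phi>"
      by (auto simp: absolute_points_def \<psi> I p)
    moreover have "inj_on f (absolute_points P inc \<phi>)"
      by (rule inj_on_subset[OF f]) (auto simp: absolute_points_def)
    ultimately show ?thesis
      using inv' abs by (simp add: orthogonal_polarity_def polarity_def card_image)
  qed
  moreover have "digraph_iso (polarity_graph P inc \<phi>) (polarity_graph (f ` P) I \<psi>)"
  proof -
    let ?h = "\<lparr>iso_verts = f, iso_arcs = map_prod f f, iso_head = snd, iso_tail = fst\<rparr>"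
    have "pre_digraph.digraph_isomorphism (polarity_graph P inc \<phi>) ?h"
      unfolding pre_digraph.digraph_isomorphism_def
      by (auto simp: polarity_graph_def wf_digraph_def f inj_on_def fe)
    moreover have "with_proj (polarity_graph (f ` P) I \<psi>) = app_iso ?h (polarity_graph P inc \<phi>)"
      by (auto simp: app_iso_def with_proj_def polarity_graph_def \<psi> I p fe image_iff)
    ultimately show ?thesis unfolding digraph_iso_def by blast
  qed
  then have "digraph_iso G (polarity_graph (f ` P) I \<psi>)"
    using iso by (rule digraph_iso_trans[rotated])
  ultimately show ?thesis unfolding orthogonal_polarity_graph_def by blast
qed

end

theory Submission
  imports Defs "HOL-Library.FuncSet" "Jordan_Normal_Form.Schur_Decomposition"
begin

text \<open>
  Put \<open>Q = q + 1\<close>, let \<open>D i\<close> be the degree of \<open>i\<close> if this is at least \<open>2 Q\<close> and \<open>Q\<close> otherwise, and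
  let \<open>P\<close> be the stochastic matrix \<open>1 - D\<inverse> L\<close>, \<open>L\<close> the Laplacian. By the matrix tree
  theorem the number of spanning trees is, up to explicit factors, the product of \<open>1 - x\<close> over the
  eigenvalues \<open>x\<close> of \<open>P\<close> other than the trivial eigenvalue 1. In an orthogonal polarity graph these
  are \<open>\<plusminus>r\<close> with \<open>r\<^sup>2 = q / Q\<^sup>2\<close>, so \<open>ln (1 - x)\<close> is bounded by the cubic that touches it at
  \<open>\<plusminus>r\<close>. This leaves the traces of \<open>P\<close>, \<open>P\<^sup>2\<close>, \<open>P\<^sup>3\<close> to be bounded below. The first is controlled
  by the number of edges, the second by the degrees. The third counts triangles: in a graph without
  4-cycles every edge lies in at most one triangle, and the edges in no triangle are among the pairs
  without a common neighbour, whose number is determined by the degrees. What remains is a sum of one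
  nonpositive term per vertex. Equality forces all eigenvalues to be \<open>\<plusminus>r\<close>, which says that the
  adjacency matrix with a diagonal entry 1 at each vertex of degree \<open>q\<close> squares to \<open>J + q I\<close>.
\<close>

section \<open>Cubic Hermite interpolation of the logarithm\<close>

text \<open>Four conditions (value and slope at \<open>r\<close> and at \<open>-r\<close>) force
  degree three. The coefficients of x, x^2 and x^3 are all negative in the range used, which is why
  lower bounds for the traces suffice. The trivial eigenvalue 1, where the logarithm is infinite, is
  moved to \<open>r\<close> by a rank one correction: the cubic is exact there, so nothing is lost.

  The cutoff 2 Q in \<open>D\<close> answers an obstacle. With \<open>D i = Q\<close> a vertex of
  degree Q - p contributes -p (p - 1) (1 / (2 n) + c (p - 1) / Q^3), where c is the cubic
  coefficient. Since p is an integer, p (p - 1) is nonnegative and vanishes only at the extremal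
  degrees Q and Q - 1, but the bracket turns negative once p is far below -Q. It is still positive
  for p >= 1 - Q, that is, for degree below 2 Q. From degree 2 Q on the vertex is normalised by its
  own degree, and then the logarithm gained is smaller than the linear loss. The bound on the edges
  enters once, as a lower bound for the sum of all Q - deg, and pays for the linear terms.\<close>

definition cubic_coeff :: "real \<Rightarrow> real" where
  "cubic_coeff r = (r / (1 - r\<^sup>2) - ln ((1 + r) / (1 - r)) / 2) / (2 * r ^ 3)"

definition linear_coeff :: "real \<Rightarrow> real" where
  "linear_coeff r = 1 / (1 - r\<^sup>2) - 3 * cubic_coeff r * r\<^sup>2"

text \<open>Matching the slopes of ln (1 - x) at \<open>r\<close> and \<open>-r\<close> forces the
  quadratic coefficient and the relation that defines \<open>linear_coeff\<close>. Matching the odd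
  part at \<open>r\<close>, which is -artanh r, then determines \<open>cubic_coeff\<close>; the
  logarithm in its definition is artanh r.\<close>

definition hermite_ln :: "real \<Rightarrow> real \<Rightarrow> real" where
  "hermite_ln r x = ln (1 - r\<^sup>2) / 2 + r\<^sup>2 / (2 * (1 - r\<^sup>2)) - linear_coeff r * x - x\<^sup>2 / (2 * (1 - r\<^sup>2)) - cubic_coeff r * x ^ 3"

text \<open>All sides vanish at 0, so derivatives are compared, that of artanh being 1 / (1 - x^2).
  The lower bound is a truncated power series. The upper bound is shaped to give exactly
  \<open>1 / 3 \<le> cubic_coeff r\<close>.\<close>

lemma artanh_bounds:
  fixes r :: real
  assumes "0 < r" "r < 1"
  shows "r + r ^ 3 / 3 + r ^ 5 / 5 \<le> ln ((1 + r) / (1 - r)) / 2"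
    and "ln ((1 + r) / (1 - r)) / 2 \<le> r / (1 - r\<^sup>2) - 2 * r ^ 3 / 3"
proof -
  have pos: "0 < 1 - x\<^sup>2" if "0 \<le> x" "x \<le> r" for x :: real
    using power_strict_mono[of x 1 2] that assms by simp
  have D: "((\<lambda>x. ln ((1 + x) / (1 - x)) / 2) has_real_derivative 1 / (1 - x\<^sup>2)) (at x)"
    if "0 \<le> x" "x \<le> r" for x
  proof -
    have "((\<lambda>x. (ln (1 + x) - ln (1 - x)) / 2) has_real_derivative (1 / (1 + x) + 1 / (1 - x)) / 2) (at x)"
      using that assms by (auto intro!: derivative_eq_intros)
    moreover have "(1 / (1 + x) + 1 / (1 - x)) / 2 = 1 / (1 - x\<^sup>2)"
      using that assms pos[OF that] by (simp add: field_simps power2_eq_square)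
    moreover have ev: "\<forall>\<^sub>F y in nhds x. (ln (1 + y) - ln (1 - y)) / 2 = ln ((1 + y) / (1 - y)) / 2"
    proof -
      have "\<forall>\<^sub>F y in nhds x. y \<in> {-1<..<1}" using that assms by (intro eventually_nhds_in_open) auto
      then show ?thesis by eventually_elim (simp add: ln_div)
    qed
    ultimately show ?thesis by (simp only: DERIV_cong_ev[OF refl ev refl, symmetric])
  qed
  let ?f = "\<lambda>x. ln ((1 + x) / (1 - x)) / 2 - (x + x ^ 3 / 3 + x ^ 5 / 5)"
  have "?f 0 \<le> ?f r"
  proof (rule DERIV_nonneg_imp_nondecreasing[of 0 r ?f])
    fix x assume x: "0 \<le> x" "x \<le> r"
    have "(?f has_real_derivative 1 / (1 - x\<^sup>2) - (1 + x\<^sup>2 + x ^ 4)) (at x)"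
      by (rule DERIV_diff[OF D[OF x]]) (auto intro!: derivative_eq_intros)
    moreover have "(1 + x\<^sup>2 + x ^ 4) * (1 - x\<^sup>2) \<le> 1" by (simp add: algebra_simps flip: power_add)
    then have "0 \<le> 1 / (1 - x\<^sup>2) - (1 + x\<^sup>2 + x ^ 4)" using pos[OF x] by (simp add: pos_le_divide_eq)
    ultimately show "\<exists>y. (?f has_real_derivative y) (at x) \<and> 0 \<le> y" by blast
  qed (use assms in simp)
  then show "r + r ^ 3 / 3 + r ^ 5 / 5 \<le> ln ((1 + r) / (1 - r)) / 2" by simp
  let ?g = "\<lambda>x. x / (1 - x\<^sup>2) - 2 * x ^ 3 / 3 - ln ((1 + x) / (1 - x)) / 2"
  have "?g 0 \<le> ?g r"
  proof (rule DERIV_nonneg_imp_nondecreasing[of 0 r ?g])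
    fix x assume x: "0 \<le> x" "x \<le> r"
    have "((\<lambda>x. x / (1 - x\<^sup>2)) has_real_derivative (1 + x\<^sup>2) / (1 - x\<^sup>2)\<^sup>2) (at x)"
      using pos[OF x] by (auto intro!: derivative_eq_intros simp: power2_eq_square algebra_simps)
    then have "(?g has_real_derivative
      (1 + x\<^sup>2) / (1 - x\<^sup>2)\<^sup>2 - 2 * x\<^sup>2 - 1 / (1 - x\<^sup>2)) (at x)"
      by (intro DERIV_diff[OF DERIV_diff D[OF x]]) (auto intro!: derivative_eq_intros)
    moreover have "(1 + x\<^sup>2) / (1 - x\<^sup>2)\<^sup>2 - 1 / (1 - x\<^sup>2) = 2 * x\<^sup>2 / (1 - x\<^sup>2)\<^sup>2"
      using pos[OF x] by (simp add: divide_simps power2_eq_square)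
    moreover have "2 * x\<^sup>2 \<le> 2 * x\<^sup>2 / (1 - x\<^sup>2)\<^sup>2"
    proof -
      have "(1 - x\<^sup>2)\<^sup>2 \<le> 1" using pos[OF x] by (intro power_le_one) auto
      moreover have "0 < (1 - x\<^sup>2)\<^sup>2" using pos[OF x] by simp
      ultimately show ?thesis by (simp add: pos_le_divide_eq mult_left_le)
    qed
    ultimately show "\<exists>y. (?g has_real_derivative y) (at x) \<and> 0 \<le> y"
      by (intro exI conjI) (assumption, simp)
  qed (use assms in simp)
  then show "ln ((1 + r) / (1 - r)) / 2 \<le> r / (1 - r\<^sup>2) - 2 * r ^ 3 / 3" by simp
qed

lemma cubic_coeff_bounds:
  assumes "0 < r" "r < 1"
  shows "1 / 3 \<le> cubic_coeff r" and "cubic_coeff r \<le> (1 / (1 - r\<^sup>2) - 1 / 3 - r\<^sup>2 / 5) / 2"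
proof -
  have p: "0 < 1 - r\<^sup>2" using power_strict_mono[of r 1 2] assms by simp
  show "1 / 3 \<le> cubic_coeff r"
    unfolding cubic_coeff_def using artanh_bounds[OF assms] assms by (simp add: pos_le_divide_eq)
  have "r / (1 - r\<^sup>2) - ln ((1 + r) / (1 - r)) / 2 \<le> r / (1 - r\<^sup>2) - (r + r ^ 3 / 3 + r ^ 5 / 5)"
    using artanh_bounds[OF assms] by simp
  also have "\<dots> = (1 / (1 - r\<^sup>2) - 1 / 3 - r\<^sup>2 / 5) / 2 * (2 * r ^ 3)"
    using p by (simp add: divide_simps) (simp add: algebra_simps power_numeral_reduce)
  finally show "cubic_coeff r \<le> (1 / (1 - r\<^sup>2) - 1 / 3 - r\<^sup>2 / 5) / 2"
    unfolding cubic_coeff_def using assms by (subst pos_divide_le_eq) auto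
qed

text \<open>With 1 - r^2 = n / Q^2 this reads c / Q^2 < 1 / (2 n), the margin that keeps the bracket
  in \<open>vertex_term_small\<close> positive down to p = 1 - Q.\<close>

lemma cubic_coeff_less: assumes "0 < r" "r < 1" shows "cubic_coeff r < 1 / (2 * (1 - r\<^sup>2))"
proof -
  have "cubic_coeff r \<le> (1 / (1 - r\<^sup>2) - 1 / 3 - r\<^sup>2 / 5) / 2" by (rule cubic_coeff_bounds(2)[OF assms])
  also have "\<dots> < (1 / (1 - r\<^sup>2)) / 2"
    by (intro divide_strict_right_mono) (simp_all add: order.strict_trans2[OF _ zero_le_power2])
  finally show ?thesis by (simp add: mult.commute)
qed

text \<open>The number 2/9 is (Q - 1) / Q^2 at Q = 3, the largest r^2 that occurs. The constant
  rounds down 1 - (9/14 - 3/10) (2/9)^2; high degree vertices need the coefficient this close to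
  1.\<close>

lemma linear_coeff_ge: assumes "0 < r" "r\<^sup>2 \<le> 2/9" shows "983/1000 \<le> linear_coeff r"
proof -
  have r: "r < 1" using assms power_less_imp_less_base[of r 2 1] by simp
  let ?x = "r\<^sup>2"
  have "linear_coeff r \<ge> 1 / (1 - ?x) - 3 * ((1 / (1 - ?x) - 1 / 3 - ?x / 5) / 2) * ?x"
    unfolding linear_coeff_def using cubic_coeff_bounds(2)[OF assms(1) r] by (intro diff_left_mono mult_right_mono) auto
  moreover have "1 / (1 - ?x) - 3 * ((1 / (1 - ?x) - 1 / 3 - ?x / 5) / 2) * ?x \<ge> 983/1000"
  proof -
    define y where "y = ?x"
    have y: "0 \<le> y" "y \<le> 2/9" using assms by (auto simp: y_def)
    have eq: "1 / (1 - y) - 3 * ((1 / (1 - y) - 1 / 3 - y / 5) / 2) * y = 1 - y\<^sup>2 / (2 * (1 - y)) + 3 / 10 * y\<^sup>2"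
      using y by (simp add: divide_simps) (simp add: algebra_simps power2_eq_square)
    moreover have "y\<^sup>2 / (2 * (1 - y)) \<le> y\<^sup>2 / (14/9)"
      using y by (intro divide_left_mono) auto
    then have "y\<^sup>2 / (2 * (1 - y)) \<le> 9/14 * y\<^sup>2" by simp
    moreover have "y\<^sup>2 \<le> (2/9)\<^sup>2" using y by (intro power_mono) auto
    then have "y\<^sup>2 \<le> 4/81" by (simp add: power_divide)
    moreover have "983/1000 \<le> 1 - a + 3 / 10 * b" if "a \<le> 9/14 * b" "b \<le> 4/81" for a b :: real
      using that by linarith
    ultimately have "983/1000 \<le> 1 - y\<^sup>2 / (2 * (1 - y)) + 3 / 10 * y\<^sup>2" by blast
    then show ?thesis unfolding y_def[symmetric] eq .
  qed
  ultimately show ?thesis by (rule order.trans[rotated])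
qed

lemma hermite_ln_node:
  assumes "0 < r" "r < 1"
  shows "hermite_ln r r = ln (1 - r)" "hermite_ln r (- r) = ln (1 + r)"
proof -
  have "linear_coeff r * r + cubic_coeff r * r ^ 3 = r / (1 - r\<^sup>2) - cubic_coeff r * (2 * r ^ 3)"
    by (simp add: linear_coeff_def algebra_simps power_numeral_reduce)
  also have "cubic_coeff r * (2 * r ^ 3) = r / (1 - r\<^sup>2) - ln ((1 + r) / (1 - r)) / 2"
    using assms by (simp add: cubic_coeff_def)
  finally have odd: "linear_coeff r * r + cubic_coeff r * r ^ 3 = (ln (1 + r) - ln (1 - r)) / 2"
    using assms by (simp add: ln_div)
  have "1 - r\<^sup>2 = (1 - r) * (1 + r)" by (simp add: algebra_simps power2_eq_square)
  then have ev: "ln (1 - r\<^sup>2) = ln (1 - r) + ln (1 + r)" using assms by (simp add: ln_mult)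
  show "hermite_ln r r = ln (1 - r)" unfolding hermite_ln_def using odd ev by (simp add: field_simps)
  show "hermite_ln r (- r) = ln (1 + r)" unfolding hermite_ln_def using odd ev by (simp add: field_simps)
qed

text \<open>The derivative of the difference g vanishes only at \<open>-r\<close>, \<open>s\<close>
  and \<open>r\<close>, with \<open>s\<close> strictly between the other two. Hence g falls up to
  \<open>-r\<close>, rises up to \<open>s\<close>, falls up to \<open>r\<close> and rises again, and
  its zeros at \<open>-r\<close> and \<open>r\<close> are its only minima. The upper bound on the
  cubic coefficient gives s < r, the lower bound gives -r < s.\<close>

lemma ln_le_hermite:
  assumes r: "0 < r" "r\<^sup>2 \<le> 2/9" and x: "x < 1"
  shows "ln (1 - x) \<le> hermite_ln r x"
    and "ln (1 - x) = hermite_ln r x \<longleftrightarrow> x = r \<or> x = - r"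
proof -
  have r1: "r < 1/2" using r power_less_imp_less_base[of r 2 "1/2"] by (simp add: power_divide)
  let ?c = "cubic_coeff r"
  \<comment> \<open>The zero of \<open>3 * ?c * (y - 1) + 1 / (1 - r\<^sup>2)\<close>, the factor of
    the derivative that remains after y^2 - r^2 is split off.\<close>
  define s where "s = 1 - 1 / (3 * ?c * (1 - r\<^sup>2))"
  define g where "g y = hermite_ln r y - ln (1 - y)" for y
  define g' where "g' y = 3 * ?c * (y\<^sup>2 - r\<^sup>2) * (y - s) / (1 - y)" for y
  have c: "1 / 3 \<le> ?c" and c2: "?c \<le> (1 / (1 - r\<^sup>2) - 1 / 3 - r\<^sup>2 / 5) / 2" using cubic_coeff_bounds r r1 by auto
  have p: "0 < 1 - r\<^sup>2" using r by simp
  have s1: "s < r"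
  proof -
    have "3 * ?c * (1 - r\<^sup>2) \<le> 3 * ((1 / (1 - r\<^sup>2) - 1 / 3 - r\<^sup>2 / 5) / 2) * (1 - r\<^sup>2)"
      using c2 p by (intro mult_right_mono) auto
    also have "\<dots> \<le> 3 * ((1 / (1 - r\<^sup>2) - 1 / 3) / 2) * (1 - r\<^sup>2)" using p by (intro mult_right_mono) auto
    also have "\<dots> = 1 + r\<^sup>2 / 2" using p by (simp add: field_simps)
    finally have "3 * ?c * (1 - r\<^sup>2) * (1 - r) \<le> (1 + r\<^sup>2 / 2) * (1 - r)" using r1 by (intro mult_right_mono) auto
    also have "\<dots> = 1 - r + r * r / 2 * (1 - r)" by (simp add: algebra_simps power2_eq_square)
    also have "\<dots> < 1"
    proof -
      have "r * (r / 2 * (1 - r)) < r * 1" using r r1 by (intro mult_strict_left_mono) (auto intro: order.strict_trans1[OF mult_left_le])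
      then show ?thesis by simp
    qed
    finally show ?thesis unfolding s_def using c p by (simp add: field_simps)
  qed
  have s2: "- r < s"
  proof -
    have "1 < (1 - r\<^sup>2) * (1 + r)"
    proof -
      have "r * r < r * (1/2)" using r r1 by (intro mult_strict_left_mono) auto
      then have "r + r * r < 1" using r1 by linarith
      then have "r * (r + r * r) < r * 1" using r by (intro mult_strict_left_mono) auto
      then show ?thesis by (simp add: algebra_simps power2_eq_square)
    qed
    also have "\<dots> \<le> (3 * ?c) * ((1 - r\<^sup>2) * (1 + r))" using c p r mult_right_mono[of 1 "3 * ?c" "(1 - r\<^sup>2) * (1 + r)"] by simp
    finally show ?thesis unfolding s_def using c p by (simp add: field_simps)
  qed
  have D: "(g has_real_derivative g' y) (at y)" if "y < 1" for y
  proof -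
    have "(g has_real_derivative (- linear_coeff r - y / (1 - r\<^sup>2) - 3 * ?c * y\<^sup>2 + 1 / (1 - y))) (at y)"
    proof -
      define k where "k = 1 / (2 * (1 - r\<^sup>2))"
      have "x\<^sup>2 / (2 * (1 - r\<^sup>2)) = k * x\<^sup>2" for x by (simp add: k_def)
      moreover have "y / (1 - r\<^sup>2) = k * (2 * y)" using p by (simp add: k_def divide_simps)
      ultimately show ?thesis unfolding g_def hermite_ln_def using that
        by (auto intro!: derivative_eq_intros simp del: times_divide_eq_right)
    qed
    moreover have "- linear_coeff r - y / (1 - r\<^sup>2) - 3 * ?c * y\<^sup>2 + 1 / (1 - y) = g' y"
    proof -
      have "3 * ?c * (y - s) = 3 * ?c * (y - 1) + 1 / (1 - r\<^sup>2)" unfolding s_def using c p by (simp add: field_simps)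
      moreover have "g' y = (y\<^sup>2 - r\<^sup>2) * (3 * ?c * (y - s)) / (1 - y)" by (simp add: g'_def)
      ultimately have "g' y = (y\<^sup>2 - r\<^sup>2) * (3 * ?c * (y - 1) + 1 / (1 - r\<^sup>2)) / (1 - y)" by (simp only:)
      also have "\<dots> = - linear_coeff r - y / (1 - r\<^sup>2) - 3 * ?c * y\<^sup>2 + 1 / (1 - y)"
        unfolding linear_coeff_def using that p by (simp add: divide_simps) (simp add: algebra_simps power2_eq_square)
      finally show ?thesis ..
    qed
    ultimately show ?thesis by simp
  qed
  have g0: "g r = 0" "g (- r) = 0" using hermite_ln_node[of r] r r1 by (auto simp: g_def)
  have posg: "0 < g x" if ne: "x \<noteq> r" "x \<noteq> - r"
  proof (cases "s \<le> x")
    case True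
    show ?thesis
    proof (cases "x < r")
      case t: True
      then obtain z where z: "x < z" "z < r" "g r - g x = (r - x) * g' z"
        using MVT2[of x r g g'] D r1 by auto
      have "(z\<^sup>2 - r\<^sup>2) < 0" using z s2 True r power2_strict_mono[of z r] abs_less_iff by (simp add: abs_if)
      then have "g' z < 0" unfolding g'_def using z True c t r1
        by (intro divide_neg_pos mult_neg_pos mult_pos_neg) auto
      then have "(r - x) * g' z < 0" using t by (intro mult_pos_neg) auto
      then show ?thesis using z g0 by simp
    next
      case f: False
      then obtain z where z: "r < z" "z < x" "g x - g r = (x - r) * g' z"
        using MVT2[of r x g g'] D x ne by (metis linorder_neqE_linordered_idom order.strict_trans1)
      have "0 < (z\<^sup>2 - r\<^sup>2)" using z r power_strict_mono[of r z 2] by simp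
      then have "0 < g' z" unfolding g'_def using z s1 c x by (intro divide_pos_pos mult_pos_pos) auto
      then have "0 < (x - r) * g' z" using f ne by (intro mult_pos_pos) auto
      then show ?thesis using z g0 by simp
    qed
  next
    case xs: False
    show ?thesis
    proof (cases "x < - r")
      case t: True
      then obtain z where z: "x < z" "z < - r" "g (- r) - g x = (- r - x) * g' z"
        using MVT2[of x "- r" g g'] D r by auto
      have "0 < (z\<^sup>2 - r\<^sup>2)" using z r power_strict_mono[of r "- z" 2] by simp
      then have "g' z < 0" unfolding g'_def using z s2 c r by (intro divide_neg_pos mult_pos_neg mult_pos_pos) auto
      then have "(- r - x) * g' z < 0" using t by (intro mult_pos_neg) auto
      then show ?thesis using z g0 by simp
    next
      case f: False
      then obtain z where z: "- r < z" "z < x" "g x - g (- r) = (x - - r) * g' z"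
        using MVT2[of "- r" x g g'] D x ne by (metis linorder_neqE_linordered_idom order.strict_trans1)
      have "(z\<^sup>2 - r\<^sup>2) < 0" using z s1 xs r power2_strict_mono[of z r] by (simp add: abs_if)
      then have "0 < g' z" unfolding g'_def using z xs c x
        by (intro divide_pos_pos mult_neg_neg[OF mult_pos_neg]) auto
      then have "0 < (x - - r) * g' z" using f ne by (intro mult_pos_pos) auto
      then show ?thesis using z g0 by simp
    qed
  qed
  show "ln (1 - x) \<le> hermite_ln r x" using posg g0 unfolding g_def
    by (cases "x = r"; cases "x = -r") auto
  show "ln (1 - x) = hermite_ln r x \<longleftrightarrow> x = r \<or> x = - r" using posg g0 unfolding g_def
    by (cases "x = r"; cases "x = - r") auto
qed

section \<open>The sign of the contribution of a single vertex\<close>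

text \<open>Here p is the \<open>defect\<close> and k the \<open>excess\<close> of a vertex, and Q^2
  - Q + 1 = n. The linear loss in k and the shapes p (p - 1)^2 and 4 k - k^2 appear once multiples
  of \<open>Sp - Sk - Q\<close> are split off from the traces in
  \<open>slack_le_vertex_terms\<close>.\<close>

definition vertex_term :: "real \<Rightarrow> real \<Rightarrow> real \<Rightarrow> real \<Rightarrow> real" where
  "vertex_term Q r p k = ln (1 + k / Q) - linear_coeff r * k / Q + k / (2 * (Q\<^sup>2 - Q + 1)) + cubic_coeff r * (4 * k - k\<^sup>2) / Q ^ 3
     - (p\<^sup>2 - p) / (2 * (Q\<^sup>2 - Q + 1)) - cubic_coeff r * (p * (p - 1)\<^sup>2) / Q ^ 3"

text \<open>The factor p (p - 1) is nonnegative because p is an integer; over the reals it would be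
  negative between 0 and 1. The other factor is positive because p - 1 >= -Q.\<close>

lemma vertex_term_small:
  fixes Q :: real and p :: int
  assumes Q: "3 \<le> Q" and r: "0 < r" "r\<^sup>2 = (Q - 1) / Q\<^sup>2" and p: "1 - Q \<le> p"
  shows "vertex_term Q r p 0 \<le> 0" and "vertex_term Q r p 0 = 0 \<longleftrightarrow> p = 0 \<or> p = 1"
proof -
  define n where "n = Q\<^sup>2 - Q + 1"
  have n: "0 < n" unfolding n_def using Q by (simp add: power2_eq_square add_pos_pos)
  have r1: "r < 1"
  proof -
    have "Q - 1 < 1 * Q\<^sup>2" using n Q by (simp add: n_def)
    then have "r\<^sup>2 < 1\<^sup>2" unfolding r using Q by (simp add: divide_less_eq)
    then show ?thesis using power_less_imp_less_base[of r 2 1] by simp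
  qed
  have q: "1 - r\<^sup>2 = n / Q\<^sup>2" unfolding r n_def using Q by (simp add: field_simps)
  have c: "cubic_coeff r < Q\<^sup>2 / (2 * n)" "1/3 \<le> cubic_coeff r" using cubic_coeff_less[OF r(1) r1] cubic_coeff_bounds[OF r(1) r1] unfolding q by (auto simp: field_simps)
  have fac: "vertex_term Q r p 0 = - (real_of_int (p * (p - 1))) * (1 / (2 * n) + cubic_coeff r * (p - 1) / Q ^ 3)"
    unfolding vertex_term_def n_def[symmetric] using n Q by (simp add: field_simps power2_eq_square)
  have pos: "0 < 1 / (2 * n) + cubic_coeff r * (p - 1) / Q ^ 3"
  proof -
    have "cubic_coeff r * (- Q) \<le> cubic_coeff r * (p - 1)" using c p by (intro mult_left_mono) auto
    then have "cubic_coeff r * (- Q) / Q ^ 3 \<le> cubic_coeff r * (p - 1) / Q ^ 3" using Q by (intro divide_right_mono) auto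
    moreover have "cubic_coeff r * (- Q) / Q ^ 3 = - (cubic_coeff r / Q\<^sup>2)" using Q by (simp add: field_simps power_numeral_reduce power2_eq_square)
    moreover have "cubic_coeff r / Q\<^sup>2 < 1 / (2 * n)" using c Q n by (simp add: field_simps)
    ultimately show ?thesis by linarith
  qed
  have "0 \<le> p * (p - 1)" by (cases "p \<le> 0") (auto simp: mult_nonpos_nonpos)
  then have "0 \<le> real_of_int (p * (p - 1))" by (simp only: of_int_0_le_iff)
  then show "vertex_term Q r p 0 \<le> 0" unfolding fac using pos by (simp only: mult_minus_left neg_le_0_iff_le) simp
  show "vertex_term Q r p 0 = 0 \<longleftrightarrow> p = 0 \<or> p = 1" unfolding fac using pos by auto
qed

text \<open>In x = k / Q >= 1 every term is bounded by an affine function of x, using the worst case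
  Q = 3 where Q occurs. The total is about 0.201 - 0.215 x, so the numerical constants leave little
  room at x = 1.\<close>

lemma vertex_term_large:
  assumes Q: "3 \<le> Q" and r: "0 < r" "r\<^sup>2 = (Q - 1) / Q\<^sup>2" and k: "Q \<le> k"
  shows "vertex_term Q r 0 k < 0"
proof -
  define n where "n = Q\<^sup>2 - Q + 1"
  define x where "x = k / Q"
  have n: "7/3 * Q \<le> n"
  proof -
    have "0 \<le> (Q - 3) * (3 * Q - 1)" using Q by (intro mult_nonneg_nonneg) auto
    then show ?thesis by (simp add: n_def algebra_simps power2_eq_square)
  qed
  have r2: "r\<^sup>2 \<le> 2/9"
  proof -
    have "0 \<le> (Q - 3) * (2 * Q - 3)" using Q by (intro mult_nonneg_nonneg) auto
    also have "\<dots> = 2 * (Q * Q) - 9 * Q + 9" by (simp add: algebra_simps)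
    finally show ?thesis unfolding r using Q by (simp add: divide_simps) (simp add: algebra_simps power2_eq_square)
  qed
  have "r\<^sup>2 < 1\<^sup>2" using r2 by simp
  then have r1: "r < 1" by (rule power_less_imp_less_base) simp
  have x: "1 \<le> x" "k = x * Q" using k Q by (auto simp: x_def)
  \<comment> \<open>The value 0.48 rounds up (9/7 - 1/3) / 2, the bound from
    \<open>cubic_coeff_bounds\<close> at r^2 = 2/9 with its last negative term dropped.\<close>
  have c: "1 / 3 \<le> cubic_coeff r" "cubic_coeff r \<le> 0.48"
  proof -
    have "1 / (1 - r\<^sup>2) \<le> 1 / (7/9)" using r2 by (intro divide_left_mono) auto
    moreover have "c \<le> 0.48" if "a \<le> 1 / (7/9)" "c \<le> (a - 1/3 - b / 5) / 2" "0 \<le> b" for a b c :: real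
      using that by simp
    ultimately show "cubic_coeff r \<le> 0.48" using cubic_coeff_bounds(2)[OF r(1) r1] zero_le_power2[of r] by blast
  qed (rule cubic_coeff_bounds(1)[OF r(1) r1])
  have l: "983/1000 \<le> linear_coeff r" using linear_coeff_ge[OF r(1) r2] .
  have "ln (1 + x) \<le> ln 2 + (x - 1) / 2"
  proof -
    have "1 + x = 2 * (1 + (x - 1) / 2)" by (simp add: field_simps)
    then have "ln (1 + x) = ln (2 * (1 + (x - 1) / 2))" by (simp only:)
    also have "\<dots> = ln 2 + ln (1 + (x - 1) / 2)"
    proof -
      have "0 < 1 + (x - 1) / 2" using x by (intro add_pos_nonneg) auto
      then show ?thesis by (intro ln_mult_pos) auto
    qed
    also have "ln (1 + (x - 1) / 2) \<le> (x - 1) / 2" using x by (intro ln_add_one_self_le_self) auto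
    finally show ?thesis by simp
  qed
  \<comment> \<open>Since ln 2 = 2 artanh (1/3), the upper bound for artanh yields ln 2 <=
    0.701.\<close>
  then have 1: "ln (1 + x) \<le> 0.701 + (x - 1) / 2" using artanh_bounds(2)[of "1/3"] by (simp add: power2_eq_square power_numeral_reduce)
  have 2: "x * (983/1000) \<le> linear_coeff r * x" using l x mult_right_mono[of "983/1000" "linear_coeff r" x] by simp
  have 3: "k / (2 * n) \<le> x * (3 / 14)"
  proof -
    have "k / (2 * n) \<le> k / (2 * (7/3 * Q))" using n Q k by (intro divide_left_mono) auto
    also have "\<dots> = x * (3/14)" using Q by (simp add: x_def)
    finally show ?thesis .
  qed
  have 4: "cubic_coeff r * (4 * k - k\<^sup>2) / Q ^ 3 \<le> x * (0.48 / 9)"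
  proof -
    have "(4 * k - k\<^sup>2) / Q ^ 3 = x * ((4 - x * Q) / Q\<^sup>2)" using Q by (simp add: x(2) field_simps power2_eq_square power_numeral_reduce)
    also have "\<dots> \<le> x * (1 / 9)"
    proof (intro mult_left_mono)
      have "Q \<le> x * Q" using x Q by simp
      moreover have "36 - 9 * Q \<le> Q\<^sup>2"
      proof -
        have "0 \<le> (Q - 3) * (Q + 12)" using Q by (intro mult_nonneg_nonneg) auto
        then show ?thesis by (simp add: algebra_simps power2_eq_square)
      qed
      ultimately have "36 - 9 * (x * Q) \<le> Q\<^sup>2" by linarith
      then show "(4 - x * Q) / Q\<^sup>2 \<le> 1 / 9" using Q by (simp add: pos_divide_le_eq)
    qed (use x in auto)
    finally have "cubic_coeff r * ((4 * k - k\<^sup>2) / Q ^ 3) \<le> cubic_coeff r * (x * (1/9))" using c by (intro mult_left_mono) auto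
    also have "\<dots> \<le> 0.48 * (x * (1/9))" using c x by (intro mult_right_mono) auto
    finally show ?thesis by simp
  qed
  have "vertex_term Q r 0 k = ln (1 + x) - linear_coeff r * x + k / (2 * n) + cubic_coeff r * (4 * k - k\<^sup>2) / Q ^ 3"
    by (simp add: vertex_term_def n_def x_def)
  also have "\<dots> \<le> 0.701 + (x - 1) / 2 - x * (983/1000) + x * (3 / 14) + x * (0.48 / 9)" using 1 2 3 4 by linarith
  also have "\<dots> < 0" using x by (simp add: diff_divide_distrib)
  finally show ?thesis .
qed

section \<open>Traces of a sparse graph without 4-cycles\<close>

lemma trace2_delta_plus_adjacency:
  fixes A :: "nat \<Rightarrow> nat \<Rightarrow> real" and x y :: "nat \<Rightarrow> real"
  assumes sym: "\<And>i j. A i j = A j i" and idem: "\<And>i j. A i j * A i j = A i j" and diag: "\<And>i. A i i = 0"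
  defines "P \<equiv> \<lambda>i j. (if i = j then x i else 0) + y i * A i j"
  shows "(\<Sum>i<n. \<Sum>j<n. P i j * P j i) = (\<Sum>i<n. (x i)\<^sup>2) + (\<Sum>i<n. \<Sum>j<n. y i * y j * A i j)"
proof -
  have "P i j * P j i = (if i = j then (x i)\<^sup>2 else 0) + y i * y j * A i j" for i j
    using idem[of i j] sym[of j i] by (simp add: P_def diag power2_eq_square mult_ac)
  then show ?thesis by (simp add: sum.distrib)
qed

text \<open>Closed walks of length three, where \<open>x\<close> weights standing still. A walk with
  exactly one adjacency step cannot close because the diagonal of \<open>A\<close> is zero. One with
  two such steps runs along an edge and back, and the pause can occur in three positions. Three
  adjacency steps form a triangle.\<close>

lemma trace3_delta_plus_adjacency:
  fixes A :: "nat \<Rightarrow> nat \<Rightarrow> real" and x y :: "nat \<Rightarrow> real"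
  assumes sym: "\<And>i j. A i j = A j i" and idem: "\<And>i j. A i j * A i j = A i j" and diag: "\<And>i. A i i = 0"
  defines "P \<equiv> \<lambda>i j. (if i = j then x i else 0) + y i * A i j"
  shows "(\<Sum>i<n. \<Sum>j<n. \<Sum>k<n. P i j * P j k * P k i) = (\<Sum>i<n. x i ^ 3) + 3 * (\<Sum>i<n. \<Sum>j<n. x i * y i * y j * A i j)
    + (\<Sum>i<n. \<Sum>j<n. \<Sum>k<n. y i * y j * y k * (A i j * A j k * A k i))"
proof -
  have A2: "A i j * A j i = A i j" for i j using idem[of i j] sym[of j i] by simp
  have inner: "(\<Sum>k<n. P j k * P k i) = (if i = j then (x i)\<^sup>2 else 0) + (x j + x i) * y j * A j i + y j * (\<Sum>k<n. y k * (A j k * A k i))"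
    if "i < n" "j < n" for i j
  proof -
    have "(\<Sum>k<n. P j k * P k i) = (\<Sum>k<n. (if k = j then x j * P j i else 0) + (if k = i then y j * A j i * x i else 0) + y j * (y k * (A j k * A k i)))"
      by (intro sum.cong refl) (auto simp: P_def algebra_simps)
    also have "\<dots> = x j * P j i + y j * A j i * x i + y j * (\<Sum>k<n. y k * (A j k * A k i))"
      using that by (simp add: sum.distrib sum_distrib_left)
    finally show ?thesis by (auto simp: P_def algebra_simps power2_eq_square)
  qed
  have mid: "(\<Sum>j<n. \<Sum>k<n. P i j * P j k * P k i) = x i ^ 3 + x i * y i * (\<Sum>j<n. y j * A i j)
     + y i * (\<Sum>j<n. (x j + x i) * y j * A i j) + (\<Sum>j<n. \<Sum>k<n. y i * y j * y k * (A i j * A j k * A k i))"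
    if i: "i < n" for i
  proof -
    let ?t = "\<lambda>j. \<Sum>k<n. y k * (A j k * A k i)"
    have "(\<Sum>j<n. \<Sum>k<n. P i j * P j k * P k i) = (\<Sum>j<n. P i j * (\<Sum>k<n. P j k * P k i))"
      by (simp add: sum_distrib_left mult.assoc)
    also have "\<dots> = (\<Sum>j<n. P i j * ((if i = j then (x i)\<^sup>2 else 0) + (x j + x i) * y j * A j i + y j * ?t j))"
      using inner[OF i] by (intro sum.cong refl) auto
    also have "\<dots> = (\<Sum>j<n. (if j = i then x i ^ 3 + x i * y i * ?t i else 0) + y i * ((x j + x i) * y j * A i j) + y i * A i j * (y j * ?t j))"
    proof (intro sum.cong refl)
      fix j
      have e: "A i j * ((x j + x i) * y j * A j i) = (x j + x i) * y j * A i j" using A2[of i j] by (auto simp: mult_ac)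
      show "P i j * ((if i = j then (x i)\<^sup>2 else 0) + (x j + x i) * y j * A j i + y j * ?t j)
         = (if j = i then x i ^ 3 + x i * y i * ?t i else 0) + y i * ((x j + x i) * y j * A i j) + y i * A i j * (y j * ?t j)"
      proof (cases "i = j")
        case True
        then show ?thesis by (simp add: P_def diag algebra_simps power2_eq_square power3_eq_cube)
      next
        case False
        then have "P i j = y i * A i j" by (simp add: P_def)
        then have "P i j * (0 + X + Y) = 0 + y i * (A i j * X) + y i * A i j * Y" for X Y by (simp add: algebra_simps)
        then show ?thesis using False e by (simp only: False not_sym[OF False] if_False)
      qed
    qed
    also have "\<dots> = x i ^ 3 + x i * y i * ?t i + y i * (\<Sum>j<n. (x j + x i) * y j * A i j) + (\<Sum>j<n. y i * A i j * (y j * ?t j))"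
      using i by (simp add: sum.distrib sum_distrib_left)
    also have "?t i = (\<Sum>j<n. y j * A i j)" by (simp add: A2)
    also have "(\<Sum>j<n. y i * A i j * (y j * ?t j)) = (\<Sum>j<n. \<Sum>k<n. y i * y j * y k * (A i j * A j k * A k i))"
      by (simp add: sum_distrib_left mult_ac)
    finally show ?thesis .
  qed
  let ?S = "\<Sum>i<n. \<Sum>j<n. x i * y i * y j * A i j"
  have swap: "(\<Sum>i<n. \<Sum>j<n. y i * (x j * y j * A i j)) = ?S"
    by (subst sum.swap) (auto intro!: sum.cong simp: sym mult_ac)
  have "(\<Sum>i<n. \<Sum>j<n. \<Sum>k<n. P i j * P j k * P k i) = (\<Sum>i<n. x i ^ 3 + x i * y i * (\<Sum>j<n. y j * A i j)
     + y i * (\<Sum>j<n. (x j + x i) * y j * A i j) + (\<Sum>j<n. \<Sum>k<n. y i * y j * y k * (A i j * A j k * A k i)))"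
    using mid by (intro sum.cong refl) auto
  also have "\<dots> = (\<Sum>i<n. x i ^ 3) + ?S + ((\<Sum>i<n. \<Sum>j<n. y i * (x j * y j * A i j)) + ?S) + (\<Sum>i<n. \<Sum>j<n. \<Sum>k<n. y i * y j * y k * (A i j * A j k * A k i))"
  proof -
    have "y i * (\<Sum>j<n. (x j + x i) * y j * A i j) = (\<Sum>j<n. y i * (x j * y j * A i j)) + (\<Sum>j<n. x i * y i * y j * A i j)" for i
      unfolding sum_distrib_left sum.distrib[symmetric] by (intro sum.cong refl) (simp add: algebra_simps)
    moreover have "x i * y i * (\<Sum>j<n. y j * A i j) = (\<Sum>j<n. x i * y i * y j * A i j)" for i
      by (simp add: sum_distrib_left mult_ac)
    ultimately show ?thesis by (simp add: sum.distrib sum_distrib_left[symmetric])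
  qed
  finally show ?thesis unfolding swap by simp
qed

locale sparse_c4_free =
  fixes n q :: nat and E :: "nat \<Rightarrow> nat \<Rightarrow> bool"
  assumes q: "2 \<le> q" and n: "n = q\<^sup>2 + q + 1"
    and E_sym: "E i j \<longleftrightarrow> E j i" and E_irrefl: "\<not> E i i"
    and codegree: "\<lbrakk>i < n; j < n; i \<noteq> j\<rbrakk> \<Longrightarrow> card {k. k < n \<and> E i k \<and> E k j} \<le> 1"
    and degree_sum: "(\<Sum>i<n. card {j. j < n \<and> E i j}) \<le> q * (q + 1)\<^sup>2"
begin

definition A :: "nat \<Rightarrow> nat \<Rightarrow> real" where "A i j = of_bool (E i j)"
definition deg :: "nat \<Rightarrow> nat" where "deg i = card {j. j < n \<and> E i j}"
definition Q :: real where "Q = real q + 1"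
text \<open>At most one of \<open>excess\<close> and \<open>defect\<close> is nonzero. For degrees
  strictly between Q and 2 Q the defect is negative: these vertices keep the normalisation Q and put
  a negative entry on the diagonal of \<open>P\<close>.\<close>

definition excess :: "nat \<Rightarrow> int" where "excess i = (if deg i < 2 * (q + 1) then 0 else int (deg i) - int (q + 1))"
definition defect :: "nat \<Rightarrow> int" where "defect i = (if deg i < 2 * (q + 1) then int (q + 1) - int (deg i) else 0)"
definition D :: "nat \<Rightarrow> real" where "D i = Q + excess i"
definition P :: "nat \<Rightarrow> nat \<Rightarrow> real" where "P i j = (of_bool (i = j) * defect i + A i j) / D i"

lemma A_sym: "A i j = A j i" using E_sym by (simp add: A_def)
lemma A_idem: "A i j * A i j = A i j" by (simp add: A_def)
lemma A_diag: "A i i = 0" using E_irrefl by (simp add: A_def)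
lemma A_nonneg: "0 \<le> A i j" "A i j \<le> 1" by (simp_all add: A_def)

lemma Q_ge: "3 \<le> Q" using q by (simp add: Q_def)
lemma real_n: "real n = Q\<^sup>2 - Q + 1" by (simp add: n Q_def power2_eq_square algebra_simps)

lemma sum_A: "(\<Sum>j<n. A i j) = deg i"
  by (simp add: A_def deg_def of_bool_def sum.If_cases Int_def conj_commute)

lemma excess_nonneg: "0 \<le> excess i" and excess_defect: "excess i = 0 \<or> defect i = 0"
  and excess_large: "excess i = 0 \<or> Q \<le> excess i" and defect_bounds: "1 - Q \<le> defect i" "defect i \<le> Q"
  and deg_eq: "real (deg i) = Q - defect i + excess i"
  by (auto simp: excess_def defect_def Q_def)

lemma D_pos: "0 < D i" and D_ge: "Q \<le> D i"
  using excess_nonneg[of i] Q_ge by (auto simp: D_def)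

abbreviation dfc :: "nat \<Rightarrow> real" where "dfc i \<equiv> of_int (defect i)"
abbreviation exc :: "nat \<Rightarrow> real" where "exc i \<equiv> of_int (excess i)"

text \<open>The weight of a vertex relative to the uniform normalisation: 1 unless the degree is at
  least 2 Q. That it never exceeds 1 is what allows products of weights to be bounded below by
  linear expressions.\<close>

definition u :: "nat \<Rightarrow> real" where "u i = Q / D i"

lemma u_bounds: "0 < u i" "u i \<le> 1" using D_pos[of i] D_ge[of i] Q_ge by (auto simp: u_def)
lemma u_deg: "u i * deg i = Q - dfc i"
  using excess_defect[of i] D_pos[of i] Q_ge unfolding deg_eq u_def D_def by auto
lemma p_u: "dfc i * u i = dfc i" using excess_defect[of i] Q_ge by (auto simp: u_def D_def)
lemma inv_D: "1 / D i = u i / Q" using Q_ge by (simp add: u_def)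

lemma P_eq: "P i j = (if i = j then dfc i / Q else 0) + u i / Q * A i j"
proof -
  have "dfc i / D i = dfc i / Q" using p_u[of i] inv_D[of i] by (metis times_divide_eq_right mult.right_neutral)
  then have 1: "of_int (of_bool (i = j) * defect i) / D i = (if i = j then dfc i / Q else 0)" by (cases "i = j") auto
  have 2: "A i j / D i = u i / Q * A i j" using inv_D[of i] by (metis mult.commute mult.right_neutral times_divide_eq_right)
  show ?thesis unfolding P_def add_divide_distrib 1 2 ..
qed

lemma P_row: "(\<Sum>j<n. P i j) = 1" if "i < n"
proof -
  have "(\<Sum>j<n. P i j) = (dfc i + u i * deg i) / Q"
    using that by (simp add: P_eq sum.distrib sum_A[symmetric] sum_distrib_left add_divide_distrib sum_divide_distrib)
  also have "\<dots> = 1" using u_deg Q_ge by simp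
  finally show ?thesis .
qed

text \<open>Detailed balance: off the diagonal both sides are entries of the symmetric matrix
  \<open>A\<close>. It makes the distribution proportional to \<open>D\<close> stationary.\<close>

lemma D_P: "D i * P i j = D j * P j i"
  using D_pos[of i] D_pos[of j] A_sym by (auto simp: P_def)

definition Sp :: real where "Sp = (\<Sum>i<n. dfc i)"
definition Sk :: real where "Sk = (\<Sum>i<n. exc i)"
definition Sp2 :: real where "Sp2 = (\<Sum>i<n. (dfc i)\<^sup>2)"
definition Sk2 :: real where "Sk2 = (\<Sum>i<n. (exc i)\<^sup>2)"
definition Sp3 :: real where "Sp3 = (\<Sum>i<n. dfc i ^ 3)"

definition tr1 :: real where "tr1 = (\<Sum>i<n. P i i)"
definition tr2 :: real where "tr2 = (\<Sum>i<n. \<Sum>j<n. P i j * P j i)"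
definition tr3 :: real where "tr3 = (\<Sum>i<n. \<Sum>j<n. \<Sum>k<n. P i j * P j k * P k i)"

lemma sum_deg: "(\<Sum>i<n. real (deg i)) = real n * Q - Sp + Sk"
  by (simp add: deg_eq sum.distrib sum_subtractf Sp_def Sk_def)

text \<open>The bound on the number of edges: n Q - (Sp - Sk) is the sum of the degrees, and n Q - q
  Q^2 = Q.\<close>

lemma Sp_Sk: "Q \<le> Sp - Sk"
proof -
  have "real (\<Sum>i<n. deg i) \<le> real (q * (q + 1)\<^sup>2)" using degree_sum unfolding deg_def by (simp only: of_nat_le_iff)
  also have "\<dots> = (Q - 1) * Q\<^sup>2" by (simp add: Q_def)
  finally have "real n * Q - Sp + Sk \<le> (Q - 1) * Q\<^sup>2" using sum_deg by simp
  then show ?thesis unfolding real_n by (simp add: algebra_simps power2_eq_square)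
qed

lemma tr1_eq: "tr1 = Sp / Q"
  by (simp add: tr1_def P_eq A_diag Sp_def sum_divide_distrib)

lemma sum_uA: "(\<Sum>i<n. \<Sum>j<n. u i * A i j) = real n * Q - Sp"
  by (simp add: sum_distrib_left[symmetric] sum_A u_deg sum_subtractf Sp_def)

lemma sum_A_total: "(\<Sum>i<n. \<Sum>j<n. A i j) = real n * Q - Sp + Sk"
  using sum_deg by (simp add: sum_A)

text \<open>An edge carries the weight u i * u j, which is at least u i + u j - 1 since both factors
  are at most 1. The linear expression can be summed exactly.\<close>

lemma tr2_ge: "real n * Q - Sp - Sk + Sp2 \<le> Q\<^sup>2 * tr2"
proof -
  have "tr2 = (\<Sum>i<n. (dfc i / Q)\<^sup>2) + (\<Sum>i<n. \<Sum>j<n. u i / Q * (u j / Q) * A i j)"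
    unfolding tr2_def P_eq by (rule trace2_delta_plus_adjacency[OF A_sym A_idem A_diag])
  then have "Q\<^sup>2 * tr2 = Sp2 + (\<Sum>i<n. \<Sum>j<n. u i * u j * A i j)"
    using Q_ge by (simp add: Sp2_def distrib_left sum_distrib_left power_divide) (simp add: power2_eq_square)
  moreover have "(\<Sum>i<n. \<Sum>j<n. u i * A i j + u j * A i j - A i j) \<le> (\<Sum>i<n. \<Sum>j<n. u i * u j * A i j)"
  proof (intro sum_mono)
    fix i j
    have "0 \<le> (1 - u i) * (1 - u j)" using u_bounds by (intro mult_nonneg_nonneg) auto
    then have "(u i + u j - 1) * A i j \<le> u i * u j * A i j"
      using A_nonneg by (intro mult_right_mono) (auto simp: algebra_simps)
    then show "u i * A i j + u j * A i j - A i j \<le> u i * u j * A i j" by (simp add: algebra_simps)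
  qed
  moreover have "(\<Sum>i<n. \<Sum>j<n. u i * A i j + u j * A i j - A i j) = 2 * (real n * Q - Sp) - (real n * Q - Sp + Sk)"
  proof -
    have "(\<Sum>i<n. \<Sum>j<n. u j * A i j) = real n * Q - Sp"
      by (subst sum.swap) (simp add: A_sym[of _ i for i] sum_uA[symmetric] A_sym)
    then show ?thesis using sum_uA sum_A_total by (simp add: sum.distrib sum_subtractf)
  qed
  ultimately show ?thesis by (simp add: algebra_simps)
qed

definition codeg :: "nat \<Rightarrow> nat \<Rightarrow> real" where "codeg i j = (\<Sum>k<n. A i k * A k j)"

lemma codeg_le: "i < n \<Longrightarrow> j < n \<Longrightarrow> i \<noteq> j \<Longrightarrow> codeg i j \<le> 1"
proof -
  assume "i < n" "j < n" "i \<noteq> j"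
  moreover have "codeg i j = card {k. k < n \<and> E i k \<and> E k j}"
  proof -
    have "codeg i j = (\<Sum>k<n. of_bool (E i k \<and> E k j))" by (simp add: codeg_def A_def of_bool_conj)
    also have "\<dots> = card {k. k < n \<and> E i k \<and> E k j}" by (simp add: of_bool_def sum.If_cases Int_def)
    finally show ?thesis .
  qed
  ultimately show ?thesis using codegree by simp
qed

lemma codeg_diag: "codeg i i = deg i" by (simp add: codeg_def A_sym[of _ i] A_idem sum_A)

definition tri :: "nat \<Rightarrow> real" where "tri i = (\<Sum>j<n. \<Sum>k<n. A i j * A j k * A k i)"

lemma tri_alt: "tri i = (\<Sum>j<n. A i j * codeg j i)"
  by (simp add: tri_def codeg_def sum_distrib_left mult.assoc)

text \<open>\<open>tri i\<close> counts each triangle at i in both directions, that is, once for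
  each of the two edges at i that it uses, and each such edge lies in at most one triangle.\<close>

lemma tri_le: assumes "i < n" shows "tri i \<le> deg i"
proof -
  have "tri i \<le> (\<Sum>j<n. A i j)" unfolding tri_alt
  proof (rule sum_mono)
    fix j assume "j \<in> {..<n}"
    then show "A i j * codeg j i \<le> A i j"
      using codeg_le[of j i] assms A_diag A_nonneg by (cases "i = j") (auto intro: mult_left_le)
  qed
  then show ?thesis by (simp add: sum_A)
qed

lemma sum_codeg: "(\<Sum>i<n. \<Sum>j<n. codeg i j) = (\<Sum>i<n. (real (deg i))\<^sup>2)"
proof -
  have "(\<Sum>i<n. \<Sum>j<n. codeg i j) = (\<Sum>i<n. \<Sum>k<n. \<Sum>j<n. A i k * A k j)"
    unfolding codeg_def by (intro sum.cong refl sum.swap)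
  also have "\<dots> = (\<Sum>i<n. \<Sum>k<n. A i k * deg k)" by (simp add: sum_distrib_left[symmetric] sum_A)
  also have "\<dots> = (\<Sum>k<n. \<Sum>i<n. A k i * deg k)" by (subst sum.swap) (simp add: A_sym)
  also have "\<dots> = (\<Sum>i<n. (real (deg i))\<^sup>2)" by (simp add: sum_distrib_right[symmetric] sum_A power2_eq_square)
  finally show ?thesis .
qed

text \<open>
  An edge in no triangle is a pair without a common neighbour, and the number of these pairs is
  determined by the degrees.
\<close>

lemma sum_tri_ge: "(\<Sum>i<n. (real (deg i))\<^sup>2) - real n * (real n - 1) \<le> (\<Sum>i<n. tri i)"
proof -
  have "(\<Sum>i<n. \<Sum>j<n. A i j - A i j * codeg i j) \<le> (\<Sum>i<n. \<Sum>j<n. 1 - codeg i j - (if i = j then 1 - real (deg i) else 0))"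
  proof (intro sum_mono)
    fix i j assume "i \<in> {..<n}" "j \<in> {..<n}"
    then show "A i j - A i j * codeg i j \<le> 1 - codeg i j - (if i = j then 1 - real (deg i) else 0)"
      using codeg_le[of i j] A_diag[of i] codeg_diag[of i] by (auto simp: A_def)
  qed
  also have "\<dots> = real n * real n - (\<Sum>i<n. (real (deg i))\<^sup>2) - real n + (\<Sum>i<n. real (deg i))"
    by (simp add: sum_subtractf sum_codeg)
  also have "(\<Sum>i<n. real (deg i)) = (\<Sum>i<n. \<Sum>j<n. A i j)" by (simp add: sum_A)
  finally have "- (\<Sum>i<n. \<Sum>j<n. A i j * codeg i j) \<le> real n * real n - (\<Sum>i<n. (real (deg i))\<^sup>2) - real n"
    by (simp add: sum_subtractf)
  moreover have "(\<Sum>i<n. \<Sum>j<n. A i j * codeg i j) = (\<Sum>i<n. tri i)"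
    unfolding tri_alt by (subst sum.swap) (simp add: A_sym)
  ultimately show ?thesis by (simp add: algebra_simps)
qed

lemma sum_deg_sq: "(\<Sum>i<n. (real (deg i))\<^sup>2) = real n * Q\<^sup>2 - 2 * Q * (Sp - Sk) + Sp2 + Sk2"
proof -
  have "(real (deg i))\<^sup>2 = Q\<^sup>2 - 2 * Q * (dfc i - exc i) + (dfc i)\<^sup>2 + (exc i)\<^sup>2" for i
    using excess_defect[of i] unfolding deg_eq by (auto simp: power2_eq_square algebra_simps)
  then show ?thesis by (simp add: sum.distrib sum_subtractf Sp_def Sk_def Sp2_def Sk2_def sum_distrib_left[symmetric])
qed

lemma sum_one_minus_u_deg: "(\<Sum>i<n. (1 - u i) * deg i) = Sk"
  using sum_deg by (simp add: left_diff_distrib u_deg sum_subtractf Sp_def)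

text \<open>The three kinds of closed walks give \<open>Sp3\<close>, the mixed sum \<open>M\<close>
  and the weighted triangle sum \<open>U\<close>. Both of the latter are first compared with their
  unweighted versions, and the errors are multiples of \<open>Sk\<close> because the total of (1 - u
  i) * deg i is \<open>Sk\<close>. The triangle count is then bounded by
  \<open>sum_tri_ge\<close>.\<close>

lemma tr3_ge: "real n * Q + Q * (Sp - Sk) + Sp3 - 2 * Sp2 + Sk2 - 3 * Sk \<le> Q ^ 3 * tr3"
proof -
  define M where "M = (\<Sum>i<n. \<Sum>j<n. dfc i * u j * A i j)"
  define U where "U = (\<Sum>i<n. \<Sum>j<n. \<Sum>k<n. u i * u j * u k * (A i j * A j k * A k i))"
  have "tr3 = (\<Sum>i<n. (dfc i / Q) ^ 3) + 3 * (\<Sum>i<n. \<Sum>j<n. dfc i / Q * (u i / Q) * (u j / Q) * A i j)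
     + (\<Sum>i<n. \<Sum>j<n. \<Sum>k<n. u i / Q * (u j / Q) * (u k / Q) * (A i j * A j k * A k i))"
    unfolding tr3_def P_eq by (rule trace3_delta_plus_adjacency[OF A_sym A_idem A_diag])
  moreover have "dfc i / Q * (u i / Q) * (u j / Q) * A i j = dfc i * u j * A i j / Q ^ 3" for i j
    using p_u[of i] by (simp add: power3_eq_cube)
  moreover have "u i / Q * (u j / Q) * (u k / Q) * (A i j * A j k * A k i) = u i * u j * u k * (A i j * A j k * A k i) / Q ^ 3" for i j k
    by (simp add: power3_eq_cube)
  ultimately have "tr3 = (\<Sum>i<n. (dfc i / Q) ^ 3) + 3 * (\<Sum>i<n. \<Sum>j<n. dfc i * u j * A i j / Q ^ 3)
     + (\<Sum>i<n. \<Sum>j<n. \<Sum>k<n. u i * u j * u k * (A i j * A j k * A k i) / Q ^ 3)" by (simp only:)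
  then have "tr3 = (Sp3 + 3 * M + U) / Q ^ 3"
    by (simp add: Sp3_def M_def U_def power_divide sum_divide_distrib[symmetric] add_divide_distrib)
  then have tr3: "Q ^ 3 * tr3 = Sp3 + 3 * M + U" using Q_ge by simp
  \<comment> \<open>Replacing the weight u j by 1 costs dfc i * (1 - u j) per arc, at most Q * (1 -
    u j) because defects do not exceed Q. These errors add up to Q * Sk.\<close>
  have "(\<Sum>i<n. \<Sum>j<n. dfc i * A i j - Q * ((1 - u j) * A j i)) \<le> M"
    unfolding M_def
  proof (intro sum_mono)
    fix i j
    have "dfc i * ((1 - u j) * A i j) \<le> Q * ((1 - u j) * A i j)"
      using defect_bounds[of i] u_bounds[of j] A_nonneg by (intro mult_right_mono mult_nonneg_nonneg) auto
    then show "dfc i * A i j - Q * ((1 - u j) * A j i) \<le> dfc i * u j * A i j"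
      using A_sym[of j i] by (simp add: algebra_simps)
  qed
  also have "(\<Sum>i<n. \<Sum>j<n. dfc i * A i j - Q * ((1 - u j) * A j i)) = (\<Sum>i<n. dfc i * deg i) - Q * Sk"
  proof -
    have "(\<Sum>i<n. \<Sum>j<n. Q * ((1 - u j) * A j i)) = Q * Sk"
      by (subst sum.swap) (simp add: sum_distrib_left[symmetric] sum_A sum_one_minus_u_deg)
    then show ?thesis by (simp add: sum_subtractf sum_distrib_left[symmetric] sum_A)
  qed
  also have "(\<Sum>i<n. dfc i * deg i) = Q * Sp - Sp2"
  proof -
    have "dfc i * deg i = Q * dfc i - (dfc i)\<^sup>2" for i
      using excess_defect[of i] unfolding deg_eq by (auto simp: algebra_simps power2_eq_square)
    then show ?thesis by (simp add: sum_subtractf Sp_def Sp2_def sum_distrib_left)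
  qed
  finally have M: "Q * Sp - Sp2 - Q * Sk \<le> M" .
  define t where "t i j k = A i j * A j k * A k i" for i j k
  have t: "0 \<le> t i j k" for i j k by (simp add: t_def A_nonneg)
  have tri_t: "tri i = (\<Sum>j<n. \<Sum>k<n. t i j k)" for i by (simp add: tri_def t_def)
  have rot: "t i j k = t j i k" "t i j k = t k i j" for i j k
    by (simp_all add: t_def A_sym mult_ac)
  have e1: "(\<Sum>i<n. \<Sum>j<n. \<Sum>k<n. u i * t i j k) = (\<Sum>i<n. u i * tri i)"
    by (simp add: tri_t sum_distrib_left)
  have e2: "(\<Sum>i<n. \<Sum>j<n. \<Sum>k<n. u j * t i j k) = (\<Sum>i<n. u i * tri i)"
    unfolding e1[symmetric] by (subst sum.swap) (intro sum.cong refl arg_cong2[where f = "(*)"] rot)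
  have e3: "(\<Sum>i<n. \<Sum>j<n. \<Sum>k<n. u k * t i j k) = (\<Sum>i<n. u i * tri i)"
  proof -
    have "(\<Sum>i<n. \<Sum>j<n. \<Sum>k<n. u k * t i j k) = (\<Sum>i<n. \<Sum>k<n. \<Sum>j<n. u k * t i j k)"
      by (intro sum.cong refl sum.swap)
    also have "\<dots> = (\<Sum>k<n. \<Sum>i<n. \<Sum>j<n. u k * t i j k)" by (rule sum.swap)
    also have "\<dots> = (\<Sum>k<n. \<Sum>i<n. \<Sum>j<n. u k * t k i j)" by (intro sum.cong refl arg_cong2[where f = "(*)"] rot)
    finally show ?thesis unfolding e1[symmetric] .
  qed
  \<comment> \<open>A product of three weights in [0, 1] is at least their sum minus 2. By symmetry
    of triangles the loss is three times the sum of (1 - u i) * tri i, hence at most 3 * Sk by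
    \<open>tri_le\<close>.\<close>
  have "(\<Sum>i<n. \<Sum>j<n. \<Sum>k<n. u i * t i j k + u j * t i j k + u k * t i j k - 2 * t i j k) \<le> U"
    unfolding U_def t_def[symmetric]
  proof (intro sum_mono)
    fix i j k
    have "0 \<le> (1 - u i) * (1 - u j)" "0 \<le> (1 - u i * u j) * (1 - u k)"
      using u_bounds u_bounds(1)[THEN less_imp_le] by (auto intro!: mult_nonneg_nonneg mult_le_one)
    then have "u i + u j + u k - 2 \<le> u i * u j * u k" by (simp add: algebra_simps)
    then have "(u i + u j + u k - 2) * t i j k \<le> u i * u j * u k * t i j k" using t by (rule mult_right_mono)
    then show "u i * t i j k + u j * t i j k + u k * t i j k - 2 * t i j k \<le> u i * u j * u k * t i j k"
      by (simp add: algebra_simps)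
  qed
  also have "(\<Sum>i<n. \<Sum>j<n. \<Sum>k<n. u i * t i j k + u j * t i j k + u k * t i j k - 2 * t i j k)
      = 3 * (\<Sum>i<n. u i * tri i) - 2 * (\<Sum>i<n. tri i)"
  proof -
    have "(\<Sum>i<n. \<Sum>j<n. \<Sum>k<n. 2 * t i j k) = 2 * (\<Sum>i<n. tri i)" by (simp add: tri_t sum_distrib_left)
    then show ?thesis by (simp only: sum.distrib sum_subtractf e1 e2 e3)
  qed
  finally have U: "(\<Sum>i<n. tri i) - 3 * (\<Sum>i<n. (1 - u i) * tri i) \<le> U"
    by (simp add: left_diff_distrib sum_subtractf)
  have "(\<Sum>i<n. (1 - u i) * tri i) \<le> (\<Sum>i<n. (1 - u i) * deg i)"
    using tri_le u_bounds by (intro sum_mono mult_left_mono) auto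
  then have "(\<Sum>i<n. tri i) - 3 * Sk \<le> U" using U sum_one_minus_u_deg by simp
  moreover have "real n * Q\<^sup>2 - real n * (real n - 1) = real n * Q"
    by (simp add: real_n algebra_simps power2_eq_square)
  ultimately show ?thesis using M sum_tri_ge sum_deg_sq unfolding tr3 by (simp add: algebra_simps)
qed

section \<open>Combining the trace bounds\<close>

text \<open>The values 1, n / Q and 1 are the traces of P, P^2 and P^3 when the spectrum is 1
  together with n - 1 numbers \<open>r\<close> or \<open>-r\<close> of sum zero, and Q^2 / (2 n) is
  the quadratic coefficient 1 / (2 (1 - r^2)). By \<open>ln_tau\<close> the logarithm of the tree
  count is (n - 3) / 2 * ln n plus the slack minus nonnegative quantities.\<close>

definition slack :: "real \<Rightarrow> real" where
  "slack r = (\<Sum>i<n. ln (D i / Q)) - linear_coeff r * (tr1 - 1) - (tr2 - real n / Q) * (Q\<^sup>2 / (2 * real n)) - cubic_coeff r * (tr3 - 1)"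

text \<open>The sum \<open>Sp\<close> is traded for \<open>Sk + Q\<close> plus a nonnegative
  surplus. In the first trace this leaves Sk / Q. In the third, Q (Sp - Sk) - Q (Q - 1) = (Q - 1)
  (Sp - Sk - Q) + Sp - Sk: the leftover Sp completes p^3 - 2 p^2 to p (p - 1)^2, and the leftover
  -Sk turns 3 k into 4 k.\<close>

lemma slack_le_vertex_terms:
  assumes "0 \<le> cubic_coeff r"
  shows "slack r \<le> (\<Sum>i<n. vertex_term Q r (dfc i) (exc i)) - (linear_coeff r / Q + cubic_coeff r * (Q - 1) / Q ^ 3) * (Sp - Sk - Q)"
proof -
  have "0 < n" by (simp add: n)
  then have n0: "0 < real n" by simp
  have "(\<Sum>i<n. vertex_term Q r (dfc i) (exc i)) = (\<Sum>i<n. ln (D i / Q)) - linear_coeff r * Sk / Q + Sk / (2 * n)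
     + cubic_coeff r * (4 * Sk - Sk2) / Q ^ 3 - (Sp2 - Sp) / (2 * n) - cubic_coeff r * (Sp3 - 2 * Sp2 + Sp) / Q ^ 3"
  proof -
    define b g c where "b = linear_coeff r / Q" and "g = 1 / (2 * real n)" and "c = cubic_coeff r / Q ^ 3"
    have "vertex_term Q r (dfc i) (exc i) = ln (D i / Q) - b * exc i + g * exc i + c * (4 * exc i) - c * (exc i)\<^sup>2
      - g * (dfc i)\<^sup>2 + g * dfc i - c * (dfc i ^ 3) + c * (2 * (dfc i)\<^sup>2) - c * dfc i" for i
      unfolding vertex_term_def real_n[symmetric] D_def b_def g_def c_def using Q_ge
      by (simp add: add_divide_distrib diff_divide_distrib algebra_simps power2_eq_square power3_eq_cube)
    then have "(\<Sum>i<n. vertex_term Q r (dfc i) (exc i)) = (\<Sum>i<n. ln (D i / Q)) - b * Sk + g * Sk + c * (4 * Sk) - c * Sk2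
      - g * Sp2 + g * Sp - c * Sp3 + c * (2 * Sp2) - c * Sp"
      by (simp add: sum.distrib sum_subtractf sum_distrib_left[symmetric] Sp_def Sk_def Sp2_def Sk2_def Sp3_def)
    then show ?thesis
      by (simp add: b_def g_def c_def add_divide_distrib diff_divide_distrib algebra_simps)
  qed
  moreover have "linear_coeff r * (tr1 - 1) = linear_coeff r * Sk / Q + linear_coeff r / Q * (Sp - Sk - Q)"
    unfolding tr1_eq using Q_ge by (simp add: field_simps)
  moreover have "(tr2 - real n / Q) * (Q\<^sup>2 / (2 * real n)) \<ge> (Sp2 - Sp) / (2 * n) - Sk / (2 * n)"
  proof -
    have "(tr2 - real n / Q) * (Q\<^sup>2 / (2 * real n)) = (Q\<^sup>2 * tr2 - real n * Q) / (2 * n)"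
      using Q_ge by (simp add: diff_divide_distrib left_diff_distrib power2_eq_square)
    also have "\<dots> \<ge> (Sp2 - Sp - Sk) / (2 * n)" using tr2_ge n0 by (intro divide_right_mono) auto
    finally show ?thesis by (simp add: diff_divide_distrib)
  qed
  moreover have "cubic_coeff r * (tr3 - 1) \<ge> cubic_coeff r * (Sp3 - 2 * Sp2 + Sp) / Q ^ 3 - cubic_coeff r * (4 * Sk - Sk2) / Q ^ 3 + cubic_coeff r * (Q - 1) / Q ^ 3 * (Sp - Sk - Q)"
  proof -
    have "Q ^ 3 * (tr3 - 1) \<ge> Sp3 - 2 * Sp2 + Sp - (4 * Sk - Sk2) + (Q - 1) * (Sp - Sk - Q)"
      using tr3_ge by (simp add: real_n algebra_simps power2_eq_square power3_eq_cube)
    then have "tr3 - 1 \<ge> (Sp3 - 2 * Sp2 + Sp - (4 * Sk - Sk2) + (Q - 1) * (Sp - Sk - Q)) / Q ^ 3"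
      using Q_ge by (simp add: pos_divide_le_eq mult.commute)
    then have "cubic_coeff r * (tr3 - 1) \<ge> cubic_coeff r * ((Sp3 - 2 * Sp2 + Sp - (4 * Sk - Sk2) + (Q - 1) * (Sp - Sk - Q)) / Q ^ 3)"
      using assms by (rule mult_left_mono)
    moreover have "c * ((a - d + e * f) / z) = c * a / z - c * d / z + c * e / z * f" for a c d e f z :: real
      by (simp add: add_divide_distrib diff_divide_distrib distrib_left right_diff_distrib)
    ultimately show ?thesis by (simp only:)
  qed
  ultimately show ?thesis unfolding slack_def by (simp add: distrib_right)
qed

context
  fixes r :: real
  assumes r: "0 < r" "r\<^sup>2 = (Q - 1) / Q\<^sup>2"
begin

lemma r2_le: "r\<^sup>2 \<le> 2/9"
proof -
  have "0 \<le> (Q - 3) * (2 * Q - 3)" using Q_ge by (intro mult_nonneg_nonneg) auto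
  also have "\<dots> = 2 * (Q * Q) - 9 * Q + 9" by (simp add: algebra_simps)
  finally show ?thesis unfolding r using Q_ge by (simp add: divide_simps) (simp add: algebra_simps power2_eq_square)
qed

lemma r_less_1: "r < 1"
proof -
  have "r\<^sup>2 < 1\<^sup>2" using r2_le by simp
  then show ?thesis by (rule power_less_imp_less_base) simp
qed

lemma vertex_term_le: "vertex_term Q r (dfc i) (exc i) \<le> 0"
  and vertex_term_zero: "vertex_term Q r (dfc i) (exc i) = 0 \<Longrightarrow> excess i = 0 \<and> (defect i = 0 \<or> defect i = 1)"
proof -
  have "vertex_term Q r (dfc i) (exc i) \<le> 0 \<and> (vertex_term Q r (dfc i) (exc i) = 0 \<longrightarrow> excess i = 0 \<and> (defect i = 0 \<or> defect i = 1))"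
  proof (cases "excess i = 0")
    case True
    then show ?thesis using vertex_term_small[OF Q_ge r defect_bounds(1)[of i]] by simp
  next
    case False
    then show ?thesis using vertex_term_large[OF Q_ge r, of "exc i"] excess_large[of i] excess_defect[of i] by auto
  qed
  then show "vertex_term Q r (dfc i) (exc i) \<le> 0"
    and "vertex_term Q r (dfc i) (exc i) = 0 \<Longrightarrow> excess i = 0 \<and> (defect i = 0 \<or> defect i = 1)" by auto
qed

text \<open>Besides nonpositive vertex terms there is the surplus \<open>Sp - Sk - Q\<close> with a
  strictly negative factor. Zero slack therefore fixes the number of edges exactly and leaves only
  the degrees Q and Q - 1.\<close>

lemma slack_le: "slack r \<le> 0"
  and slack_zero: "slack r = 0 \<Longrightarrow> Sp - Sk = Q \<and> (\<forall>i<n. excess i = 0 \<and> (defect i = 0 \<or> defect i = 1))"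
proof -
  have c: "0 \<le> cubic_coeff r" using cubic_coeff_bounds(1)[OF r(1) r_less_1] by simp
  have l: "0 < linear_coeff r" using linear_coeff_ge[OF r(1) r2_le] by simp
  let ?c = "linear_coeff r / Q + cubic_coeff r * (Q - 1) / Q ^ 3"
  have pos: "0 < ?c" using c l Q_ge by (intro add_pos_nonneg divide_pos_pos) auto
  have neg: "(\<Sum>i<n. vertex_term Q r (dfc i) (exc i)) \<le> 0" by (intro sum_nonpos vertex_term_le)
  have T: "0 \<le> ?c * (Sp - Sk - Q)" using pos Sp_Sk by (intro mult_nonneg_nonneg) auto
  show "slack r \<le> 0" using slack_le_vertex_terms[OF c] neg T by linarith
  assume "slack r = 0"
  then have z: "(\<Sum>i<n. vertex_term Q r (dfc i) (exc i)) = 0" "?c * (Sp - Sk - Q) = 0"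
    using slack_le_vertex_terms[OF c] neg T by linarith+
  have "(\<Sum>i<n. - vertex_term Q r (dfc i) (exc i)) = 0" using z(1) by (simp add: sum_negf)
  then have "\<forall>i\<in>{..<n}. - vertex_term Q r (dfc i) (exc i) = 0"
    using vertex_term_le by (subst (asm) sum_nonneg_eq_0_iff) auto
  moreover have "Sp - Sk = Q" using z(2) pos by simp
  ultimately show "Sp - Sk = Q \<and> (\<forall>i<n. excess i = 0 \<and> (defect i = 0 \<or> defect i = 1))"
    using vertex_term_zero by auto
qed

end

end

section \<open>The matrix tree theorem\<close>

text \<open>Spanning trees rooted at 0, each vertex pointing to its parent. Extensionality makes the
  encoding unique. It also makes f 0 \<open>undefined\<close>, so iterates beyond the root carry no
  meaning, and only the existence of a visit to 0 is asked for.\<close>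

definition parent_maps :: "nat \<Rightarrow> (nat \<Rightarrow> nat \<Rightarrow> bool) \<Rightarrow> (nat \<Rightarrow> nat) set" where
  "parent_maps n E = {f \<in> {1..<n} \<rightarrow>\<^sub>E {..<n}. (\<forall>i\<in>{1..<n}. E i (f i)) \<and> (\<forall>i<n. \<exists>m. (f ^^ m) i = 0)}"

text \<open>Row i >= 1 is the Laplacian row of the single arc from i to f i. The unit row 0 stands
  for deleting the root.\<close>

definition functional_mat :: "nat \<Rightarrow> (nat \<Rightarrow> nat) \<Rightarrow> real mat" where
  "functional_mat n f = mat n n (\<lambda>(i,j). if i = 0 then of_bool (j = 0) else of_bool (j = i) - of_bool (j = f i))"

text \<open>In the Leibniz expansion a permutation with nonzero product sends every moved point to
  its image under \<open>f\<close>, and that image is moved as well. Following \<open>f\<close> from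
  a moved point thus reaches the root as a moved point, but row 0 forces the root to be fixed. Only
  the identity remains.\<close>

lemma det_functional_mat_tree:
  assumes f: "f \<in> {1..<n} \<rightarrow> {..<n}" and ne: "\<And>i. i \<in> {1..<n} \<Longrightarrow> f i \<noteq> i"
    and reach: "\<And>i. i < n \<Longrightarrow> \<exists>m. (f ^^ m) i = 0"
  shows "det (functional_mat n f) = 1"
proof -
  let ?M = "functional_mat n f"
  have zero: "(\<Prod>i = 0..<n. ?M $$ (i, p i)) = 0" if p: "p permutes {0..<n}" and "p \<noteq> id" for p
  proof (rule ccontr)
    assume nz: "(\<Prod>i = 0..<n. ?M $$ (i, p i)) \<noteq> 0"
    have pi: "p i < n" if "i < n" for i using permutes_in_image[OF p, of i] that by simp
    have e: "?M $$ (i, p i) \<noteq> 0" if "i < n" for i using nz that by simp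
    have step: "p i = (if i = 0 then 0 else if p i = i then i else f i)" if "i < n" for i
      using e[OF that] pi[OF that] that by (auto simp: functional_mat_def split: if_splits)
    obtain i where i: "p i \<noteq> i" using \<open>p \<noteq> id\<close> by (auto simp: fun_eq_iff)
    then have "i < n" using p permutes_not_in by fastforce
    have "(f ^^ m) i < n \<and> p ((f ^^ m) i) \<noteq> (f ^^ m) i" for m
    proof (induction m)
      case (Suc m)
      let ?j = "(f ^^ m) i"
      have "?j \<noteq> 0"
      proof
        assume "?j = 0"
        then show False using step[of ?j] Suc by simp
      qed
      then have "p ?j = f ?j" using step[of ?j] Suc by auto
      moreover have "p (p ?j) \<noteq> p ?j" using Suc permutes_inj[OF p] by (auto dest: injD)
      ultimately show ?case using pi[of ?j] Suc by auto
    qed (use i \<open>i < n\<close> in auto)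
    moreover obtain m where "(f ^^ m) i = 0" using reach \<open>i < n\<close> by blast
    ultimately show False using step[of 0] \<open>i < n\<close> by (metis)
  qed
  have "det ?M = (\<Sum>p \<in> {p. p permutes {0..<n}}. signof p * (\<Prod>i = 0..<n. ?M $$ (i, p i)))"
    by (rule det_def') (simp add: functional_mat_def)
  also have "\<dots> = (\<Sum>p \<in> {p. p permutes {0..<n}}. if p = id then 1 else 0)"
  proof (rule sum.cong[OF refl])
    fix p assume "p \<in> {p. p permutes {0..<n}}"
    then show "signof p * (\<Prod>i = 0..<n. ?M $$ (i, p i)) = (if p = id then 1 else 0)"
    proof (cases "p = id")
      case True
      have "?M $$ (i, i) = 1" if "i < n" for i
        using that ne[of i] by (cases "i = 0") (auto simp: functional_mat_def)
      then show ?thesis using True by simp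
    qed (use zero[of p] in simp)
  qed
  also have "\<dots> = 1" by (simp add: permutes_id finite_permutations)
  finally show ?thesis .
qed

text \<open>A vertex j other than 0 reaches the root exactly if f j does, so the indicator vector of
  the vertices that never reach it lies in the kernel.\<close>

lemma det_functional_mat_non_tree:
  assumes f: "f \<in> {1..<n} \<rightarrow> {..<n}" and i: "i < n" and nr: "\<nexists>m. (f ^^ m) i = 0"
  shows "det (functional_mat n f) = 0"
proof -
  let ?M = "functional_mat n f"
  define x where "x = vec n (\<lambda>i. of_bool (\<nexists>m. (f ^^ m) i = 0) :: real)"
  have M: "?M \<in> carrier_mat n n" by (simp add: functional_mat_def)
  have shift: "(\<exists>m. (f ^^ m) j = 0) \<longleftrightarrow> (\<exists>m. (f ^^ m) (f j) = 0)" if nz: "j \<noteq> 0" for j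
  proof
    assume "\<exists>m. (f ^^ m) j = 0"
    then obtain m where m: "(f ^^ m) j = 0" by blast
    then obtain k where "m = Suc k" using nz m by (cases m) auto
    then show "\<exists>m. (f ^^ m) (f j) = 0" using m by (auto simp: funpow_swap1)
  next
    assume "\<exists>m. (f ^^ m) (f j) = 0"
    then obtain m where "(f ^^ m) (f j) = 0" by blast
    then have "(f ^^ Suc m) j = 0" by (simp add: funpow_swap1)
    then show "\<exists>m. (f ^^ m) j = 0" by blast
  qed
  have "?M *\<^sub>v x = 0\<^sub>v n"
  proof (rule eq_vecI)
    fix j assume "j < dim_vec (0\<^sub>v n)"
    then have j: "j < n" by simp
    have "(?M *\<^sub>v x) $ j = (\<Sum>k<n. ?M $$ (j,k) * x $ k)"
      using M j by (simp add: scalar_prod_def atLeast0LessThan x_def)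
    also have "\<dots> = 0"
    proof (cases "j = 0")
      case True
      have "x $ 0 = 0" using j True by (auto simp: x_def intro: exI[of _ 0])
      then have "?M $$ (j,k) * x $ k = 0" if "k < n" for k using that True by (cases "k = 0") (simp_all add: functional_mat_def)
      then show ?thesis by (intro sum.neutral) auto
    next
      case False
      then have fj: "f j < n" using f j by auto
      have "(\<Sum>k<n. ?M $$ (j,k) * x $ k) = (\<Sum>k<n. (if k = j then x $ k else 0) - (if k = f j then x $ k else 0))"
        using False j by (intro sum.cong) (auto simp: functional_mat_def)
      also have "\<dots> = x $ j - x $ f j" using j fj by (simp add: sum_subtractf)
      also have "x $ j = x $ f j" using j fj by (simp only: x_def index_vec shift[OF False])
      also have "x $ f j - x $ f j = 0" by simp
      finally show ?thesis .
    qed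
    finally show "(?M *\<^sub>v x) $ j = 0\<^sub>v n $ j" using j by simp
  qed (simp add: functional_mat_def)
  moreover have "x \<in> carrier_vec n" by (simp add: x_def)
  moreover have "x \<noteq> 0\<^sub>v n"
  proof
    assume "x = 0\<^sub>v n"
    then have "x $ i = 0" using i by simp
    then show False using i nr by (simp add: x_def)
  qed
  ultimately show ?thesis using det_0_iff_vec_prod_zero_field[OF M] by blast
qed

definition rooted_laplacian :: "nat \<Rightarrow> (nat \<Rightarrow> nat \<Rightarrow> bool) \<Rightarrow> real mat" where
  "rooted_laplacian n E = mat n n (\<lambda>(i,j). if i = 0 then of_bool (j = 0)
     else of_bool (i = j) * real (card {k. k < n \<and> E i k}) - of_bool (E i j))"

text \<open>Row i >= 1 of the Laplacian is the sum, over the neighbours j of i, of the row of the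
  single arc from i to j. Multilinearity expands the determinant over all choices of one neighbour
  per vertex, and each choice contributes 1 if it is a tree and 0 otherwise.\<close>

theorem det_rooted_laplacian:
  assumes n: "0 < n" and irr: "\<And>i. \<not> E i i"
  shows "det (rooted_laplacian n E) = real (card (parent_maps n E))"
proof -
  let ?N = "\<lambda>i. {k. k < n \<and> E i k}"
  let ?F = "Pi\<^sub>E {1..<n} ?N"
  let ?R = "\<lambda>i j s. of_bool (s = i) - of_bool (s = j) :: real"
  have fin: "finite ?F" by (intro finite_PiE) auto
  have entry: "rooted_laplacian n E $$ (i, s) = (\<Sum>j\<in>?N i. ?R i j s)" if "i \<in> {1..<n}" "s < n" for i s
  proof -
    have "(\<Sum>j\<in>?N i. of_bool (s = j) :: real) = of_bool (E i s)"
      using that by (auto simp: of_bool_def sum.If_cases Int_def intro!: card_1_singleton_iff[THEN iffD2] exI[of _ s])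
    then show ?thesis using that by (auto simp: rooted_laplacian_def sum_subtractf)
  qed
  have split: "{0..<n} = insert 0 {1..<n}" using n by auto
  have "det (rooted_laplacian n E) = (\<Sum>p \<in> {p. p permutes {0..<n}}. signof p * (\<Prod>i = 0..<n. rooted_laplacian n E $$ (i, p i)))"
    by (rule det_def') (simp add: rooted_laplacian_def)
  also have "\<dots> = (\<Sum>p \<in> {p. p permutes {0..<n}}. \<Sum>f\<in>?F. signof p * (\<Prod>i = 0..<n. functional_mat n f $$ (i, p i)))"
  proof (rule sum.cong[OF refl])
    fix p assume "p \<in> {p. p permutes {0..<n}}"
    then have p: "p i < n" if "i < n" for i using permutes_in_image[of p "{0..<n}" i] that by simp
    have "(\<Prod>i = 0..<n. rooted_laplacian n E $$ (i, p i)) = of_bool (p 0 = 0) * (\<Prod>i\<in>{1..<n}. \<Sum>j\<in>?N i. ?R i j (p i))"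
      unfolding split using entry p n by (subst prod.insert) (auto simp: rooted_laplacian_def intro!: prod.cong)
    also have "(\<Prod>i\<in>{1..<n}. \<Sum>j\<in>?N i. ?R i j (p i)) = (\<Sum>f\<in>?F. \<Prod>i\<in>{1..<n}. ?R i (f i) (p i))"
      by (rule prod_sum_PiE) auto
    also have "of_bool (p 0 = 0) * \<dots> = (\<Sum>f\<in>?F. \<Prod>i = 0..<n. functional_mat n f $$ (i, p i))"
      unfolding split sum_distrib_left
    proof (rule sum.cong[OF refl])
      fix f
      show "of_bool (p 0 = 0) * (\<Prod>i\<in>{1..<n}. ?R i (f i) (p i)) = (\<Prod>i\<in>insert 0 {1..<n}. functional_mat n f $$ (i, p i))"
        using p n by (subst prod.insert) (auto simp: functional_mat_def intro!: prod.cong)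
    qed
    finally show "signof p * (\<Prod>i = 0..<n. rooted_laplacian n E $$ (i, p i)) =
      (\<Sum>f\<in>?F. signof p * (\<Prod>i = 0..<n. functional_mat n f $$ (i, p i)))" by (simp add: sum_distrib_left)
  qed
  also have "\<dots> = (\<Sum>f\<in>?F. det (functional_mat n f))"
  proof (subst sum.swap, rule sum.cong[OF refl])
    fix f
    show "(\<Sum>p \<in> {p. p permutes {0..<n}}. signof p * (\<Prod>i = 0..<n. functional_mat n f $$ (i, p i))) = det (functional_mat n f)"
      by (rule det_def'[symmetric]) (simp add: functional_mat_def)
  qed
  also have "\<dots> = (\<Sum>f\<in>?F. of_bool (f \<in> parent_maps n E))"
  proof (rule sum.cong[OF refl])
    fix f assume f: "f \<in> ?F"
    have f': "f \<in> {1..<n} \<rightarrow> {..<n}" and fE: "f \<in> {1..<n} \<rightarrow>\<^sub>E {..<n}" and Ef: "\<forall>i\<in>{1..<n}. E i (f i)"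
      using f by (auto simp: PiE_iff)
    show "det (functional_mat n f) = of_bool (f \<in> parent_maps n E)"
    proof (cases "\<forall>i<n. \<exists>m. (f ^^ m) i = 0")
      case True
      have "f i \<noteq> i" if "i \<in> {1..<n}" for i using Ef irr that by metis
      then have "det (functional_mat n f) = 1" using det_functional_mat_tree[OF f'] True by blast
      then show ?thesis using True Ef fE by (simp add: parent_maps_def)
    next
      case False
      then have "det (functional_mat n f) = 0" "f \<notin> parent_maps n E"
        using det_functional_mat_non_tree[OF f'] by (blast, simp add: parent_maps_def)
      then show ?thesis by simp
    qed
  qed
  also have "\<dots> = real (card (?F \<inter> parent_maps n E))"
    using fin by (simp add: of_bool_def sum.If_cases Int_def)
  also have "?F \<inter> parent_maps n E = parent_maps n E"
    by (auto simp: parent_maps_def PiE_iff extensional_def)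
  finally show ?thesis .
qed

text \<open>
  Adding all rows to the first row and all columns to the first column isolates the rank one part.
\<close>

lemma det_laplacian_rank_one:
  fixes w :: "nat \<Rightarrow> real" and E :: "nat \<Rightarrow> nat \<Rightarrow> bool"
  assumes n: "0 < n" and sym: "\<And>i j. E i j \<longleftrightarrow> E j i"
    and W: "W = (\<Sum>i<n. w i)" "W \<noteq> 0"
  defines "L \<equiv> \<lambda>i j. of_bool (i = j) * real (card {k. k < n \<and> E i k}) - of_bool (E i j)"
  shows "det (mat n n (\<lambda>(i,j). L i j + c * w i * w j)) = c * W\<^sup>2 * det (rooted_laplacian n E)"
proof -
  let ?M = "mat n n (\<lambda>(i,j). L i j + c * w i * w j)"
  define X where "X = mat n n (\<lambda>(i,j). if i = 0 \<or> i = j then 1 else 0 :: real)"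
  \<comment> \<open>\<open>Z\<close> reverses an elimination: subtracting \<open>w i / W\<close>
    times row 0 from row i clears the entry \<open>c * W * w i\<close> in column 0 and at the same
    time removes the rank one part elsewhere, leaving \<open>L i j\<close> in
    \<open>N\<close>.\<close>
  define Z where "Z = mat n n (\<lambda>(i,j). if i = j then 1 else if j = 0 then w i / W else 0)"
  define N where "N = mat n n (\<lambda>(i,j). if j = 0 then if i = 0 then c * W\<^sup>2 else 0
     else if i = 0 then c * W * w j else L i j)"
  have carr: "?M \<in> carrier_mat n n" "X \<in> carrier_mat n n" "X\<^sup>T \<in> carrier_mat n n" "Z \<in> carrier_mat n n" "N \<in> carrier_mat n n"
    by (auto simp: X_def Z_def N_def)
  have row: "(\<Sum>j<n. L i j) = 0" if "i < n" for i
  proof -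
    have "(\<Sum>j<n. of_bool (E i j)) = real (card {k. k < n \<and> E i k})"
      by (simp add: of_bool_def sum.If_cases Int_def)
    then show ?thesis using that by (simp add: L_def sum_subtractf of_bool_def if_distrib[of "\<lambda>x. x * _"] cong: if_cong)
  qed
  have Lsym: "L i j = L j i" for i j using sym by (auto simp: L_def)
  have mult: "(B * C) $$ (i,j) = (\<Sum>k<n. B $$ (i,k) * C $$ (k,j))" if "B \<in> carrier_mat n n" "C \<in> carrier_mat n n" "i < n" "j < n" for B C :: "real mat" and i j
    using that by (simp add: scalar_prod_def atLeast0LessThan)
  have msum: "(\<Sum>j<n. L i j + c * w i * w j) = c * w i * W" if "i < n" for i
    using row[OF that] by (simp add: sum.distrib W sum_distrib_left[symmetric])
  have XM: "(X * ?M) $$ (i,j) = (if i = 0 then c * W * w j else L i j + c * w i * w j)" if ij: "i < n" "j < n" for i j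
  proof (cases "i = 0")
    case True
    have "(X * ?M) $$ (i,j) = (\<Sum>k<n. L j k + c * w j * w k)"
      using True ij Lsym[of _ j] unfolding mult[OF carr(2,1) ij] by (intro sum.cong refl) (auto simp: X_def mult_ac)
    then show ?thesis using msum[OF ij(2)] True by (simp add: mult_ac)
  next
    case False
    have "(X * ?M) $$ (i,j) = (\<Sum>k<n. if k = i then L i j + c * w i * w j else 0)"
      using False ij unfolding mult[OF carr(2,1) ij] by (intro sum.cong refl) (auto simp: X_def)
    then show ?thesis using False ij by simp
  qed
  have XMX: "(X * ?M * X\<^sup>T) $$ (i,j) = (if j = 0 then if i = 0 then c * W\<^sup>2 else c * W * w i else if i = 0 then c * W * w j else L i j + c * w i * w j)"
    if ij: "i < n" "j < n" for i j
  proof -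
    have XMc: "X * ?M \<in> carrier_mat n n" using carr by auto
    note m = mult[OF XMc carr(3) ij]
    show ?thesis
    proof (cases "j = 0")
      case True
      have "(X * ?M * X\<^sup>T) $$ (i,j) = (\<Sum>k<n. if i = 0 then c * W * w k else L i k + c * w i * w k)"
        unfolding m using True ij XM by (intro sum.cong refl) (auto simp: X_def)
      then show ?thesis using True msum[OF ij(1)] by (simp add: W(1)[symmetric] sum_distrib_left[symmetric] power2_eq_square mult_ac)
    next
      case False
      have "(X * ?M * X\<^sup>T) $$ (i,j) = (\<Sum>k<n. if k = j then (if i = 0 then c * W * w j else L i j + c * w i * w j) else 0)"
        unfolding m using False ij XM by (intro sum.cong refl) (auto simp: X_def)
      then show ?thesis using False ij by simp
    qed
  qed
  have "X * ?M * X\<^sup>T = Z * N"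
  proof (rule eq_matI)
    fix i j assume "i < dim_row (Z * N)" "j < dim_col (Z * N)"
    then have ij: "i < n" "j < n" using carr by auto
    have "(Z * N) $$ (i,j) = (\<Sum>k<n. (if k = i then N $$ (i,j) else 0) + (if k = 0 then (if i = 0 then 0 else w i / W * N $$ (0,j)) else 0))"
      unfolding mult[OF carr(4,5) ij] using ij by (intro sum.cong refl) (auto simp: Z_def)
    also have "\<dots> = N $$ (i,j) + (if i = 0 then 0 else w i / W * N $$ (0,j))" using ij n by (simp add: sum.distrib)
    also have "\<dots> = (X * ?M * X\<^sup>T) $$ (i,j)"
      unfolding XMX[OF ij] using ij n W(2) by (auto simp: N_def power2_eq_square)
    finally show "(X * ?M * X\<^sup>T) $$ (i,j) = (Z * N) $$ (i,j)" ..
  qed (use carr in auto)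
  then have "det X * det ?M * det (X\<^sup>T) = det Z * det N"
    using det_mult[OF carr(2,1)] det_mult[OF _ carr(3), of "X * ?M"] det_mult[OF carr(4,5)] carr by auto
  moreover have "det X = 1"
  proof -
    have "upper_triangular X" by (auto simp: X_def)
    then have "det X = prod_list (diag_mat X)" by (rule det_upper_triangular[OF _ carr(2)])
    also have "\<dots> = 1" using carr(2) by (auto simp: diag_mat_def prod.list_conv_set_nth X_def)
    finally show ?thesis .
  qed
  moreover have "det Z = 1"
  proof -
    have "det Z = prod_list (diag_mat Z)" by (rule det_lower_triangular[OF _ carr(4)]) (auto simp: Z_def)
    also have "\<dots> = 1" using carr(4) by (auto simp: diag_mat_def prod.list_conv_set_nth Z_def)
    finally show ?thesis .
  qed
  ultimately have "det ?M = det N" using det_transpose[OF carr(2)] by simp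
  also have "\<dots> = c * W\<^sup>2 * det (mat_delete N 0 0)"
  proof -
    have "det N = (\<Sum>i<n. N $$ (i,0) * cofactor N i 0)" by (rule laplace_expansion_column[OF carr(5) n])
    also have "\<dots> = (\<Sum>i<n. if i = 0 then c * W\<^sup>2 * cofactor N 0 0 else 0)"
      using n by (intro sum.cong refl) (auto simp: N_def)
    finally show ?thesis using n by (simp add: cofactor_def)
  qed
  also have "mat_delete N 0 0 = mat_delete (rooted_laplacian n E) 0 0"
    by (intro eq_matI) (auto simp: mat_delete_def N_def rooted_laplacian_def L_def)
  also have "det (mat_delete (rooted_laplacian n E) 0 0) = det (rooted_laplacian n E)"
  proof -
    have R: "rooted_laplacian n E \<in> carrier_mat n n" by (simp add: rooted_laplacian_def)
    have "det (rooted_laplacian n E) = (\<Sum>j<n. rooted_laplacian n E $$ (0,j) * cofactor (rooted_laplacian n E) 0 j)"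
      by (rule laplace_expansion_row[OF R n])
    also have "\<dots> = (\<Sum>j<n. if j = 0 then cofactor (rooted_laplacian n E) 0 0 else 0)"
      using n by (intro sum.cong refl) (auto simp: rooted_laplacian_def)
    finally show ?thesis using n by (simp add: cofactor_def)
  qed
  finally show ?thesis .
qed

section \<open>Spanning trees correspond to parent maps\<close>

lemma parent_mapsD:
  assumes "f \<in> parent_maps n E"
  shows "f \<in> extensional {1..<n}" "\<And>i. i \<in> {1..<n} \<Longrightarrow> f i < n" "\<And>i. i \<in> {1..<n} \<Longrightarrow> E i (f i)"
    "\<And>i. i < n \<Longrightarrow> \<exists>m. (f ^^ m) i = 0"
  using assms by (auto simp: parent_maps_def PiE_iff)

definition depth :: "(nat \<Rightarrow> nat) \<Rightarrow> nat \<Rightarrow> nat" where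
  "depth f i = (LEAST m. (f ^^ m) i = 0)"

lemma depth_parent:
  assumes f: "f \<in> parent_maps n E" and i: "i \<in> {1..<n}"
  shows "depth f i = Suc (depth f (f i))"
proof -
  obtain m where m: "(f ^^ m) i = 0" using parent_mapsD(4)[OF f] i by auto
  have "depth f i = Suc (LEAST m. (f ^^ Suc m) i = 0)"
    unfolding depth_def by (rule Least_Suc[where P = "\<lambda>m. (f ^^ m) i = 0", OF m]) (use i in auto)
  then show ?thesis by (simp add: depth_def funpow_swap1)
qed

definition parent_arcs :: "nat \<Rightarrow> (nat \<Rightarrow> nat) \<Rightarrow> (nat \<times> nat) set" where
  "parent_arcs n f = (\<Union>i\<in>{1..<n}. {(i, f i), (f i, i)})"

text \<open>The orientation towards 0 is determined by the edges. If f i and g i differ, the edge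
  between i and f i must belong to g as \<open>g (f i) = i\<close>. Since f i is less deep,
  induction gives \<open>f (f i) = i\<close>, which is impossible by depth.\<close>

lemma parent_arcs_inj:
  assumes f: "f \<in> parent_maps n E" and g: "g \<in> parent_maps n E" and eq: "parent_arcs n f = parent_arcs n g"
  shows "f = g"
proof -
  have "f i = g i" if "i \<in> {1..<n}" for i
    using that
  proof (induction "depth f i" arbitrary: i rule: less_induct)
    case less
    let ?y = "f i"
    have y: "?y < n" using parent_mapsD(2)[OF f less.prems] .
    have di: "depth f i = Suc (depth f ?y)" using depth_parent[OF f less.prems] .
    show ?case
    proof (rule ccontr)
      assume ne: "f i \<noteq> g i"
      have "(i, ?y) \<in> parent_arcs n f" using less.prems by (auto simp: parent_arcs_def)
      then have "(i, ?y) \<in> parent_arcs n g" by (simp only: eq)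
      then have gy: "g ?y = i" "?y \<in> {1..<n}" using ne by (auto simp: parent_arcs_def)
      then have "f ?y = i" using less.hyps[of ?y] di by simp
      then show False using depth_parent[OF f gy(2)] di by simp
    qed
  qed
  then show ?thesis using parent_mapsD(1)[OF f] parent_mapsD(1)[OF g] by (intro extensionalityI) auto
qed

definition parent_graph :: "nat \<Rightarrow> (nat \<Rightarrow> 'a) \<Rightarrow> (nat \<Rightarrow> nat) \<Rightarrow> 'a pair_pre_digraph" where
  "parent_graph n h f = \<lparr> pverts = h ` {..<n}, parcs = map_prod h h ` parent_arcs n f \<rparr>"

lemma parent_arcs_cases:
  assumes "(i, j) \<in> parent_arcs n f"
  obtains "i \<in> {1..<n}" "j = f i" | "j \<in> {1..<n}" "i = f j"
  using assms by (auto simp: parent_arcs_def)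

lemma parent_arcs_less:
  assumes f: "f \<in> parent_maps n E" and a: "(i, j) \<in> parent_arcs n f"
  shows "i < n" "j < n"
  using parent_arcs_cases[OF a] parent_mapsD(2)[OF f] by (metis atLeastLessThan_iff)+

text \<open>A cycle is given as a list of arcs from a base point. Indices modulo the length remove
  the base point, so that every position has a predecessor and a successor.\<close>

lemma (in pair_pre_digraph) cycle_indices:
  assumes "cycle p"
  shows "distinct (map snd p)" and "\<And>k. k < length p \<Longrightarrow> fst (p ! (Suc k mod length p)) = snd (p ! k)"
    and "set p \<subseteq> parcs G"
proof -
  obtain u where u: "awalk u p u" "distinct (tl (pawalk_verts u p))" "p \<noteq> []"
    using assms unfolding cycle_def by auto
  have cas: "pcas u p u" and "set p \<subseteq> parcs G" using u(1) by (auto simp: awalk_def)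
  then show "set p \<subseteq> parcs G" by blast
  have verts: "pawalk_verts a p = a # map snd p" if "pcas a p b" for a b
    using that by (induction p arbitrary: a) auto
  show "distinct (map snd p)" using u(2) verts[OF cas] by simp
  have inner: "fst (p ! Suc k) = snd (p ! k)" if "pcas a p b" "Suc k < length p" for a b k
    using that
  proof (induction p arbitrary: a k)
    case (Cons e es)
    then show ?case by (cases k; cases es) auto
  qed simp
  have ends: "fst (p ! 0) = a" "snd (p ! (length p - 1)) = b" if "pcas a p b" "p \<noteq> []" for a b
    using that by (induction p arbitrary: a) (auto simp: nth_Cons' split: if_splits)
  show "fst (p ! (Suc k mod length p)) = snd (p ! k)" if "k < length p" for k
  proof (cases "Suc k < length p")
    case True then show ?thesis using inner[OF cas] by simp
  next
    case False
    then have "Suc k = length p" using that by simp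
    then show ?thesis using ends[OF cas u(3)] by (metis diff_Suc_1 mod_self)
  qed
qed

locale labelled_pair_graph = pair_graph G for G :: "'a pair_pre_digraph" +
  fixes n :: nat and h :: "nat \<Rightarrow> 'a"
  assumes label: "bij_betw h {..<n} (pverts G)" and n_pos: "0 < n"
begin

definition adj :: "nat \<Rightarrow> nat \<Rightarrow> bool" where
  "adj i j \<longleftrightarrow> i < n \<and> j < n \<and> (h i, h j) \<in> parcs G"

lemma inj_label: "i < n \<Longrightarrow> j < n \<Longrightarrow> h i = h j \<longleftrightarrow> i = j"
  using label by (auto simp: bij_betw_def inj_on_def)

lemma label_image: "h ` {..<n} = pverts G"
  using label by (simp add: bij_betw_def)

lemma adj_sym: "adj i j \<longleftrightarrow> adj j i"
  using sym_arcs by (auto simp: adj_def symmetric_def dest: symD)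

lemma adj_irrefl: "\<not> adj i i"
  using no_loops' by (auto simp: adj_def)

lemma parent_graph_arcs:
  assumes f: "f \<in> parent_maps n adj" and ij: "i < n" "j < n"
  shows "(h i, h j) \<in> parcs (parent_graph n h f) \<longleftrightarrow> (i, j) \<in> parent_arcs n f"
  using parent_arcs_less[OF f] inj_label ij unfolding parent_graph_def by (force simp: image_iff)

lemma parent_arcs_adj:
  assumes f: "f \<in> parent_maps n adj" shows "(i, j) \<in> parent_arcs n f \<Longrightarrow> adj i j"
  using parent_mapsD(3)[OF f] adj_sym by (auto simp: parent_arcs_def)

lemma parent_graph_sub:
  assumes f: "f \<in> parent_maps n adj" shows "parcs (parent_graph n h f) \<subseteq> parcs G"
  using parent_arcs_adj[OF f] by (auto simp: parent_graph_def adj_def)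

lemma parent_graph_pair_graph:
  assumes f: "f \<in> parent_maps n adj" shows "pair_graph (parent_graph n h f)"
proof
  let ?T = "parent_graph n h f"
  have v: "pverts ?T = pverts G" by (simp add: parent_graph_def label_image)
  note sub = parent_graph_sub[OF f]
  show "fst e \<in> pverts ?T" "snd e \<in> pverts ?T" "fst e \<noteq> snd e" if "e \<in> parcs ?T" for e
    using that sub no_loops wellformed unfolding v by auto
  show "finite (pverts ?T)" unfolding v by (rule pair_finite_verts)
  show "finite (parcs ?T)" using sub pair_finite_arcs by (rule finite_subset)
  show "symmetric ?T"
    by (auto simp: symmetric_def parent_graph_def parent_arcs_def intro!: symI)
qed

lemma parent_graph_connected:
  assumes f: "f \<in> parent_maps n adj" shows "Digraph_Component.connected (parent_graph n h f)"
proof -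
  let ?T = "parent_graph n h f"
  interpret T: pair_graph ?T by (rule parent_graph_pair_graph[OF f])
  have v: "pverts ?T = h ` {..<n}" by (simp add: parent_graph_def)
  have r: "h i \<rightarrow>\<^sup>*\<^bsub>?T\<^esub> h 0" if "i < n" for i
    using that
  proof (induction "depth f i" arbitrary: i rule: less_induct)
    case less
    show ?case
    proof (cases "i = 0")
      case True
      have "h 0 \<rightarrow>\<^sup>*\<^bsub>?T\<^esub> h 0" using n_pos v by (intro T.reachable_refl) simp
      then show ?thesis unfolding True .
    next
      case False
      then have i: "i \<in> {1..<n}" using less.prems by auto
      have "h (f i) \<rightarrow>\<^sup>*\<^bsub>?T\<^esub> h 0"
        using less.hyps[of "f i"] depth_parent[OF f i] parent_mapsD(2)[OF f i] by auto
      moreover have "(h i, h (f i)) \<in> parcs ?T"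
    proof -
      have "(i, f i) \<in> parent_arcs n f" using i by (auto simp: parent_arcs_def)
      then show ?thesis by (force simp: parent_graph_def)
    qed
      ultimately show ?thesis by (rule T.adj_reachable_trans[rotated])
    qed
  qed
  show ?thesis
  proof (rule T.connectedI)
    fix u v assume "u \<in> pverts ?T" "v \<in> pverts ?T"
    then obtain i j where ij: "i < n" "u = h i" "j < n" "v = h j" using v by auto
    have "u \<rightarrow>\<^sup>*\<^bsub>?T\<^esub> h 0" unfolding ij(2) by (rule r[OF ij(1)])
    moreover have "h 0 \<rightarrow>\<^sup>*\<^bsub>?T\<^esub> v" unfolding ij(4) by (rule T.symmetric_reachable'[OF r[OF ij(3)]])
    ultimately have "u \<rightarrow>\<^sup>*\<^bsub>?T\<^esub> v" by (rule T.reachable_trans)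
    then show "u \<rightarrow>\<^sup>*\<^bsub>with_proj (mk_symmetric ?T)\<^esub> v" by (rule T.reachable_mk_symmetricI)
  qed (use n_pos v in auto)
qed

text \<open>At a vertex of greatest depth on the cycle both cyclic neighbours are no deeper, hence
  both are its parent. On a cycle of length at least 3 they are the heads of two different arcs,
  although heads on a cycle are distinct.\<close>

lemma parent_graph_acyclic:
  assumes f: "f \<in> parent_maps n adj" shows "acyclic_graph (parent_graph n h f)"
  unfolding acyclic_graph_def
proof
  let ?T = "parent_graph n h f"
  assume "\<exists>p. pre_digraph.cycle ?T p \<and> 3 \<le> length p"
  then obtain p where p: "pre_digraph.cycle ?T p" and len: "3 \<le> length p" by blast
  let ?m = "length p"
  note c = pair_pre_digraph.cycle_indices[OF p]
  define idx where "idx = the_inv_into {..<n} h"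
  have idx: "idx (h i) = i" if "i < n" for i
    unfolding idx_def using that label by (intro the_inv_into_f_f) (auto simp: bij_betw_def)
  have arc: "(idx (fst (p ! k)), idx (snd (p ! k))) \<in> parent_arcs n f"
    "h (idx (snd (p ! k))) = snd (p ! k)" if "k < ?m" for k
  proof -
    have "p ! k \<in> parcs ?T" using c(3) that by auto
    then obtain i j where ij: "p ! k = (h i, h j)" "(i, j) \<in> parent_arcs n f" by (auto simp: parent_graph_def)
    then show "(idx (fst (p ! k)), idx (snd (p ! k))) \<in> parent_arcs n f"
      "h (idx (snd (p ! k))) = snd (p ! k)" using idx parent_arcs_less[OF f ij(2)] by auto
  qed
  define D where "D k = depth f (idx (snd (p ! k)))" for k
  obtain k where k: "k < ?m" and max: "\<And>j. j < ?m \<Longrightarrow> D j \<le> D k"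
  proof -
    have "Max (D ` {..<?m}) \<in> D ` {..<?m}" using len by (intro Max_in) (auto simp: lessThan_empty_iff)
    then obtain k where "k < ?m" "D k = Max (D ` {..<?m})" by auto
    then show thesis by (intro that[of k]) auto
  qed
  \<comment> \<open>Adding \<open>?m - 1\<close> is the step backwards modulo \<open>?m\<close>; it
    is correct at k = 0 as well.\<close>
  let ?next = "Suc k mod ?m" and ?prev = "(k + (?m - 1)) mod ?m"
  have "0 < ?m" by (rule le_less_trans[OF le0 k])
  then have lt: "?next < ?m" "?prev < ?m" by simp_all
  have "Suc ?prev mod ?m = Suc (k + (?m - 1)) mod ?m" by (simp add: mod_Suc_eq)
  also have "Suc (k + (?m - 1)) = k + ?m" using k by simp
  finally have prevnext: "Suc ?prev mod ?m = k" using k by simp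
  \<comment> \<open>Here the length 3 matters: on the directed 2-cycle of a single edge successor
    and predecessor coincide.\<close>
  have ne: "?next \<noteq> ?prev"
  proof
    assume "?next = ?prev"
    then have "k = Suc ?next mod ?m" using prevnext by simp
    also have "\<dots> = (k + 2) mod ?m" by (simp add: mod_Suc_eq)
    finally show False using k len by (cases "k + 2 < ?m") (auto simp: mod_if split: if_splits)
  qed
  let ?x = "idx (snd (p ! k))"
  have par: "y = f ?x" if "(y, ?x) \<in> parent_arcs n f" "depth f y \<le> depth f ?x" for y
    using that(1)
  proof (cases rule: parent_arcs_cases)
    case 1
    then show ?thesis using depth_parent[OF f, of y] that(2) by simp
  qed
  have sym: "(a, b) \<in> parent_arcs n f \<longleftrightarrow> (b, a) \<in> parent_arcs n f" for a b
    by (auto simp: parent_arcs_def)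
  have "idx (snd (p ! ?prev)) = f ?x"
    using arc(1)[OF k] max[OF lt(2)] c(2)[OF lt(2)] prevnext by (intro par) (auto simp: D_def)
  moreover have "idx (snd (p ! ?next)) = f ?x"
    using arc(1)[OF lt(1)] max[OF lt(1)] c(2)[OF k] sym by (intro par) (auto simp: D_def)
  ultimately have "snd (p ! ?next) = snd (p ! ?prev)" using arc(2) lt by metis
  then show False using c(1) ne lt by (auto simp: distinct_conv_nth)
qed

lemma parent_graph_spanning_tree:
  assumes f: "f \<in> parent_maps n adj" shows "undirected_spanning_tree (parent_graph n h f) G"
proof -
  interpret T: pair_graph "parent_graph n h f" by (rule parent_graph_pair_graph[OF f])
  have "pverts (parent_graph n h f) = pverts G" by (simp add: parent_graph_def label_image)
  then have "spanning (parent_graph n h f) G"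
    using parent_graph_sub[OF f] wf_digraph T.wf_digraph by (auto simp: spanning_def subgraph_def compatible_def)
  then show ?thesis
    using T.pair_graph_axioms parent_graph_connected[OF f] parent_graph_acyclic[OF f]
    by (simp add: undirected_spanning_tree_def)
qed

text \<open>Each vertex other than 0 chooses a neighbour in \<open>T\<close> that is strictly closer
  to 0. The resulting parent graph lies in \<open>T\<close>. An arc (u, v) of \<open>T\<close>
  outside it would close a path of the parent graph from v to u to a cycle. That path has at least
  two arcs, since one arc would already contain the edge between u and v, so the cycle has length at
  least 3.\<close>

lemma spanning_tree_parent_graph:
  assumes T: "undirected_spanning_tree T G"
  obtains f where "f \<in> parent_maps n adj" "T = parent_graph n h f"
proof -
  interpret T: pair_graph T using T by (simp add: undirected_spanning_tree_def)
  have vT: "pverts T = pverts G" and sub: "parcs T \<subseteq> parcs G" and con: "Digraph_Component.connected T"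
    and ac: "acyclic_graph T"
    using T by (auto simp: undirected_spanning_tree_def spanning_def subgraph_def)
  define R where "R = {(i, j). i < n \<and> j < n \<and> (h i, h j) \<in> parcs T}"
  have "strongly_connected T" using T.symmetric_connected_imp_strongly_connected con T.sym_arcs by blast
  have reach: "(i, 0) \<in> R\<^sup>*" if "i < n" for i
  proof -
    have "h i \<in> pverts G" "h 0 \<in> pverts G" using that n_pos label_image by auto
    then have "h i \<rightarrow>\<^sup>*\<^bsub>T\<^esub> h 0" using \<open>strongly_connected T\<close>
      unfolding strongly_connected_def by (simp add: vT)
    then have "(h i, h 0) \<in> (parcs T)\<^sup>*" using reachable_rtranclI[of T] by simp
    then have "\<exists>j<n. h j = h i \<and> (j, 0) \<in> R\<^sup>*"
    proof (induction rule: converse_rtrancl_induct)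
      case base
      then show ?case using n_pos by auto
    next
      case (step y z)
      then obtain j where j: "j < n" "h j = z" "(j, 0) \<in> R\<^sup>*" by auto
      have "y \<in> h ` {..<n}" using step(1) T.wellformed label_image vT by auto
      then obtain l where "l < n" "h l = y" by auto
      then show ?case using j step(1) by (intro exI[of _ l]) (auto simp: R_def intro: converse_rtrancl_into_rtrancl)
    qed
    then show ?thesis using inj_label that by blast
  qed
  define d where "d i = (LEAST m. (i, 0) \<in> R ^^ m)" for i
  have closer: "\<exists>j. (i, j) \<in> R \<and> d j < d i" if i: "i < n" "i \<noteq> 0" for i
  proof -
    obtain m where "(i, 0) \<in> R ^^ m" using reach[OF i(1)] by (auto simp: rtrancl_power)
    then have di: "(i, 0) \<in> R ^^ d i" unfolding d_def by (rule LeastI)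
    then obtain l where l: "d i = Suc l" using i by (cases "d i") auto
    then obtain j where j: "(i, j) \<in> R" "(j, 0) \<in> R ^^ l" using di unfolding l by (blast elim: relpow_Suc_E2)
    then have "d j \<le> l" unfolding d_def by (intro Least_le)
    then show ?thesis using j l by auto
  qed
  define f where "f = (\<lambda>i\<in>{1..<n}. SOME j. (i, j) \<in> R \<and> d j < d i)"
  have fR: "(i, f i) \<in> R" "d (f i) < d i" if "i \<in> {1..<n}" for i
    using someI_ex[OF closer[of i]] that by (auto simp: f_def)
  have reach0: "\<exists>m. (f ^^ m) i = 0" if "i < n" for i
    using that
  proof (induction "d i" arbitrary: i rule: less_induct)
    case less
    show ?case
    proof (cases "i = 0")
      case True
      then show ?thesis by (intro exI[of _ 0]) auto
    next
      case False
      then have i: "i \<in> {1..<n}" using less.prems by auto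
      then obtain m where "(f ^^ m) (f i) = 0" using less.hyps[of "f i"] fR[OF i] by (auto simp: R_def)
      then have "(f ^^ Suc m) i = 0" by (simp add: funpow_swap1)
      then show ?thesis by blast
    qed
  qed
  have f: "f \<in> parent_maps n adj"
    using fR(1) reach0 sub by (auto simp: parent_maps_def f_def R_def adj_def PiE_iff)
  let ?S = "parent_graph n h f"
  interpret S: pair_graph ?S by (rule parent_graph_pair_graph[OF f])
  have vS: "pverts ?S = pverts T" by (simp add: parent_graph_def label_image vT)
  have ST: "parcs ?S \<subseteq> parcs T"
  proof -
    have "(h i, h (f i)) \<in> parcs T" "(h (f i), h i) \<in> parcs T" if "i \<in> {1..<n}" for i
      using fR(1)[OF that] T.sym_arcs by (auto simp: R_def symmetric_def dest: symD)
    then show ?thesis by (auto simp: parent_graph_def parent_arcs_def)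
  qed
  have "parcs T \<subseteq> parcs ?S"
  proof (rule subrelI, rule ccontr)
    fix u v assume uv: "(u, v) \<in> parcs T" "(u, v) \<notin> parcs ?S"
    have "strongly_connected ?S"
      using S.symmetric_connected_imp_strongly_connected parent_graph_connected[OF f] S.sym_arcs by blast
    moreover have mem: "u \<in> pverts ?S" "v \<in> pverts ?S" using uv(1) T.wellformed' unfolding vS by auto
    ultimately have "v \<rightarrow>\<^sup>*\<^bsub>?S\<^esub> u" unfolding strongly_connected_def by auto
    then obtain p where "S.apath v p u" using S.reachable_awalk S.apath_awalk_to_apath by blast
    then have p: "S.awalk v p u" "distinct (pawalk_verts v p)" by (auto simp: S.apath_def)
    have "u \<noteq> v" using uv T.no_loops' by auto
    have "T.cycle ((u, v) # p)"
      unfolding T.cycle_def using p uv ST mem vS by (intro exI[of _ u]) (auto simp: T.awalk_def S.awalk_def)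
    moreover have "3 \<le> length ((u, v) # p)"
    proof (rule ccontr)
      assume "\<not> 3 \<le> length ((u, v) # p)"
      then consider "p = []" | e where "p = [e]" by (cases p; cases "tl p") auto
      then show False
      proof cases
        case 1
        then show False using p \<open>u \<noteq> v\<close> by (auto simp: S.awalk_def)
      next
        case 2
        then have "(v, u) \<in> parcs ?S" using p by (cases e) (auto simp: S.awalk_def)
        then show False using uv(2) S.sym_arcs by (auto simp: symmetric_def dest: symD)
      qed
    qed
    ultimately show False using ac unfolding acyclic_graph_def by blast
  qed
  then have "T = ?S" using ST vS by (simp add: pair_pre_digraph.equality)
  then show thesis using that f by blast
qed

lemma num_spanning_trees_eq: "num_spanning_trees G = card (parent_maps n adj)"
proof -
  have "inj_on (parent_graph n h) (parent_maps n adj)"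
  proof
    fix f g assume fg: "f \<in> parent_maps n adj" "g \<in> parent_maps n adj" "parent_graph n h f = parent_graph n h g"
    have "(i, j) \<in> parent_arcs n f \<longleftrightarrow> (i, j) \<in> parent_arcs n g" for i j
      using parent_graph_arcs[OF fg(1), of i j] parent_graph_arcs[OF fg(2), of i j] fg(3)
        parent_arcs_less[OF fg(1), of i j] parent_arcs_less[OF fg(2), of i j] by auto
    then have "parent_arcs n f = parent_arcs n g" by auto
    then show "f = g" by (rule parent_arcs_inj[OF fg(1,2)])
  qed
  moreover have "{T. undirected_spanning_tree T G} = parent_graph n h ` parent_maps n adj"
    using parent_graph_spanning_tree spanning_tree_parent_graph by blast
  ultimately show ?thesis by (simp add: num_spanning_trees_def card_image)
qed

end

section \<open>The spectral bound\<close>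

definition mat_trace :: "'a::comm_ring_1 mat \<Rightarrow> 'a" where
  "mat_trace A = (\<Sum>i<dim_row A. A $$ (i,i))"

lemma mat_trace_mult_comm:
  assumes "A \<in> carrier_mat n m" "B \<in> carrier_mat m n"
  shows "mat_trace (A * B) = mat_trace (B * A)"
proof -
  have "mat_trace (A * B) = (\<Sum>i<n. \<Sum>j<m. A $$ (i,j) * B $$ (j,i))"
    using assms by (auto simp: mat_trace_def scalar_prod_def atLeast0LessThan intro!: sum.cong)
  also have "\<dots> = (\<Sum>j<m. \<Sum>i<n. B $$ (j,i) * A $$ (i,j))"
    by (subst sum.swap) (simp add: mult.commute)
  also have "\<dots> = mat_trace (B * A)"
    using assms by (auto simp: mat_trace_def scalar_prod_def atLeast0LessThan intro!: sum.cong)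
  finally show ?thesis .
qed

lemma mat_trace_similar:
  assumes "similar_mat A B" shows "mat_trace A = mat_trace B"
proof -
  obtain n P Q where *: "A \<in> carrier_mat n n" "B \<in> carrier_mat n n" "P \<in> carrier_mat n n" "Q \<in> carrier_mat n n"
     "Q * P = 1\<^sub>m n" "A = P * B * Q"
    using similar_matD[OF assms] by auto
  have "mat_trace A = mat_trace (P * (B * Q))" using * by (simp add: assoc_mult_mat)
  also have "\<dots> = mat_trace (B * Q * P)" using * by (subst mat_trace_mult_comm[of _ n n]) auto
  also have "B * Q * P = B" using * by (simp add: assoc_mult_mat[of _ n n _ n _ n])
  finally show ?thesis .
qed

lemma upper_triangular_mult_index:
  fixes A B :: "'a::comm_ring_1 mat"
  assumes "A \<in> carrier_mat n n" "B \<in> carrier_mat n n" "upper_triangular A" "upper_triangular B"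
    and "j \<le> i" "i < n"
  shows "(A * B) $$ (i,j) = (if i = j then A $$ (i,i) * B $$ (i,i) else 0)"
proof -
  have "(A * B) $$ (i,j) = (\<Sum>k<n. A $$ (i,k) * B $$ (k,j))"
    using assms by (simp add: scalar_prod_def atLeast0LessThan)
  also have "\<dots> = (\<Sum>k<n. if k = i then (if i = j then A $$ (i,i) * B $$ (i,i) else 0) else 0)"
  proof (rule sum.cong[OF refl])
    fix k assume "k \<in> {..<n}"
    then show "A $$ (i,k) * B $$ (k,j) = (if k = i then (if i = j then A $$ (i,i) * B $$ (i,i) else 0) else 0)"
      using assms upper_triangularD[of A k i] upper_triangularD[of B j k]
      by (cases "k < i"; cases "j < k"; cases "k = i") auto
  qed
  finally show ?thesis using assms by simp
qed

lemma upper_triangular_pow: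
  fixes A :: "'a::comm_ring_1 mat"
  assumes "A \<in> carrier_mat n n" "upper_triangular A"
  shows "upper_triangular (A ^\<^sub>m k) \<and> (\<forall>i<n. (A ^\<^sub>m k) $$ (i,i) = (A $$ (i,i)) ^ k)"
proof (induction k)
  case (Suc k)
  have c: "A ^\<^sub>m k \<in> carrier_mat n n" using assms by simp
  have "upper_triangular (A ^\<^sub>m k * A)"
  proof (rule upper_triangularI)
    fix i j assume "j < i" "i < dim_row (A ^\<^sub>m k * A)"
    then show "(A ^\<^sub>m k * A) $$ (i,j) = 0"
      using upper_triangular_mult_index[OF c assms(1) _ assms(2), of j i] Suc c by auto
  qed
  moreover have "(A ^\<^sub>m k * A) $$ (i,i) = (A $$ (i,i)) ^ Suc k" if "i < n" for i
    using upper_triangular_mult_index[OF c assms(1) _ assms(2), of i i] Suc that by (simp add: mult.commute)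
  ultimately show ?case by simp
qed (use assms in auto)

lemma mat_trace_of_real: "mat_trace (map_mat complex_of_real A) = complex_of_real (mat_trace A)"
  if "A \<in> carrier_mat n n"
  using that by (auto simp: mat_trace_def)

lemma of_real_pow_mat:
  assumes "A \<in> carrier_mat n n"
  shows "map_mat complex_of_real (A ^\<^sub>m k) = map_mat complex_of_real A ^\<^sub>m k"
  by (rule of_real_hom.mat_hom_pow[OF assms])

lemma det_one_minus_char_poly:
  fixes A :: "'a::field mat"
  assumes "A \<in> carrier_mat n n"
  shows "det (1\<^sub>m n - A) = poly (char_poly A) 1"
proof -
  have "1\<^sub>m n - A = - char_matrix A 1"
    using assms by (intro eq_matI) (auto simp: char_matrix_def)
  then show ?thesis using char_poly_matrix[OF assms] by simp
qed

text \<open>Symmetry is not assumed, so the eigenvalues are taken from the diagonal of a triangular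
  form over the complex numbers. This lists them with multiplicity, and one list serves the
  determinant and all power traces.\<close>

lemma real_spectrum:
  fixes A :: "real mat"
  assumes A: "A \<in> carrier_mat n n"
    and ev: "\<And>z v. eigenvector (map_mat complex_of_real A) v z \<Longrightarrow> z \<in> \<real> \<and> Re z \<le> 1"
  obtains e :: "nat \<Rightarrow> real" where "\<And>i. i < n \<Longrightarrow> e i \<le> 1"
    "det (1\<^sub>m n - A) = (\<Prod>i<n. 1 - e i)"
    "\<And>k. mat_trace (A ^\<^sub>m k) = (\<Sum>i<n. e i ^ k)"
proof -
  let ?A = "map_mat complex_of_real A"
  have cA: "?A \<in> carrier_mat n n" using A by simp
  obtain es where es: "char_poly ?A = (\<Prod>a\<leftarrow>es. [:- a, 1:])"
    using char_poly_factorized[OF cA] by blast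
  obtain B where B: "B \<in> carrier_mat n n" "upper_triangular B" "similar_mat ?A B"
    using schur_decomposition_exists[OF cA es] by blast
  define e where "e i = Re (B $$ (i,i))" for i
  have cp: "char_poly ?A = (\<Prod>a\<leftarrow>diag_mat B. [:- a, 1:])"
    using char_poly_similar[OF B(3)] char_poly_upper_triangular[OF B(1,2)] by simp
  have e: "B $$ (i,i) = complex_of_real (e i)" "e i \<le> 1" if "i < n" for i
  proof -
    have "B $$ (i,i) \<in> set (diag_mat B)" using that B(1) by (auto simp: diag_mat_def)
    then have "poly (char_poly ?A) (B $$ (i,i)) = 0" unfolding cp by (rule linear_poly_root)
    then have "eigenvalue ?A (B $$ (i,i))" using eigenvalue_root_char_poly[OF cA] by simp
    then obtain v where "eigenvector ?A v (B $$ (i,i))" unfolding eigenvalue_def by blast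
    from ev[OF this] show "B $$ (i,i) = complex_of_real (e i)" "e i \<le> 1"
      by (auto simp: e_def complex_is_Real_iff complex_eq_iff)
  qed
  have "complex_of_real (det (1\<^sub>m n - A)) = det (map_mat complex_of_real (1\<^sub>m n - A))" by simp
  also have "map_mat complex_of_real (1\<^sub>m n - A) = 1\<^sub>m n - ?A"
    using A by (intro eq_matI) auto
  also have "det \<dots> = poly (\<Prod>a\<leftarrow>diag_mat B. [:- a, 1:]) 1"
    using det_one_minus_char_poly[OF cA] cp by simp
  also have "\<dots> = (\<Prod>a\<leftarrow>diag_mat B. 1 - a)"
    by (simp add: poly_prod_list o_def)
  also have "\<dots> = (\<Prod>i<n. 1 - B $$ (i,i))"
    using B(1) by (simp add: diag_mat_def prod.list_conv_set_nth atLeast0LessThan)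
  also have "\<dots> = complex_of_real (\<Prod>i<n. 1 - e i)"
    using e by (auto intro!: prod.cong)
  finally have d: "det (1\<^sub>m n - A) = (\<Prod>i<n. 1 - e i)" by (simp only: of_real_eq_iff)
  have "mat_trace (A ^\<^sub>m k) = (\<Sum>i<n. e i ^ k)" for k
  proof -
    have "complex_of_real (mat_trace (A ^\<^sub>m k)) = mat_trace (?A ^\<^sub>m k)"
      using mat_trace_of_real[of "A ^\<^sub>m k" n] of_real_pow_mat[OF A, of k] A by simp
    also have "similar_mat (?A ^\<^sub>m k) (B ^\<^sub>m k)" using B(3) similar_mat_wit_pow
      unfolding similar_mat_def by blast
    then have "mat_trace (?A ^\<^sub>m k) = mat_trace (B ^\<^sub>m k)" by (rule mat_trace_similar)
    also have "\<dots> = (\<Sum>i<n. (B $$ (i,i)) ^ k)"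
      using upper_triangular_pow[OF B(1,2)] B(1) by (auto simp: mat_trace_def intro!: sum.cong)
    also have "\<dots> = complex_of_real (\<Sum>i<n. e i ^ k)" using e by auto
    finally show ?thesis by (simp only: of_real_eq_iff)
  qed
  then show thesis using that e d by blast
qed

section \<open>Moving the trivial eigenvalue\<close>

context sparse_c4_free
begin

definition W :: real where "W = (\<Sum>i<n. D i)"
text \<open>The stationary distribution of \<open>P\<close>, and so its left eigenvector for the
  eigenvalue 1.\<close>

definition e :: "nat \<Rightarrow> real" where "e i = D i / W"

lemma n_pos: "0 < n" by (simp add: n)

lemma W_ge: "real n * Q \<le> W"
  using sum_mono[of "{..<n}" "\<lambda>_. Q" D] D_ge by (simp add: W_def)

lemma W_pos: "0 < W" using order.strict_trans2[OF mult_pos_pos[of "real n" Q] W_ge] n_pos Q_ge by simp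

lemma D_P_eq: "D i * P i j = (if i = j then dfc i else 0) + A i j"
proof -
  have "D i \<noteq> 0" using D_pos[of i] by simp
  then have "D i * P i j = of_int (of_bool (i = j) * defect i) + A i j" unfolding P_def by (metis nonzero_mult_div_cancel_left times_divide_eq_right)
  then show ?thesis by simp
qed

lemma sum_e: "(\<Sum>i<n. e i) = 1" using W_pos by (simp add: e_def sum_divide_distrib[symmetric] W_def[symmetric])

lemma e_P: "j < n \<Longrightarrow> (\<Sum>i<n. e i * P i j) = e j"
proof -
  assume j: "j < n"
  have "(\<Sum>i<n. e i * P i j) = (\<Sum>i<n. D j * P j i / W)" by (simp add: e_def D_P)
  also have "\<dots> = D j * (\<Sum>i<n. P j i) / W" by (simp add: sum_distrib_left sum_divide_distrib)
  finally show ?thesis using P_row[OF j] by (simp add: e_def)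
qed

text \<open>
  \<open>C r\<close> has the eigenvalues of \<open>P\<close>, except that the trivial eigenvalue 1 is moved to \<open>r\<close>, where
  the cubic bound is exact.
\<close>

definition C :: "real \<Rightarrow> nat \<Rightarrow> nat \<Rightarrow> real" where "C r i j = P i j - (1 - r) * e j"
definition P2 :: "nat \<Rightarrow> nat \<Rightarrow> real" where "P2 i k = (\<Sum>j<n. P i j * P j k)"

lemma P2_row: "i < n \<Longrightarrow> (\<Sum>j<n. P2 i j) = 1"
proof -
  assume i: "i < n"
  have "(\<Sum>k<n. P2 i k) = (\<Sum>j<n. P i j * (\<Sum>k<n. P j k))"
    unfolding P2_def by (subst sum.swap) (simp add: sum_distrib_left)
  also have "\<dots> = 1" using P_row[OF i] by (simp add: P_row)
  finally show ?thesis .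
qed

text \<open>As matrices C = P - (1 - r) J, where every row of J is \<open>e\<close>. Since P J = J P
  = J = J J, all mixed terms are multiples of J, and squaring only replaces r by r^2 in the
  correction.\<close>

lemma C2: "i < n \<Longrightarrow> k < n \<Longrightarrow> (\<Sum>j<n. C r i j * C r j k) = P2 i k - (1 - r\<^sup>2) * e k"
proof -
  assume i: "i < n" and k: "k < n"
  have "(\<Sum>j<n. C r i j * C r j k) = (\<Sum>j<n. P i j * P j k - (1 - r) * e k * P i j - (1 - r) * (e j * P j k) + (1 - r)\<^sup>2 * e k * e j)"
    by (intro sum.cong refl) (simp add: C_def algebra_simps power2_eq_square)
  also have "\<dots> = P2 i k - (1 - r) * e k * (\<Sum>j<n. P i j) - (1 - r) * (\<Sum>j<n. e j * P j k) + (1 - r)\<^sup>2 * e k * (\<Sum>j<n. e j)"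
    by (simp only: sum.distrib sum_subtractf sum_distrib_left[symmetric] P2_def)
  finally show ?thesis using P_row[OF i] e_P[OF k] sum_e by (simp add: algebra_simps power2_eq_square)
qed

definition Cm :: "real \<Rightarrow> real mat" where "Cm r = mat n n (\<lambda>(i,j). C r i j)"

lemma Cm_carrier: "Cm r \<in> carrier_mat n n" by (simp add: Cm_def)

lemma Cm_index: "i < n \<Longrightarrow> j < n \<Longrightarrow> Cm r $$ (i,j) = C r i j" by (simp add: Cm_def)

lemma Cm_sq: "i < n \<Longrightarrow> k < n \<Longrightarrow> (Cm r ^\<^sub>m 2) $$ (i,k) = P2 i k - (1 - r\<^sup>2) * e k"
  using C2 Cm_carrier[of r] by (simp add: numeral_2_eq_2 Cm_def scalar_prod_def atLeast0LessThan)

lemma trace_Cm1: "mat_trace (Cm r ^\<^sub>m 1) = tr1 - 1 + r"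
  using sum_e Cm_carrier[of r] by (simp add: mat_trace_def Cm_def C_def sum_subtractf tr1_def sum_distrib_left[symmetric])

lemma trace_Cm2: "mat_trace (Cm r ^\<^sub>m 2) = tr2 - 1 + r\<^sup>2"
proof -
  have "mat_trace (Cm r ^\<^sub>m 2) = (\<Sum>i<n. P2 i i - (1 - r\<^sup>2) * e i)"
    using Cm_sq[of _ _ r] Cm_carrier[of r] by (simp add: mat_trace_def)
  then show ?thesis using sum_e by (simp add: sum_subtractf sum_distrib_left[symmetric] P2_def tr2_def)
qed

lemma pow_mat_add: "A \<in> carrier_mat m m \<Longrightarrow> A ^\<^sub>m (a + b) = A ^\<^sub>m a * A ^\<^sub>m b" for A :: "real mat"
  by (induction b) (auto simp: assoc_mult_mat[of _ m m _ m _ m])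

lemma trace_mult: "A \<in> carrier_mat n n \<Longrightarrow> B \<in> carrier_mat n n \<Longrightarrow> mat_trace (A * B) = (\<Sum>i<n. \<Sum>j<n. A $$ (i,j) * B $$ (j,i))" for A B :: "real mat"
  by (auto simp: mat_trace_def scalar_prod_def atLeast0LessThan intro!: sum.cong)

lemma trace_Cm3: "mat_trace (Cm r ^\<^sub>m 3) = tr3 - 1 + r ^ 3"
proof -
  have "mat_trace (Cm r ^\<^sub>m 3) = mat_trace (Cm r ^\<^sub>m 2 * Cm r ^\<^sub>m 1)"
    using pow_mat_add[OF Cm_carrier, of r 2 1] by simp
  also have "\<dots> = (\<Sum>i<n. \<Sum>j<n. (P2 i j - (1 - r\<^sup>2) * e j) * C r j i)"
    using Cm_carrier[of r] by (subst trace_mult) (auto simp: Cm_sq Cm_index intro!: sum.cong)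
  also have "\<dots> = (\<Sum>i<n. (\<Sum>j<n. P2 i j * P j i) - (1 - r) * e i - (1 - r\<^sup>2) * e i + (1 - r\<^sup>2) * (1 - r) * e i)"
  proof (intro sum.cong refl)
    fix i assume "i \<in> {..<n}"
    then have i: "i < n" by simp
    have "(\<Sum>j<n. (P2 i j - (1 - r\<^sup>2) * e j) * C r j i) = (\<Sum>j<n. P2 i j * P j i - (1 - r) * e i * P2 i j
      - (1 - r\<^sup>2) * (e j * P j i) + (1 - r\<^sup>2) * (1 - r) * e i * e j)"
      by (intro sum.cong refl) (simp add: C_def algebra_simps)
    also have "\<dots> = (\<Sum>j<n. P2 i j * P j i) - (1 - r) * e i * (\<Sum>j<n. P2 i j)
      - (1 - r\<^sup>2) * (\<Sum>j<n. e j * P j i) + (1 - r\<^sup>2) * (1 - r) * e i * (\<Sum>j<n. e j)"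
      by (simp only: sum.distrib sum_subtractf sum_distrib_left[symmetric])
    finally show "(\<Sum>j<n. (P2 i j - (1 - r\<^sup>2) * e j) * C r j i) = (\<Sum>j<n. P2 i j * P j i) - (1 - r) * e i - (1 - r\<^sup>2) * e i + (1 - r\<^sup>2) * (1 - r) * e i"
      using P2_row[OF i] e_P[OF i] sum_e by simp
  qed
  also have "\<dots> = (\<Sum>i<n. \<Sum>j<n. P2 i j * P j i) - (1 - r) - (1 - r\<^sup>2) + (1 - r\<^sup>2) * (1 - r)"
    using sum_e by (simp add: sum.distrib sum_subtractf sum_distrib_left[symmetric])
  also have "(\<Sum>i<n. \<Sum>j<n. P2 i j * P j i) = tr3"
  proof -
    have "(\<Sum>i<n. \<Sum>k<n. P2 i k * P k i) = (\<Sum>i<n. \<Sum>k<n. \<Sum>j<n. P i j * P j k * P k i)"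
      by (simp add: P2_def sum_distrib_right)
    also have "\<dots> = (\<Sum>i<n. \<Sum>j<n. \<Sum>k<n. P i j * P j k * P k i)" by (intro sum.cong refl sum.swap)
    finally show ?thesis by (simp add: tr3_def)
  qed
  finally show ?thesis by (simp add: algebra_simps power2_eq_square power3_eq_cube)
qed

text \<open>Fourth powers enter only through the sum of (ev^2 - r^2)^2, which decides the case of
  equality.\<close>

lemma trace_Cm4: "mat_trace (Cm r ^\<^sub>m 4) = (\<Sum>i<n. \<Sum>j<n. (Cm r ^\<^sub>m 2) $$ (i,j) * (Cm r ^\<^sub>m 2) $$ (j,i))"
proof -
  have "mat_trace (Cm r ^\<^sub>m 4) = mat_trace (Cm r ^\<^sub>m 2 * Cm r ^\<^sub>m 2)"
    using pow_mat_add[OF Cm_carrier, of r 2 2] by simp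
  then show ?thesis using Cm_carrier[of r] by (subst (asm) trace_mult) auto
qed

text \<open>Scaling row i by \<open>D i\<close> turns the matrix into the Laplacian plus (1 - r) / W
  times the rank one matrix with entries D i * D j, so \<open>det_laplacian_rank_one\<close> applies
  with w = D. Without the shift by \<open>r\<close> the determinant would be zero.\<close>

lemma det_one_minus_Cm:
  "det (1\<^sub>m n - Cm r) * (\<Prod>i<n. D i) = (1 - r) * W * real (card (parent_maps n E))"
proof -
  let ?M = "mat n n (\<lambda>(i,j). of_bool (i = j) * real (card {k. k < n \<and> E i k}) - of_bool (E i j) + (1 - r) / W * D i * D j)"
  let ?D = "mat n n (\<lambda>(i,j). if i = j then D i else 0)"
  have "?D * (1\<^sub>m n - Cm r) = ?M"
  proof (rule eq_matI)
    fix i j assume "i < dim_row ?M" "j < dim_col ?M"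
    then have ij: "i < n" "j < n" by auto
    have "(?D * (1\<^sub>m n - Cm r)) $$ (i,j) = (\<Sum>k<n. if k = i then D i * (of_bool (i = j) - C r i j) else 0)"
    proof -
      have "(?D * (1\<^sub>m n - Cm r)) $$ (i,j) = (\<Sum>k<n. ?D $$ (i,k) * (1\<^sub>m n - Cm r) $$ (k,j))"
        using ij Cm_carrier[of r] by (simp add: scalar_prod_def atLeast0LessThan)
      also have "\<dots> = (\<Sum>k<n. if k = i then D i * (of_bool (i = j) - C r i j) else 0)"
        using ij Cm_carrier[of r] by (intro sum.cong refl) (auto simp: Cm_index)
      finally show ?thesis .
    qed
    also have "\<dots> = D i * (of_bool (i = j) - C r i j)" using ij by simp
    also have "\<dots> = of_bool (i = j) * (D i - dfc i) - A i j + (1 - r) / W * D i * D j"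
    proof -
      have "D i * (of_bool (i = j) - C r i j) = of_bool (i = j) * D i - D i * P i j + (1 - r) / W * D i * D j"
        by (simp add: C_def e_def algebra_simps)
      then show ?thesis unfolding D_P_eq by (simp add: of_bool_def)
    qed
    also have "D i - dfc i = deg i" by (simp add: D_def deg_eq)
    finally show "(?D * (1\<^sub>m n - Cm r)) $$ (i,j) = ?M $$ (i,j)" using ij by (simp add: deg_def A_def)
  qed (auto simp: Cm_def)
  moreover have "det (?D * (1\<^sub>m n - Cm r)) = det ?D * det (1\<^sub>m n - Cm r)"
    by (rule det_mult[OF _ minus_carrier_mat[OF Cm_carrier]]) (rule mat_carrier)
  ultimately have "det ?M = det ?D * det (1\<^sub>m n - Cm r)" by (simp only:)
  moreover have "det ?D = (\<Prod>i<n. D i)"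
  proof -
    have "det ?D = prod_list (diag_mat ?D)" by (rule det_upper_triangular[of _ n]) auto
    then show ?thesis by (simp add: diag_mat_def prod.list_conv_set_nth atLeast0LessThan)
  qed
  moreover have "det ?M = (1 - r) / W * W\<^sup>2 * real (card (parent_maps n E))"
    using det_laplacian_rank_one[OF n_pos, of E W D "(1 - r) / W"] W_pos E_sym
      det_rooted_laplacian[OF n_pos, of E] E_irrefl by (simp add: W_def[symmetric])
  ultimately show ?thesis using W_pos by (simp add: power2_eq_square mult.commute)
qed

text \<open>Entries of \<open>P\<close> may be negative, so a comparison of row sums would not do.
  The matrix with entries D i * C r i j is symmetric, and its Hermitian form at an eigenvector is N
  - F - G: \<open>N\<close> is the norm weighted by \<open>D\<close>, \<open>F\<close> the Dirichlet
  form of the graph, and \<open>G\<close> comes from the rank one correction. It also equals z N, so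
  z is real, and z <= 1 because F and G are nonnegative.\<close>

lemma Cm_eigenvalue:
  assumes r: "r \<le> 1" and ev: "eigenvector (map_mat complex_of_real (Cm r)) v z"
  shows "z \<in> \<real> \<and> Re z \<le> 1"
proof -
  have v: "v \<in> carrier_vec n" "v \<noteq> 0\<^sub>v n" "map_mat complex_of_real (Cm r) *\<^sub>v v = z \<cdot>\<^sub>v v"
    using ev Cm_carrier[of r] by (auto simp: eigenvector_def)
  define x where "x i = v $ i" for i
  have zx: "(\<Sum>j<n. of_real (C r i j) * x j) = z * x i" if i: "i < n" for i
  proof -
    have "(map_mat complex_of_real (Cm r) *\<^sub>v v) $ i = (\<Sum>j<n. of_real (C r i j) * x j)"
      using v(1) i Cm_carrier[of r] by (auto simp: scalar_prod_def atLeast0LessThan x_def Cm_def intro!: sum.cong)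
    then show ?thesis using v i by (simp add: x_def)
  qed
  define N where "N = (\<Sum>i<n. D i * (cmod (x i))\<^sup>2)"
  define F where "F = (\<Sum>i<n. \<Sum>j<n. A i j * (cmod (x i - x j))\<^sup>2) / 2"
  define G where "G = (1 - r) / W * (cmod (\<Sum>j<n. of_real (D j) * x j))\<^sup>2"
  have cm: "of_real ((cmod y)\<^sup>2) = cnj y * y" for y
    using complex_norm_square[of y] by (simp only: mult.commute)
  have "N > 0"
  proof -
    obtain i where i: "i < n" "x i \<noteq> 0" using v(1,2) by (auto simp: x_def vec_eq_iff)
    then have "0 < D i * (cmod (x i))\<^sup>2" using D_pos by simp
    also have "\<dots> \<le> N" unfolding N_def using i D_pos by (intro member_le_sum) (auto intro!: mult_nonneg_nonneg less_imp_le[OF D_pos])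
    finally show ?thesis .
  qed
  have quad: "(\<Sum>i<n. \<Sum>j<n. of_real (D i * C r i j) * (cnj (x i) * x j)) = z * of_real N"
  proof -
    have "(\<Sum>i<n. \<Sum>j<n. of_real (D i * C r i j) * (cnj (x i) * x j)) = (\<Sum>i<n. of_real (D i) * cnj (x i) * (\<Sum>j<n. of_real (C r i j) * x j))"
      by (simp add: sum_distrib_left mult_ac)
    also have "\<dots> = (\<Sum>i<n. of_real (D i) * cnj (x i) * (z * x i))" using zx by simp
    also have "\<dots> = z * of_real N" by (simp add: N_def sum_distrib_left cm mult_ac del: of_real_power)
    finally show ?thesis .
  qed
  have "(\<Sum>i<n. \<Sum>j<n. of_real (D i * C r i j) * (cnj (x i) * x j)) = of_real (N - F - G)"
  proof -
    have DC: "D i * C r i j = (if i = j then dfc i else 0) + A i j - (1 - r) / W * D i * D j" for i j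
    proof -
      have "D i * C r i j = D i * P i j - (1 - r) / W * D i * D j" by (simp add: C_def e_def algebra_simps)
      then show ?thesis unfolding D_P_eq .
    qed
    define Y where "Y = (\<Sum>i<n. \<Sum>j<n. of_real (A i j) * (cnj (x i) * x j))"
    have "(\<Sum>i<n. \<Sum>j<n. of_real (D i * C r i j) * (cnj (x i) * x j)) =
       (\<Sum>i<n. of_real (dfc i) * (cnj (x i) * x i)) + Y - (\<Sum>i<n. \<Sum>j<n. of_real ((1 - r) / W * D i * D j) * (cnj (x i) * x j))"
    proof -
      have "of_real (D i * C r i j) * (cnj (x i) * x j) = (if j = i then of_real (dfc i) * (cnj (x i) * x i) else 0)
         + of_real (A i j) * (cnj (x i) * x j) - of_real ((1 - r) / W * D i * D j) * (cnj (x i) * x j)" for i j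
        unfolding DC by (simp add: algebra_simps)
      then show ?thesis by (simp add: sum.distrib sum_subtractf Y_def)
    qed
    also have "(\<Sum>i<n. \<Sum>j<n. of_real ((1 - r) / W * D i * D j) * (cnj (x i) * x j)) = of_real G"
    proof -
      have "of_real G = of_real ((1 - r) / W) * (cnj (\<Sum>j<n. of_real (D j) * x j) * (\<Sum>j<n. of_real (D j) * x j))"
        unfolding G_def of_real_mult cm ..
      also have "\<dots> = (\<Sum>i<n. \<Sum>j<n. of_real ((1 - r) / W * D i * D j) * (cnj (x i) * x j))"
        by (simp add: sum_product sum_distrib_left mult_ac)
      finally show ?thesis ..
    qed
    also have "of_real F = (\<Sum>i<n. of_real (deg i) * (cnj (x i) * x i)) - Y"
    proof -
      have t1: "(\<Sum>i<n. \<Sum>j<n. of_real (A i j) * (cnj (x i) * x i)) = (\<Sum>i<n. of_real (deg i) * (cnj (x i) * x i))"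
      proof (intro sum.cong refl)
        fix i
        have "(\<Sum>j<n. of_real (A i j) * (cnj (x i) * x i)) = of_real (\<Sum>j<n. A i j) * (cnj (x i) * x i)"
          by (simp only: of_real_sum sum_distrib_right)
        then show "(\<Sum>j<n. of_real (A i j) * (cnj (x i) * x i)) = of_real (deg i) * (cnj (x i) * x i)"
          unfolding sum_A .
      qed
      have t2: "(\<Sum>i<n. \<Sum>j<n. of_real (A i j) * (cnj (x j) * x j)) = (\<Sum>i<n. of_real (deg i) * (cnj (x i) * x i))"
        unfolding t1[symmetric] by (subst sum.swap) (simp add: A_sym)
      have t3: "(\<Sum>i<n. \<Sum>j<n. of_real (A i j) * (cnj (x j) * x i)) = Y"
        unfolding Y_def by (subst sum.swap) (simp add: A_sym)
      have "complex_of_real (A i j * (cmod (x i - x j))\<^sup>2) = of_real (A i j) * (cnj (x i) * x i) + of_real (A i j) * (cnj (x j) * x j)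
         - of_real (A i j) * (cnj (x i) * x j) - of_real (A i j) * (cnj (x j) * x i)" for i j
        unfolding of_real_mult cm by (simp add: algebra_simps)
      then have "complex_of_real (\<Sum>i<n. \<Sum>j<n. A i j * (cmod (x i - x j))\<^sup>2) = 2 * ((\<Sum>i<n. of_real (deg i) * (cnj (x i) * x i)) - Y)"
        unfolding of_real_sum by (simp add: sum.distrib sum_subtractf t1 t2 t3 Y_def[symmetric])
      then show ?thesis unfolding F_def of_real_divide by simp
    qed
    then have "Y = (\<Sum>i<n. of_real (deg i) * (cnj (x i) * x i)) - of_real F" by simp
    moreover have "of_real N = (\<Sum>i<n. of_real (dfc i) * (cnj (x i) * x i)) + (\<Sum>i<n. of_real (deg i) * (cnj (x i) * x i))"
    proof -
      have "of_real N = (\<Sum>i<n. complex_of_real (dfc i + deg i) * (cnj (x i) * x i))"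
        unfolding N_def of_real_sum of_real_mult cm by (simp add: D_def deg_eq)
      then show ?thesis by (simp add: sum.distrib distrib_right)
    qed
    ultimately show ?thesis by simp
  qed
  then have "z * of_real N = of_real (N - F - G)" using quad by simp
  then have z: "z = of_real ((N - F - G) / N)" using \<open>N > 0\<close> by (simp add: field_simps)
  moreover have "0 \<le> F" unfolding F_def by (simp add: sum_nonneg A_nonneg)
  moreover have "0 \<le> G" unfolding G_def using r W_pos by simp
  ultimately have "Re z \<le> 1" using \<open>N > 0\<close> by simp
  moreover have "z \<in> \<real>" unfolding z by (rule Reals_of_real)
  ultimately show ?thesis by blast
qed

section \<open>From the traces to the number of spanning trees\<close>

definition tau :: real where "tau = real (card (parent_maps n E))"

context
  fixes r :: real
  assumes r: "0 < r" "r\<^sup>2 = (Q - 1) / Q\<^sup>2"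
begin

lemmas r1 = r_less_1[OF r]

lemma one_minus_r2: "1 - r\<^sup>2 = real n / Q\<^sup>2"
  unfolding r real_n using Q_ge by (simp add: field_simps)

text \<open>The left side depends only on three traces. It is regrouped around the reference
  spectrum: \<open>r\<close> itself, giving ln (1 - r), and n - 1 numbers with square r^2 whose odd
  powers cancel, each giving half of ln (1 - r^2).\<close>

lemma trace_hermite:
  fixes ev :: "nat \<Rightarrow> real"
  assumes "\<And>k. mat_trace (Cm r ^\<^sub>m k) = (\<Sum>i<n. ev i ^ k)"
  shows "(\<Sum>i<n. hermite_ln r (ev i)) = (real n - 1) / 2 * ln (real n / Q\<^sup>2) + ln (1 - r) + slack r - (\<Sum>i<n. ln (D i / Q))"
proof -
  define c where "c = Q\<^sup>2 / (2 * real n)"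
  have c: "x / (2 * (1 - r\<^sup>2)) = c * x" for x unfolding one_minus_r2 c_def by simp
  have s1: "(\<Sum>i<n. ev i) = tr1 - 1 + r" using assms[of 1] trace_Cm1[of r] by simp
  have s2: "(\<Sum>i<n. (ev i)\<^sup>2) = tr2 - 1 + r\<^sup>2" using assms[of 2] trace_Cm2[of r] by simp
  have s3: "(\<Sum>i<n. ev i ^ 3) = tr3 - 1 + r ^ 3" using assms[of 3] trace_Cm3[of r] by simp
  have "(\<Sum>i<n. hermite_ln r (ev i)) = real n * (ln (1 - r\<^sup>2) / 2 + c * r\<^sup>2) - linear_coeff r * (\<Sum>i<n. ev i)
     - c * (\<Sum>i<n. (ev i)\<^sup>2) - cubic_coeff r * (\<Sum>i<n. ev i ^ 3)"
    unfolding hermite_ln_def c by (simp add: sum_subtractf sum_distrib_left)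
  also have "\<dots> = real n * (ln (1 - r\<^sup>2) / 2 + c * r\<^sup>2) - linear_coeff r * (tr1 - 1 + r) - c * (tr2 - 1 + r\<^sup>2) - cubic_coeff r * (tr3 - 1 + r ^ 3)"
    unfolding s1 s2 s3 ..
  also have "\<dots> = (real n - 1) / 2 * ln (1 - r\<^sup>2) + hermite_ln r r - linear_coeff r * (tr1 - 1) - c * (tr2 - 1 - (real n - 1) * r\<^sup>2) - cubic_coeff r * (tr3 - 1)"
    unfolding hermite_ln_def c by (simp add: algebra_simps diff_divide_distrib)
  also have "1 + (real n - 1) * r\<^sup>2 = real n / Q"
    unfolding r real_n using Q_ge by (simp add: field_simps power2_eq_square)
  then have "tr2 - 1 - (real n - 1) * r\<^sup>2 = tr2 - real n / Q" by simp
  also have "hermite_ln r r = ln (1 - r)" by (rule hermite_ln_node[OF r(1) r1])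
  finally show ?thesis unfolding slack_def one_minus_r2 c_def by (simp add: mult.commute)
qed

text \<open>All powers of Q cancel: -(n - 1) ln Q from the cubic, n ln Q from the product of the
  \<open>D i\<close>, and -ln Q from writing W as n Q times W / (n Q). The factor n split off from W
  lowers (n - 1) / 2 to (n - 3) / 2.\<close>

lemma ln_tau:
  assumes det: "det (1\<^sub>m n - Cm r) = (\<Prod>i<n. 1 - ev i)" and lt: "\<And>i. i < n \<Longrightarrow> ev i < 1"
    and tr: "\<And>k. mat_trace (Cm r ^\<^sub>m k) = (\<Sum>i<n. ev i ^ k)"
  shows "0 < tau" and "ln tau = (real n - 3) / 2 * ln (real n) + slack r
     - ((\<Sum>i<n. hermite_ln r (ev i) - ln (1 - ev i)) + ln (W / (real n * Q)))"
proof -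
  have n0: "0 < real n" using n_pos by simp
  have PD: "0 < (\<Prod>i<n. D i)" using D_pos by (intro prod_pos) auto
  have eq: "(\<Prod>i<n. 1 - ev i) * (\<Prod>i<n. D i) = (1 - r) * W * tau"
    using det_one_minus_Cm[of r] unfolding det tau_def .
  have "0 < (\<Prod>i<n. 1 - ev i)" using lt by (intro prod_pos) auto
  then have "0 < (1 - r) * W * tau" unfolding eq[symmetric] using PD by simp
  then show tau: "0 < tau"
  proof -
    have "tau \<noteq> 0" using \<open>0 < (1 - r) * W * tau\<close> by (metis less_irrefl mult_zero_right)
    then show ?thesis by (simp add: tau_def)
  qed
  have "(\<Sum>i<n. ln (1 - ev i)) + (\<Sum>i<n. ln (D i)) = ln ((\<Prod>i<n. 1 - ev i) * (\<Prod>i<n. D i))"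
  proof -
    have "1 - ev i \<noteq> 0" if "i \<in> {..<n}" for i using lt[of i] that by simp
    then have "ln (\<Prod>i<n. 1 - ev i) = (\<Sum>i<n. ln (1 - ev i))" by (intro ln_prod) auto
    moreover have "ln (\<Prod>i<n. D i) = (\<Sum>i<n. ln (D i))" using D_pos by (intro ln_prod) (auto simp: less_le)
    ultimately show ?thesis using \<open>0 < (\<Prod>i<n. 1 - ev i)\<close> PD by (simp add: ln_mult_pos)
  qed
  also have "\<dots> = ln (1 - r) + ln W + ln tau"
    unfolding eq using tau W_pos r1 by (simp add: ln_mult_pos)
  finally have 1: "ln tau = (\<Sum>i<n. ln (1 - ev i)) + (\<Sum>i<n. ln (D i)) - ln (1 - r) - ln W" by simp
  have 2: "(\<Sum>i<n. ln (D i / Q)) = (\<Sum>i<n. ln (D i)) - real n * ln Q"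
    using D_pos[THEN less_imp_neq, THEN not_sym] Q_ge by (simp add: ln_div sum_subtractf)
  have 3: "ln (real n / Q\<^sup>2) = ln (real n) - 2 * ln Q" using n0 Q_ge by (simp add: ln_div ln_realpow)
  have 4: "ln (W / (real n * Q)) = ln W - ln (real n) - ln Q" using n0 Q_ge W_pos by (simp add: ln_div ln_mult_pos)
  show "ln tau = (real n - 3) / 2 * ln (real n) + slack r
     - ((\<Sum>i<n. hermite_ln r (ev i) - ln (1 - ev i)) + ln (W / (real n * Q)))"
    using trace_hermite[OF tr] unfolding sum_subtractf 1 2 3 4 by (simp add: algebra_simps diff_divide_distrib)
qed

text \<open>Both sides are the trace of the square of C^2 - r^2 I. This translates a condition on
  eigenvalues into one on matrix entries.\<close>

lemma eigenvalue_condition: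
  assumes tr: "\<And>k. mat_trace (Cm r ^\<^sub>m k) = (\<Sum>i<n. ev i ^ k)"
  shows "(\<Sum>i<n. ((ev i)\<^sup>2 - r\<^sup>2)\<^sup>2) = (\<Sum>i<n. \<Sum>j<n. (P2 i j - (1 - r\<^sup>2) * e j - of_bool (i = j) * r\<^sup>2) * (P2 j i - (1 - r\<^sup>2) * e i - of_bool (i = j) * r\<^sup>2))"
proof -
  define K where "K i j = P2 i j - (1 - r\<^sup>2) * e j" for i j
  have K: "(Cm r ^\<^sub>m 2) $$ (i,j) = K i j" if "i < n" "j < n" for i j using Cm_sq that by (simp add: K_def)
  have "((ev i)\<^sup>2 - r\<^sup>2)\<^sup>2 = ev i ^ 4 - 2 * r\<^sup>2 * (ev i)\<^sup>2 + r ^ 4" for i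
    by (simp add: power2_diff algebra_simps flip: power_mult)
  then have "(\<Sum>i<n. ((ev i)\<^sup>2 - r\<^sup>2)\<^sup>2) = mat_trace (Cm r ^\<^sub>m 4) - 2 * r\<^sup>2 * mat_trace (Cm r ^\<^sub>m 2) + real n * r ^ 4"
    unfolding tr by (simp add: sum.distrib sum_subtractf sum_distrib_left)
  also have "mat_trace (Cm r ^\<^sub>m 2) = (\<Sum>i<n. K i i)"
    using K Cm_carrier[of r] by (simp add: mat_trace_def)
  also have "mat_trace (Cm r ^\<^sub>m 4) = (\<Sum>i<n. \<Sum>j<n. K i j * K j i)" unfolding trace_Cm4 using K by simp
  also have "(\<Sum>i<n. \<Sum>j<n. K i j * K j i) - 2 * r\<^sup>2 * (\<Sum>i<n. K i i) + real n * r ^ 4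
    = (\<Sum>i<n. \<Sum>j<n. K i j * K j i - (if j = i then 2 * r\<^sup>2 * K i i else 0) + (if j = i then r ^ 4 else 0))"
    by (simp add: sum.distrib sum_subtractf sum_distrib_left)
  also have "\<dots> = (\<Sum>i<n. \<Sum>j<n. (K i j - of_bool (i = j) * r\<^sup>2) * (K j i - of_bool (i = j) * r\<^sup>2))"
    by (intro sum.cong refl) (auto simp: algebra_simps power2_eq_square power4_eq_xxxx)
  finally show ?thesis unfolding K_def .
qed

end

end

section \<open>The case of equality\<close>

context sparse_c4_free
begin

text \<open>A loop at each vertex of degree q restores the row sum q + 1; such vertices will be the
  absolute points. For degrees q and q + 1 this relation is the matrix \<open>P\<close> multiplied
  by Q.\<close>

definition incident :: "nat \<Rightarrow> nat \<Rightarrow> bool" where "incident i j \<longleftrightarrow> (if i = j then deg i = q else E i j)"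

definition joins :: "nat \<Rightarrow> nat \<Rightarrow> nat set" where "joins i j = {l. l < n \<and> incident i l \<and> incident l j}"

definition regular_degrees :: bool where "regular_degrees \<longleftrightarrow> (\<forall>i<n. deg i = q \<or> deg i = q + 1)"

definition orthogonal :: bool where
  "orthogonal \<longleftrightarrow> regular_degrees \<and> card {i. i < n \<and> deg i = q} = q + 1 \<and>
     (\<forall>i<n. \<forall>j<n. i \<noteq> j \<longrightarrow> card (joins i j) = 1)"

lemma incident_sym: "incident i j \<longleftrightarrow> incident j i" using E_sym by (auto simp: incident_def)

lemma regular_degrees_iff: "regular_degrees \<longleftrightarrow> (\<forall>i<n. excess i = 0 \<and> (defect i = 0 \<or> defect i = 1))"
proof -
  have "(deg i = q \<or> deg i = q + 1) \<longleftrightarrow> excess i = 0 \<and> (defect i = 0 \<or> defect i = 1)" for i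
    by (auto simp: excess_def defect_def)
  then show ?thesis by (simp add: regular_degrees_def)
qed

lemma defect_regular: "regular_degrees \<Longrightarrow> i < n \<Longrightarrow> dfc i = of_bool (deg i = q)"
  by (auto simp: regular_degrees_def defect_def)

context
  assumes reg: regular_degrees
begin

lemma D_regular: "i < n \<Longrightarrow> D i = Q" using reg by (simp add: regular_degrees_iff D_def)

lemma W_regular: "W = real n * Q" by (simp add: W_def D_regular)

lemma e_regular: "i < n \<Longrightarrow> e i = 1 / real n" using Q_ge by (simp add: e_def D_regular W_regular)

lemma P_regular: "i < n \<Longrightarrow> P i j = of_bool (incident i j) / Q"
proof -
  assume i: "i < n"
  have "of_int (of_bool (i = j) * defect i) + A i j = of_bool (incident i j)"
    using defect_regular[OF reg i] E_irrefl by (cases "i = j") (auto simp: incident_def A_def)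
  then show ?thesis by (simp only: P_def D_regular[OF i])
qed

lemma Sp_regular: "Sp = card {i. i < n \<and> deg i = q}"
proof -
  have "Sp = (\<Sum>i<n. of_bool (deg i = q))" using defect_regular[OF reg] by (simp add: Sp_def)
  then show ?thesis by (simp add: of_bool_def sum.If_cases Int_def)
qed

lemma Sk_regular: "Sk = 0" using reg by (simp add: regular_degrees_iff Sk_def)

lemma P2_regular: "i < n \<Longrightarrow> P2 i j = card (joins i j) / Q\<^sup>2"
proof -
  assume i: "i < n"
  have "P2 i j = (\<Sum>l<n. of_bool (incident i l \<and> incident l j) / Q\<^sup>2)"
    unfolding P2_def using i by (intro sum.cong refl) (simp add: P_regular power2_eq_square)
  then show ?thesis by (simp add: sum_divide_distrib[symmetric] of_bool_def sum.If_cases Int_def joins_def)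
qed

lemma card_joins_diag: "i < n \<Longrightarrow> real (card (joins i i)) = Q"
proof -
  assume i: "i < n"
  have "joins i i = {l. l < n \<and> incident i l}" using incident_sym by (auto simp: joins_def)
  moreover have "(\<Sum>l<n. of_bool (incident i l) / Q) = real (card {l. l < n \<and> incident i l}) / Q"
    by (simp add: sum_divide_distrib[symmetric] of_bool_def sum.If_cases Int_def)
  moreover have "(\<Sum>l<n. of_bool (incident i l) / Q) = 1" using P_row[OF i] i by (simp add: P_regular)
  ultimately show ?thesis using Q_ge by simp
qed

lemma joins_sym: "joins i j = joins j i" using incident_sym by (auto simp: joins_def)

text \<open>For these degrees C^2 - r^2 I is symmetric with zero diagonal, since 1 / Q - 1 / Q^2 =
  r^2, and has the entries (card (joins i j) - 1) / Q^2 elsewhere. The trace of its square is a sum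
  of squares.\<close>

lemma eigenvalues_regular:
  assumes r: "0 < r" "r\<^sup>2 = (Q - 1) / Q\<^sup>2" and tr: "\<And>k. mat_trace (Cm r ^\<^sub>m k) = (\<Sum>i<n. ev i ^ k)"
  shows "(\<forall>i<n. (ev i)\<^sup>2 = r\<^sup>2) \<longleftrightarrow> (\<forall>i<n. \<forall>j<n. i \<noteq> j \<longrightarrow> card (joins i j) = 1)"
proof -
  define X where "X i j = (if i = j then 0 else (real (card (joins i j)) - 1) / Q\<^sup>2)" for i j
  have n0: "0 < real n" using n_pos by simp
  have X: "P2 i j - (1 - r\<^sup>2) * e j - of_bool (i = j) * r\<^sup>2 = X i j" if ij: "i < n" "j < n" for i j
  proof -
    have "(1 - r\<^sup>2) * e j = 1 / Q\<^sup>2" unfolding one_minus_r2[OF r] e_regular[OF ij(2)] using n0 by simp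
    then show ?thesis
      using P2_regular[OF ij(1), of j] card_joins_diag[OF ij(1)] r(2)
      by (auto simp: X_def diff_divide_distrib)
  qed
  have Xsym: "X i j = X j i" for i j by (simp add: X_def joins_sym)
  have "(\<Sum>i<n. ((ev i)\<^sup>2 - r\<^sup>2)\<^sup>2) = (\<Sum>i<n. \<Sum>j<n. (X i j)\<^sup>2)"
    unfolding eigenvalue_condition[OF r tr]
  proof (intro sum.cong refl)
    fix i j assume "i \<in> {..<n}" "j \<in> {..<n}"
    then show "(P2 i j - (1 - r\<^sup>2) * e j - of_bool (i = j) * r\<^sup>2) * (P2 j i - (1 - r\<^sup>2) * e i - of_bool (i = j) * r\<^sup>2) = (X i j)\<^sup>2"
      using X[of i j] X[of j i] Xsym[of i j] by (simp add: power2_eq_square eq_commute[of i j])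
  qed
  moreover have "(\<Sum>i<n. ((ev i)\<^sup>2 - r\<^sup>2)\<^sup>2) = 0 \<longleftrightarrow> (\<forall>i<n. (ev i)\<^sup>2 = r\<^sup>2)"
    by (subst sum_nonneg_eq_0_iff) auto
  moreover have "(\<Sum>i<n. \<Sum>j<n. (X i j)\<^sup>2) = 0 \<longleftrightarrow> (\<forall>i<n. \<forall>j<n. X i j = 0)"
    by (subst sum_nonneg_eq_0_iff) (auto simp: sum_nonneg sum_nonneg_eq_0_iff)
  moreover have "X i j = 0 \<longleftrightarrow> (i \<noteq> j \<longrightarrow> card (joins i j) = 1)" for i j using Q_ge by (simp add: X_def)
  ultimately show ?thesis by simp
qed

end

text \<open>The number of vertices of degree q fixes the first trace. Because ev^2 = r^2, the second
  trace is immediate and cubes reduce to r^2 * ev, so the third follows from the first.\<close>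

lemma slack_orthogonal:
  assumes r: "0 < r" "r\<^sup>2 = (Q - 1) / Q\<^sup>2" and tr: "\<And>k. mat_trace (Cm r ^\<^sub>m k) = (\<Sum>i<n. ev i ^ k)"
    and orth: orthogonal and ev: "\<And>i. i < n \<Longrightarrow> (ev i)\<^sup>2 = r\<^sup>2"
  shows "slack r = 0"
proof -
  have reg: regular_degrees and c: "card {i. i < n \<and> deg i = q} = q + 1" using orth by (auto simp: orthogonal_def)
  have "Sp = Q" using Sp_regular[OF reg] c by (simp add: Q_def)
  then have tr1: "tr1 = 1" using Q_ge by (simp add: tr1_eq)
  have "tr2 - 1 + r\<^sup>2 = (\<Sum>i<n. (ev i)\<^sup>2)" using tr[of 2] trace_Cm2[of r] by simp
  also have "\<dots> = real n * r\<^sup>2" using ev by simp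
  finally have "tr2 = 1 + (real n - 1) * r\<^sup>2" by (simp add: algebra_simps)
  also have "\<dots> = real n / Q" unfolding r real_n using Q_ge by (simp add: field_simps power2_eq_square)
  finally have tr2: "tr2 = real n / Q" .
  have "tr3 - 1 + r ^ 3 = (\<Sum>i<n. ev i ^ 3)" using tr[of 3] trace_Cm3[of r] by simp
  also have "\<dots> = (\<Sum>i<n. r\<^sup>2 * ev i)" using ev by (intro sum.cong refl) (simp add: power3_eq_cube power2_eq_square)
  also have "\<dots> = r\<^sup>2 * (tr1 - 1 + r)" using tr[of 1] trace_Cm1[of r] by (simp add: sum_distrib_left[symmetric])
  finally have tr3: "tr3 = 1" using tr1 by (simp add: power3_eq_cube power2_eq_square)
  have "(\<Sum>i<n. ln (D i / Q)) = 0" using D_regular[OF reg] Q_ge by simp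
  then show ?thesis by (simp add: slack_def tr1 tr2 tr3)
qed

theorem tau_bound:
  shows "tau \<le> real n powr ((real n - 3) / 2)"
    and "tau = real n powr ((real n - 3) / 2) \<longleftrightarrow> orthogonal"
proof -
  define r where "r = sqrt (Q - 1) / Q"
  have r: "0 < r" "r\<^sup>2 = (Q - 1) / Q\<^sup>2" using Q_ge by (auto simp: r_def power_divide)
  have r1: "r < 1" by (rule r_less_1[OF r])
  have n0: "0 < real n" using n_pos by simp
  obtain ev where le: "\<And>i. i < n \<Longrightarrow> ev i \<le> 1" and det: "det (1\<^sub>m n - Cm r) = (\<Prod>i<n. 1 - ev i)"
    and tr: "\<And>k. mat_trace (Cm r ^\<^sub>m k) = (\<Sum>i<n. ev i ^ k)"
    using real_spectrum[OF Cm_carrier[of r]] Cm_eigenvalue[of r] r1 by (metis less_imp_le)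
  let ?B = "real n powr ((real n - 3) / 2)"
  have B: "?B = exp ((real n - 3) / 2 * ln (real n))" using n0 by (simp add: powr_def)
  have "tau \<le> ?B \<and> (tau = ?B \<longleftrightarrow> orthogonal)"
  \<comment> \<open>An eigenvalue 1 that survives the shift makes \<open>tau\<close> zero. It is
    treated separately because ln (1 - ev i) has no meaning there.\<close>
  proof (cases "\<exists>i<n. ev i = 1")
    case True
    then have "(\<Prod>i<n. 1 - ev i) = 0" by auto
    then have "det (1\<^sub>m n - Cm r) = 0" by (simp only: det)
    then have "(1 - r) * W * tau = 0" using det_one_minus_Cm[of r] by (simp only: tau_def mult_zero_left)
    then have "tau = 0" using r1 W_pos by simp
    moreover have "\<not> orthogonal"
    proof
      assume o: orthogonal
      then have "\<forall>i<n. (ev i)\<^sup>2 = r\<^sup>2" using eigenvalues_regular[OF _ r tr] by (auto simp: orthogonal_def)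
      then have "r\<^sup>2 = 1" using True by auto
      then show False using r2_le[OF r] by linarith
    qed
    moreover have "0 < ?B" using n0 by simp
    ultimately show ?thesis by simp
  next
    case False
    then have lt: "ev i < 1" if "i < n" for i using le that by (metis less_le)
    note lnt = ln_tau[OF r det lt tr]
    let ?g = "\<lambda>i. hermite_ln r (ev i) - ln (1 - ev i)"
    have g: "0 \<le> ?g i" "?g i = 0 \<longleftrightarrow> (ev i)\<^sup>2 = r\<^sup>2" if "i < n" for i
      using ln_le_hermite[OF r(1) r2_le[OF r] lt[OF that]] by (auto simp: power2_eq_iff)
    have G: "0 \<le> (\<Sum>i<n. ?g i)" using g by (intro sum_nonneg) auto
    have G0: "(\<Sum>i<n. ?g i) = 0 \<longleftrightarrow> (\<forall>i<n. (ev i)\<^sup>2 = r\<^sup>2)"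
      using g by (subst sum_nonneg_eq_0_iff) auto
    have nQ: "0 < real n * Q" using n0 Q_ge by simp
    have Wl: "0 \<le> ln (W / (real n * Q))" using W_ge nQ by (intro ln_ge_zero) simp
    have tau: "tau = exp (ln tau)" using lnt(1) by simp
    have le': "ln tau \<le> (real n - 3) / 2 * ln (real n)" using lnt(2) slack_le[OF r] G Wl by linarith
    have "tau = ?B \<longleftrightarrow> ln tau = (real n - 3) / 2 * ln (real n)"
      unfolding B using tau by (metis exp_inj_iff)
    \<comment> \<open>The difference from the bound is a sum of three nonpositive quantities, so it
      vanishes only if each of them does.\<close>
    also have "\<dots> \<longleftrightarrow> slack r = 0 \<and> (\<Sum>i<n. ?g i) = 0 \<and> ln (W / (real n * Q)) = 0"
      using lnt(2) slack_le[OF r] G Wl by linarith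
    also have "\<dots> \<longleftrightarrow> orthogonal"
    proof
      assume *: "slack r = 0 \<and> (\<Sum>i<n. ?g i) = 0 \<and> ln (W / (real n * Q)) = 0"
      then have reg: regular_degrees and "Sp - Sk = Q" using slack_zero[OF r] regular_degrees_iff by auto
      then have "card {i. i < n \<and> deg i = q} = q + 1"
        using Sp_regular[OF reg] Sk_regular[OF reg] by (simp add: Q_def)
      moreover have "\<forall>i<n. (ev i)\<^sup>2 = r\<^sup>2" using * G0 by blast
      ultimately show orthogonal using reg eigenvalues_regular[OF reg r tr] by (simp add: orthogonal_def)
    next
      assume o: orthogonal
      then have reg: regular_degrees by (simp add: orthogonal_def)
      then have ev: "\<forall>i<n. (ev i)\<^sup>2 = r\<^sup>2" using eigenvalues_regular[OF reg r tr] o by (simp add: orthogonal_def)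
      then show "slack r = 0 \<and> (\<Sum>i<n. ?g i) = 0 \<and> ln (W / (real n * Q)) = 0"
        using slack_orthogonal[OF r tr o] G0 W_regular[OF reg] nQ by simp
    qed
    finally show ?thesis using le' tau unfolding B by (metis exp_le_cancel_iff)
  qed
  then show "tau \<le> ?B" and "tau = ?B \<longleftrightarrow> orthogonal" by auto
qed

end

section \<open>Orthogonal polarity graphs\<close>

lemma four_cycle_iso:
  assumes d: "distinct [x, a, y, b]"
  shows "digraph_iso (\<lparr>pverts = {x, a, y, b},
     parcs = {(x,a),(a,x),(a,y),(y,a),(y,b),(b,y),(b,x),(x,b)}\<rparr>) four_cycle"
proof -
  let ?H = "\<lparr>pverts = {x, a, y, b}, parcs = {(x,a),(a,x),(a,y),(y,a),(y,b),(b,y),(b,x),(x,b)}\<rparr>"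
  define g :: "'a \<Rightarrow> nat" where "g v = (if v = x then 0 else if v = a then 1 else if v = y then 2 else 3)" for v
  have g: "g x = 0" "g a = 1" "g y = 2" "g b = 3" using d by (auto simp: g_def)
  let ?h = "\<lparr>iso_verts = g, iso_arcs = map_prod g g, iso_head = snd, iso_tail = fst\<rparr>"
  have gi: "inj_on g {x, a, y, b}" using g by (auto simp: inj_on_def)
  moreover have "inj_on (map_prod g g) {(x,a),(a,x),(a,y),(y,a),(y,b),(b,y),(b,x),(x,b)}"
    by (rule inj_on_subset[OF map_prod_inj_on[OF gi gi]]) auto
  moreover have "wf_digraph (with_proj ?H)" by (auto simp: wf_digraph_def)
  ultimately have "pre_digraph.digraph_isomorphism ?H ?h"
    unfolding pre_digraph.digraph_isomorphism_def by simp
  moreover have "with_proj four_cycle = app_iso ?h ?H"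
    using g by (auto simp: app_iso_def with_proj_def four_cycle_def)
  ultimately show ?thesis unfolding digraph_iso_def by blast
qed

lemma C4_free_common_neighbours:
  assumes G: "pair_graph G" and free: "C4_free G" and ne: "x \<noteq> y" "a \<noteq> b"
    and arcs: "(x,a) \<in> parcs G" "(a,y) \<in> parcs G" "(x,b) \<in> parcs G" "(b,y) \<in> parcs G"
  shows False
proof -
  interpret pair_graph G by (rule G)
  let ?H = "\<lparr>pverts = {x, a, y, b}, parcs = {(x,a),(a,x),(a,y),(y,a),(y,b),(b,y),(b,x),(x,b)}\<rparr>"
  have sym: "(v, u) \<in> parcs G" if "(u, v) \<in> parcs G" for u v
    using that sym_arcs by (auto simp: symmetric_def dest: symD)
  have "distinct [x, a, y, b]" using ne arcs[THEN no_loops'] by auto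
  then have "digraph_iso ?H four_cycle" by (rule four_cycle_iso)
  moreover have "subgraph ?H G"
    unfolding subgraph_def using arcs arcs[THEN sym] wf_digraph arcs[THEN wellformed'(1)] arcs[THEN wellformed'(2)]
    by (auto simp: wf_digraph_def[of "with_proj ?H"] compatible_def)
  ultimately show False using free unfolding C4_free_def by blast
qed

lemma card_parcs_le:
  assumes "pair_graph G" shows "card (parcs G) \<le> 2 * card (edges G)"
proof -
  interpret pair_graph G by (rule assms)
  have fin: "finite (edges G)"
  proof -
    have "edges G \<subseteq> (\<lambda>a. {fst a, snd a}) ` parcs G" unfolding edges_def by force
    then show ?thesis by (rule finite_subset) (rule finite_imageI[OF pair_finite_arcs])
  qed
  have c: "card {(u, v). {u, v} = s \<and> (u, v) \<in> parcs G} \<le> 2" if s: "s \<in> edges G" for s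
  proof -
    obtain u v where uv: "s = {u, v}" using s unfolding edges_def by blast
    have "{(u, v). {u, v} = s \<and> (u, v) \<in> parcs G} \<subseteq> {(u, v), (v, u)}"
      unfolding uv doubleton_eq_iff by blast
    then have "card {(u, v). {u, v} = s \<and> (u, v) \<in> parcs G} \<le> card {(u, v), (v, u)}" by (rule card_mono[rotated]) simp
    also have "card {a, b} \<le> 2" for a b :: "'a \<times> 'a" by (cases "a = b") simp_all
    finally show ?thesis .
  qed
  have "parcs G \<subseteq> (\<Union>s\<in>edges G. {(u, v). {u, v} = s \<and> (u, v) \<in> parcs G})"
  proof
    fix a assume a: "a \<in> parcs G"
    obtain u v where uv: "a = (u, v)" by (cases a)
    then have "{u, v} \<in> edges G" using a unfolding edges_def by blast
    then show "a \<in> (\<Union>s\<in>edges G. {(u, v). {u, v} = s \<and> (u, v) \<in> parcs G})"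
      using a unfolding uv by (intro UN_I[of "{u, v}"]) simp_all
  qed
  moreover have "finite (\<Union>s\<in>edges G. {(u, v). {u, v} = s \<and> (u, v) \<in> parcs G})"
    by (rule finite_subset[OF _ pair_finite_arcs]) blast
  ultimately have "card (parcs G) \<le> card (\<Union>s\<in>edges G. {(u, v). {u, v} = s \<and> (u, v) \<in> parcs G})" by (intro card_mono)
  also have "\<dots> \<le> (\<Sum>s\<in>edges G. card {(u, v). {u, v} = s \<and> (u, v) \<in> parcs G})" by (rule card_UN_le[OF fin])
  also have "\<dots> \<le> (\<Sum>s\<in>edges G. 2)" by (rule sum_mono) (rule c)
  finally show ?thesis by simp
qed

text \<open>The relation \<open>incident\<close> stated on the graph itself, so that it can be
  compared with the incidence of a plane.\<close>

definition loop_adj :: "nat \<Rightarrow> 'a pair_pre_digraph \<Rightarrow> 'a \<Rightarrow> 'a \<Rightarrow> bool" where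
  "loop_adj q G x y \<longleftrightarrow> (if x = y then card {z. (x, z) \<in> parcs G} = q else (x, y) \<in> parcs G)"

text \<open>
  The condition that the adjacency matrix, completed by a diagonal entry 1 at every vertex of
  degree q, is the incidence matrix of a symmetric design with \<open>\<lambda> = 1\<close>.
\<close>

definition orthogonal_pattern :: "nat \<Rightarrow> 'a pair_pre_digraph \<Rightarrow> bool" where
  "orthogonal_pattern q G \<longleftrightarrow>
     (\<forall>x\<in>pverts G. \<forall>y\<in>pverts G. x \<noteq> y \<longrightarrow> (\<exists>!z. z \<in> pverts G \<and> loop_adj q G x z \<and> loop_adj q G z y)) \<and>
     (\<forall>x\<in>pverts G. card {z. (x, z) \<in> parcs G} \<in> {q, q + 1}) \<and>
     card {x \<in> pverts G. card {z. (x, z) \<in> parcs G} = q} = q + 1"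

text \<open>The vertices serve both as points and as lines, with \<open>loop_adj\<close> as
  incidence. That relation is symmetric, so exchanging the two copies is a polarity, and its
  absolute points are the vertices with a loop.\<close>

lemma orthogonal_patternI_plane:
  fixes G :: "'a pair_pre_digraph"
  assumes G: "pair_graph G" and q: "2 \<le> q" and n: "1 < card (pverts G)" and pat: "orthogonal_pattern q G"
  shows "orthogonal_polarity_graph q G"
proof -
  interpret pair_graph G by (rule G)
  let ?V = "pverts G" and ?I = "loop_adj q G"
  let ?\<phi> = "\<lambda>z. case z of Inl x \<Rightarrow> Inr x | Inr x \<Rightarrow> Inl x"
  have arc_sym: "(x, y) \<in> parcs G \<longleftrightarrow> (y, x) \<in> parcs G" for x y
    using sym_arcs by (auto simp: symmetric_def dest: symD)
  have sym: "?I x y \<longleftrightarrow> ?I y x" for x y using arc_sym by (auto simp: loop_adj_def)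
  have uniq: "\<exists>!z. z \<in> ?V \<and> ?I x z \<and> ?I z y" if "x \<in> ?V" "y \<in> ?V" "x \<noteq> y" for x y
    using pat that unfolding orthogonal_pattern_def by blast
  have deg: "card {z. (x, z) \<in> parcs G} = q \<or> card {z. (x, z) \<in> parcs G} = q + 1" if "x \<in> ?V" for x
    using pat that unfolding orthogonal_pattern_def by auto
  have fin: "finite {z. (x, z) \<in> parcs G}" for x
    by (rule finite_subset[OF _ pair_finite_verts]) (auto dest: in_arcsD2)
  have line: "card {x \<in> ?V. ?I x l} = q + 1" if l: "l \<in> ?V" for l
  proof -
    have "{x \<in> ?V. ?I x l} = (if card {z. (l, z) \<in> parcs G} = q then {l} else {}) \<union> {z. (l, z) \<in> parcs G}"
      using l arc_sym no_loops' by (auto simp: loop_adj_def dest: in_arcsD2)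
    moreover have "l \<notin> {z. (l, z) \<in> parcs G}" using no_loops' by auto
    ultimately show ?thesis using deg[OF l] fin[of l] by auto
  qed
  \<comment> \<open>Two lines l and m meet in z, and each carries two further points because q + 1
    >= 3. Any three of these four points include both points of one line and a point of the other,
    so a common line would give a second meeting point of l and m.\<close>
  have quad: "\<exists>Q\<subseteq>?V. card Q = 4 \<and> \<not> (\<exists>T\<subseteq>Q. card T = 3 \<and> (\<exists>l\<in>?V. \<forall>x\<in>T. ?I x l))"
  proof -
    obtain l m where lm: "l \<in> ?V" "m \<in> ?V" "l \<noteq> m"
    proof -
      have "?V \<noteq> {}" using n by auto
      then obtain l where l: "l \<in> ?V" by blast
      have "?V \<noteq> {l}" using n by auto
      then obtain m where "m \<in> ?V" "m \<noteq> l" using l by blast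
      then show thesis using that l by blast
    qed
    obtain z where z: "z \<in> ?V" "?I l z" "?I z m" using uniq[OF lm] by blast
    have two: "\<exists>a b. a \<noteq> b \<and> a \<noteq> z \<and> b \<noteq> z \<and> a \<in> ?V \<and> b \<in> ?V \<and> ?I a l' \<and> ?I b l'" if "l' \<in> ?V" for l'
    proof -
      have c2: "2 \<le> card ({x \<in> ?V. ?I x l'} - {z})"
        using line[OF that] q by (auto simp: card_Diff_singleton_if)
      obtain S where "S \<subseteq> {x \<in> ?V. ?I x l'} - {z}" "card S = 2"
        by (rule obtain_subset_with_card_n[OF c2])
      then obtain a b where "a \<noteq> b" "{a, b} \<subseteq> {x \<in> ?V. ?I x l'} - {z}" by (auto simp: card_2_iff)
      then show ?thesis by auto
    qed
    obtain a b where ab: "a \<noteq> b" "a \<noteq> z" "b \<noteq> z" "a \<in> ?V" "b \<in> ?V" "?I a l" "?I b l" using two[OF lm(1)] by blast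
    obtain c d where cd: "c \<noteq> d" "c \<noteq> z" "d \<noteq> z" "c \<in> ?V" "d \<in> ?V" "?I c m" "?I d m" using two[OF lm(2)] by blast
    have meet: "x = z" if "x \<in> ?V" "?I x l" "?I x m" for x
      using uniq[OF lm] that z sym by blast
    have join: "k = k'" if "x \<noteq> y" "x \<in> ?V" "y \<in> ?V" "k \<in> ?V" "k' \<in> ?V" "?I x k" "?I y k" "?I x k'" "?I y k'" for x y k k'
      using uniq[of x y] that sym by blast
    have ne: "a \<noteq> c" "a \<noteq> d" "b \<noteq> c" "b \<noteq> d" using meet ab cd by blast+
    have "\<not> (\<exists>T\<subseteq>{a,b,c,d}. card T = 3 \<and> (\<exists>k\<in>?V. \<forall>x\<in>T. ?I x k))"
    proof
      assume "\<exists>T\<subseteq>{a,b,c,d}. card T = 3 \<and> (\<exists>k\<in>?V. \<forall>x\<in>T. ?I x k)"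
      then obtain T k where T: "T \<subseteq> {a,b,c,d}" "card T = 3" and k: "k \<in> ?V" "\<And>x. x \<in> T \<Longrightarrow> ?I x k" by blast
      have small: "\<not> T \<subseteq> {u, v}" for u v
      proof
        assume "T \<subseteq> {u, v}"
        then have "card T \<le> card {u, v}" by (rule card_mono[rotated]) simp
        also have "\<dots> \<le> 2" by (simp add: card_insert_if)
        finally show False using T(2) by simp
      qed
      have "a \<in> T \<and> b \<in> T \<or> c \<in> T \<and> d \<in> T"
        using T(1) small[of a c] small[of a d] small[of b c] small[of b d] by blast
      then show False
      proof
        assume "a \<in> T \<and> b \<in> T"
        then have "k = l" using join[of a b k l] ab lm k by blast
        moreover have "c \<in> T \<or> d \<in> T" using T(1) small[of a b] by blast
        ultimately show False using k meet cd by blast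
      next
        assume "c \<in> T \<and> d \<in> T"
        then have "k = m" using join[of c d k m] cd lm k by blast
        moreover have "a \<in> T \<or> b \<in> T" using T(1) small[of c d] by blast
        ultimately show False using k meet ab by blast
      qed
    qed
    moreover have "card {a,b,c,d} = 4" using ne ab cd by (simp add: card_insert_if)
    ultimately show ?thesis using ab cd by (intro exI[of _ "{a,b,c,d}"]) auto
  qed
  have plane: "finite_projective_plane ?V ?V ?I q"
  proof
    fix x y assume "x \<in> ?V" "y \<in> ?V" "x \<noteq> y"
    then show "\<exists>!l. l \<in> ?V \<and> ?I x l \<and> ?I y l" using uniq[of x y] sym by simp
  next
    fix x y assume "x \<in> ?V" "y \<in> ?V" "x \<noteq> y"
    then show "\<exists>!z. z \<in> ?V \<and> ?I z x \<and> ?I z y" using uniq[of x y] sym by simp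
  qed (use quad line pair_finite_verts in auto)
  have "polarity ?V ?V ?I ?\<phi>"
    unfolding polarity_def
  proof (intro conjI)
    show "bij_betw ?\<phi> (?V <+> ?V) (?V <+> ?V)"
      by (rule bij_betw_byWitness[where f' = ?\<phi>]) auto
  qed (use sym in \<open>auto simp: image_image\<close>)
  moreover have "absolute_points ?V ?I ?\<phi> = {x \<in> ?V. card {z. (x, z) \<in> parcs G} = q}"
    by (auto simp: absolute_points_def loop_adj_def)
  ultimately have pol: "orthogonal_polarity ?V ?V ?I q ?\<phi>"
    using pat by (simp add: orthogonal_polarity_def orthogonal_pattern_def)
  have "polarity_graph ?V ?I ?\<phi> = G"
    by (rule pair_pre_digraph.equality) (auto simp: polarity_graph_def loop_adj_def dest: in_arcsD1 in_arcsD2 no_loops')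
  moreover have "digraph_iso G G"
  proof -
    let ?h = "\<lparr>iso_verts = id, iso_arcs = id, iso_head = snd, iso_tail = fst\<rparr>"
    have "digraph_isomorphism ?h" unfolding digraph_isomorphism_def using wf_digraph by simp
    moreover have "with_proj G = app_iso ?h (with_proj G)" by (simp add: app_iso_def with_proj_def)
    ultimately show ?thesis unfolding digraph_iso_def by blast
  qed
  ultimately show ?thesis using orthogonal_polarity_graphI[OF plane pol] by simp
qed

text \<open>The polarity identifies each line with a point through \<open>lam\<close>, which turns
  incidence into a symmetric relation \<open>I\<close> on the vertices. A line has q + 1 points and
  a vertex is not adjacent to itself, so the degree is q exactly at absolute points: the degrees
  recover the loops, and \<open>I\<close> agrees with \<open>loop_adj\<close>.\<close>

lemma orthogonal_polarity_graph_pattern: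
  fixes G :: "'a pair_pre_digraph"
  assumes G: "pair_graph G" and opg: "orthogonal_polarity_graph q G"
  shows "orthogonal_pattern q G"
proof -
  interpret pair_graph G by (rule G)
  obtain Pt L inc \<phi> where plane: "finite_projective_plane (Pt :: nat set) (L :: nat set) inc q"
    and op: "orthogonal_polarity Pt L inc q \<phi>" and iso: "digraph_iso G (polarity_graph Pt inc \<phi>)"
    using opg unfolding orthogonal_polarity_graph_def by blast
  interpret pl: finite_projective_plane Pt L inc q by (rule plane)
  let ?H = "polarity_graph Pt inc \<phi>" and ?V = "pverts G"
  obtain f where f: "digraph_isomorphism f" and H: "with_proj ?H = app_iso f (with_proj G)"
    using iso unfolding digraph_iso_def by blast
  define g where "g = iso_verts f"
  have gP: "g ` ?V = Pt"
    using arg_cong[OF H, of verts] by (simp add: g_def polarity_graph_def)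
  have ginj: "inj_on g ?V" using f by (simp add: digraph_isomorphism_def g_def)
  \<comment> \<open>An isomorphism maps arcs by a function of its own. Since tails and heads are the
    components of an arc, that function must act as \<open>map_prod g g\<close> on arcs.\<close>
  have arcs: "parcs ?H = map_prod g g ` parcs G"
  proof -
    have "iso_arcs f a = map_prod g g a" if "a \<in> parcs G" for a
    proof -
      have "fst (iso_arcs f a) = g (fst a)" "snd (iso_arcs f a) = g (snd a)"
        using f that arg_cong[OF H, of tail] arg_cong[OF H, of head] by (auto simp: digraph_isomorphism_def g_def)
      then show ?thesis by (simp add: prod_eq_iff)
    qed
    moreover have "parcs ?H = iso_arcs f ` parcs G" using arg_cong[OF H, of arcs] by simp
    ultimately show ?thesis by (simp cong: image_cong)
  qed
  have im: "\<phi> ` Inl ` Pt = Inr ` L" "\<phi> ` Inr ` L = Inl ` Pt"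
    and inv: "\<forall>z\<in>Pt <+> L. \<phi> (\<phi> z) = z"
    and pinc: "\<forall>x\<in>Pt. \<forall>l\<in>L. inc x l \<longleftrightarrow> inc (projl (\<phi> (Inr l))) (projr (\<phi> (Inl x)))"
    and abs: "card (absolute_points Pt inc \<phi>) = q + 1"
    using op by (auto simp: orthogonal_polarity_def polarity_def)
  define lam where "lam x = projr (\<phi> (Inl x))" for x
  have lam: "\<phi> (Inl x) = Inr (lam x)" "lam x \<in> L" if "x \<in> Pt" for x
  proof -
    have "\<phi> (Inl x) \<in> Inr ` L" using that im by blast
    then show "\<phi> (Inl x) = Inr (lam x)" "lam x \<in> L" by (auto simp: lam_def)
  qed
  have phil: "\<phi> (Inr (lam x)) = Inl x" if "x \<in> Pt" for x
    using inv lam[OF that] that by (metis InlI)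
  have lam_inj: "x = y" if "x \<in> Pt" "y \<in> Pt" "lam x = lam y" for x y using phil that by (metis sum.inject(1))
  have lam_surj: "\<exists>x\<in>Pt. lam x = l" if "l \<in> L" for l
  proof -
    have "Inr l \<in> \<phi> ` Inl ` Pt" using that im by blast
    then obtain x where x: "x \<in> Pt" "Inr l = \<phi> (Inl x)" by blast
    then have "lam x = l" using lam(1)[OF x(1)] by simp
    then show ?thesis using x(1) by blast
  qed
  have incsym: "inc x (lam y) \<longleftrightarrow> inc y (lam x)" if "x \<in> Pt" "y \<in> Pt" for x y
    using pinc[rule_format, OF that(1) lam(2)[OF that(2)]] phil[OF that(2)] lam_def by simp
  define I where "I x y = inc (g x) (lam (g y))" for x y
  have gV: "g x \<in> Pt" if "x \<in> ?V" for x using that gP by auto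
  have Isym: "I x y \<longleftrightarrow> I y x" if "x \<in> ?V" "y \<in> ?V" for x y using incsym gV that by (simp add: I_def)
  have arcI: "(x, y) \<in> parcs G \<longleftrightarrow> x \<in> ?V \<and> y \<in> ?V \<and> x \<noteq> y \<and> I x y" for x y
  proof (cases "x \<in> ?V \<and> y \<in> ?V")
    case True
    then have geq: "g x = g y \<longleftrightarrow> x = y" using ginj by (auto dest: inj_onD)
    have "(x, y) \<in> parcs G \<longleftrightarrow> (g x, g y) \<in> parcs ?H"
    proof
      assume "(g x, g y) \<in> parcs ?H"
      then obtain x' y' where "(x', y') \<in> parcs G" "g x' = g x" "g y' = g y" unfolding arcs by auto
      moreover from this have "x' = x" "y' = y" using ginj True by (auto dest: in_arcsD1 in_arcsD2 inj_onD)
      ultimately show "(x, y) \<in> parcs G" by simp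
    qed (auto simp: arcs)
    also have "\<dots> \<longleftrightarrow> x \<noteq> y \<and> I x y" using True gV geq by (auto simp: polarity_graph_def I_def lam_def)
    finally show ?thesis using True by blast
  qed (auto dest: in_arcsD1 in_arcsD2)
  have line: "card {x \<in> ?V. I x y} = q + 1" if "y \<in> ?V" for y
  proof -
    have "{p \<in> Pt. inc p (lam (g y))} = g ` {x \<in> ?V. I x y}" using gP by (auto simp: I_def)
    moreover have "inj_on g {x \<in> ?V. I x y}" using ginj by (rule inj_on_subset) auto
    ultimately show ?thesis using pl.order[OF lam(2)[OF gV[OF that]]] by (simp add: card_image)
  qed
  have deg: "card {z. (x, z) \<in> parcs G} = (if I x x then q else q + 1)" if x: "x \<in> ?V" for x
  proof -
    have "{z. (x, z) \<in> parcs G} = {z \<in> ?V. I z x} - {x}" using arcI Isym x by auto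
    then show ?thesis using line[OF x] pair_finite_verts x by (simp add: card_Diff_singleton_if)
  qed
  have loopsI: "loop_adj q G x y \<longleftrightarrow> I x y" if "x \<in> ?V" "y \<in> ?V" for x y
  proof (cases "x = y")
    case True
    have "loop_adj q G x x \<longleftrightarrow> (if I x x then q else q + 1) = q" unfolding loop_adj_def deg[OF that(1)] by simp
    also have "\<dots> \<longleftrightarrow> I x x" by simp
    finally show ?thesis unfolding True .
  next
    case False
    then have "loop_adj q G x y \<longleftrightarrow> (x, y) \<in> parcs G" by (simp add: loop_adj_def)
    also have "\<dots> \<longleftrightarrow> I x y" using arcI[of x y] that False by blast
    finally show ?thesis .
  qed
  have uniq: "\<exists>!z. z \<in> ?V \<and> loop_adj q G x z \<and> loop_adj q G z y" if xy: "x \<in> ?V" "y \<in> ?V" "x \<noteq> y" for x y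
  proof -
    have gne: "g x \<noteq> g y" using ginj xy by (auto dest: inj_onD)
    obtain l where l: "l \<in> L" "inc (g x) l" "inc (g y) l" and lu: "\<And>m. m \<in> L \<Longrightarrow> inc (g x) m \<Longrightarrow> inc (g y) m \<Longrightarrow> m = l"
      using pl.unique_line[OF gV[OF xy(1)] gV[OF xy(2)] gne] by blast
    obtain z where z: "z \<in> ?V" "lam (g z) = l" using lam_surj[OF l(1)] gP by auto
    show ?thesis
    proof (rule ex1I[of _ z])
      have "I x z" "I y z" using l z(2) by (simp_all add: I_def)
      then have "loop_adj q G x z" "loop_adj q G z y"
        using loopsI[OF xy(1) z(1)] loopsI[OF z(1) xy(2)] Isym[OF z(1) xy(2)] by blast+
      then show "z \<in> ?V \<and> loop_adj q G x z \<and> loop_adj q G z y" using z(1) by blast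
      fix w assume w: "w \<in> ?V \<and> loop_adj q G x w \<and> loop_adj q G w y"
      then have wV: "w \<in> ?V" by blast
      have "I x w" "I y w" using w loopsI[OF xy(1) wV] loopsI[OF wV xy(2)] Isym[OF wV xy(2)] by blast+
      then have "lam (g w) = lam (g z)" unfolding I_def z(2) by (rule lu[OF lam(2)[OF gV[OF wV]]])
      then have "g w = g z" by (rule lam_inj[OF gV[OF wV] gV[OF z(1)]])
      then show "w = z" by (rule inj_onD[OF ginj _ wV z(1)])
    qed
  qed
  have "absolute_points Pt inc \<phi> = g ` {x \<in> ?V. I x x}"
    using gP by (auto simp: absolute_points_def I_def lam_def)
  moreover have "inj_on g {x \<in> ?V. I x x}" using ginj by (rule inj_on_subset) auto
  ultimately have "card {x \<in> ?V. I x x} = q + 1" using abs by (simp add: card_image)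
  moreover have "card {z. (x, z) \<in> parcs G} = q \<longleftrightarrow> I x x" if "x \<in> ?V" for x using deg[OF that] by simp
  then have "{x \<in> ?V. I x x} = {x \<in> ?V. card {z. (x, z) \<in> parcs G} = q}" by blast
  ultimately have "card {x \<in> ?V. card {z. (x, z) \<in> parcs G} = q} = q + 1" by (simp only:)
  moreover have "card {z. (x, z) \<in> parcs G} \<in> {q, q + 1}" if "x \<in> ?V" for x using deg[OF that] by simp
  ultimately show ?thesis using uniq unfolding orthogonal_pattern_def by blast
qed

lemma Ex1_iff_card: "(\<exists>!x. P x) \<longleftrightarrow> card {x. P x} = 1"
  unfolding One_nat_def card_1_singleton_iff set_eq_iff by auto

theorem corollary1p5:
  fixes q n :: nat and G :: "'a pair_pre_digraph"
  assumes "2 \<le> q"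
    and "n = q\<^sup>2 + q + 1"
    and "pair_graph G"
    and "Digraph_Component.connected G"
    and "C4_free G"
    and "card (pverts G) = n"
    and "real (card (edges G)) \<le> 1 / 2 * real q * (real q + 1)\<^sup>2"
  shows "real (num_spanning_trees G) \<le> real n powr ((real n - 3) / 2) \<and>
    (real (num_spanning_trees G) = real n powr ((real n - 3) / 2)
       \<longleftrightarrow> orthogonal_polarity_graph q G)"
proof -
  interpret pair_graph G by (rule assms(3))
  obtain h where h: "bij_betw h {..<n} (pverts G)"
    using ex_bij_betw_nat_finite[OF pair_finite_verts] assms(6) by (auto simp: atLeast0LessThan)
  interpret labelled_pair_graph G n h
    by unfold_locales (use h assms(2) in auto)
  have nbrs: "{z. (h i, z) \<in> parcs G} = h ` {j. j < n \<and> adj i j}" if "i < n" for i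
  proof (intro subset_antisym subsetI)
    fix z assume z: "z \<in> {z. (h i, z) \<in> parcs G}"
    then have "z \<in> h ` {..<n}" unfolding label_image using in_arcsD2 by blast
    then show "z \<in> h ` {j. j < n \<and> adj i j}" using z that by (auto simp: adj_def)
  qed (auto simp: adj_def)
  have inj: "inj_on h S" if "S \<subseteq> {..<n}" for S using label that by (auto simp: bij_betw_def intro: inj_on_subset)
  \<comment> \<open>Two common neighbours of a pair would form a 4-cycle with it, and the degree sum
    counts arcs, at most two per edge.\<close>
  interpret S: sparse_c4_free n q adj
  proof
    fix i j assume ij: "i < n" "j < n" "i \<noteq> j"
    show "card {k. k < n \<and> adj i k \<and> adj k j} \<le> 1"
    proof -
      have "k = l" if "k < n" "l < n" "adj i k" "adj k j" "adj i l" "adj l j" for k l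
        using C4_free_common_neighbours[OF assms(3,5), of "h i" "h j" "h k" "h l"] that ij inj_label
        by (auto simp: adj_def)
      then show ?thesis by (simp add: card_le_Suc0_iff_eq)
    qed
  next
    have "(\<Sum>i<n. card {j. j < n \<and> adj i j}) = card (SIGMA i:{..<n}. {j. j < n \<and> adj i j})" by simp
    also have "\<dots> \<le> card (parcs G)"
    proof (rule card_inj_on_le[where f = "map_prod h h"])
      show "inj_on (map_prod h h) (SIGMA i:{..<n}. {j. j < n \<and> adj i j})"
        by (rule inj_on_subset[OF map_prod_inj_on[OF inj[OF subset_refl] inj[OF subset_refl]]]) auto
    qed (auto simp: adj_def pair_finite_arcs)
    also have "\<dots> \<le> 2 * card (edges G)" by (rule card_parcs_le[OF assms(3)])
    also have "\<dots> \<le> q * (q + 1)\<^sup>2"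
    proof -
      have "real (2 * card (edges G)) \<le> real (q * (q + 1)\<^sup>2)" using assms(7) by (simp add: ac_simps)
      then show ?thesis by (simp only: of_nat_le_iff)
    qed
    finally show "(\<Sum>i<n. card {j. j < n \<and> adj i j}) \<le> q * (q + 1)\<^sup>2" .
  qed (use assms(1,2) adj_sym adj_irrefl in auto)
  have deg: "card {z. (h i, z) \<in> parcs G} = S.deg i" if "i < n" for i
    unfolding nbrs[OF that] S.deg_def by (rule card_image) (rule inj, auto)
  have loop_adj: "loop_adj q G (h i) (h j) \<longleftrightarrow> S.incident i j" if "i < n" "j < n" for i j
  proof (cases "i = j")
    case True
    show ?thesis unfolding loop_adj_def S.incident_def True deg[OF that(2)] by simp
  next
    case False
    then show ?thesis using that inj_label[OF that] by (simp add: loop_adj_def S.incident_def adj_def)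
  qed
  have joins: "card {z. z \<in> pverts G \<and> loop_adj q G (h i) z \<and> loop_adj q G z (h j)} = card (S.joins i j)"
    if "i < n" "j < n" for i j
  proof -
    have "{z. z \<in> pverts G \<and> loop_adj q G (h i) z \<and> loop_adj q G z (h j)} = h ` S.joins i j"
      using that loop_adj unfolding S.joins_def label_image[symmetric] by blast
    moreover have "inj_on h (S.joins i j)" by (rule inj) (auto simp: S.joins_def)
    ultimately show ?thesis by (simp add: card_image)
  qed
  have absolute: "card {x \<in> pverts G. card {z. (x, z) \<in> parcs G} = q} = card {i. i < n \<and> S.deg i = q}"
  proof -
    have "{x \<in> pverts G. card {z. (x, z) \<in> parcs G} = q} = h ` {i. i < n \<and> S.deg i = q}"
      using deg unfolding label_image[symmetric] by auto
    moreover have "inj_on h {i. i < n \<and> S.deg i = q}" by (rule inj) auto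
    ultimately show ?thesis by (simp add: card_image)
  qed
  have "orthogonal_pattern q G \<longleftrightarrow>
     (\<forall>i<n. \<forall>j<n. h i \<noteq> h j \<longrightarrow> card {z. z \<in> pverts G \<and> loop_adj q G (h i) z \<and> loop_adj q G z (h j)} = 1) \<and>
     (\<forall>i<n. card {z. (h i, z) \<in> parcs G} \<in> {q, q + 1}) \<and>
     card {x \<in> pverts G. card {z. (x, z) \<in> parcs G} = q} = q + 1"
    unfolding orthogonal_pattern_def Ex1_iff_card label_image[symmetric] ball_simps by blast
  also have "\<dots> \<longleftrightarrow> S.orthogonal"
    unfolding S.orthogonal_def S.regular_degrees_def absolute using deg joins inj_label by auto
  finally have pattern: "orthogonal_pattern q G \<longleftrightarrow> S.orthogonal" .
  have "1 < card (pverts G)" using assms(1,2,6) by simp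
  then have "orthogonal_polarity_graph q G \<longleftrightarrow> S.orthogonal"
    using orthogonal_patternI_plane[OF assms(3,1)] orthogonal_polarity_graph_pattern[OF assms(3)] pattern by blast
  moreover have "real (num_spanning_trees G) = S.tau" by (simp add: num_spanning_trees_eq S.tau_def)
  ultimately show ?thesis using S.tau_bound by simp
qed

end
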